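(* Let $k,n\ge1$, let $\bar\alpha=(\alpha_1,\dots,\alpha_n)$ and $\bar z=(z_1,\dots,z_k)$ be sequences of pairwise distinct complex numbers, and let $(\boldsymbol l,\boldsymbol m)\in\mathcal Z_{kn}$ with $\boldsymbol l=(l_1,\dots,l_k)$, $\boldsymbol m=(m_1,\dots,m_n)$. Put $\mu^{(i)}=(m_i,0,0,\dots)$ and $\lambda^{(a)}=(1,\dots,1,0,\dots)$ with $l_a$ ones. Let $V$ be a space of quasi-exponentials with data $(\bar\mu,\bar\lambda;\bar\alpha,\bar z)$, let $D_V^{\mathrm{aug}}=(d/dx)^n+\sum_{i=1}^n b_i(x)(d/dx)^{n-i}$, and let $v\in\mathfrak P_{kn}[\boldsymbol l,\boldsymbol m]$ be a nonzero vector with $\pi^{\langle n\rangle}_{\bar z}(B^{\langle n\rangle}_i(x))\,v=b_i(x)\,v$ for $i=1,\dots,n$ (an equality of series in $x^{-1}$, with $b_i$ expanded at $x=\infty$). Let $\widetilde D_V$ be defined by $$\widetilde D_V=(-1)^{M'}\prod_{i=1}^n(x+\alpha_i)^{(\mu^{(i)})'_1}\,\bigl(D_V^{-1}\bigr)^{\#}\,\prod_{a=1}^k\Bigl(\frac d{dx}-z_a\Bigr)^{\lambda^{(a)}_1},\qquad M'=\dim V,$$ let $\tilde V=\ker\widetilde D_V$ and $\widetilde D_V^{\mathrm{aug}}=\widetilde D_V\prod_{a:\,l_a=0}(d/dx-z_a)=(d/dx)^k+\sum_{a=1}^k\tilde b_a(x)(d/dx)^{k-a}$. Then, for generic $\bar\alpha,\bar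 z$, the vector $v$ is an eigenvector of the action $\pi^{\langle k\rangle}_{-\bar\alpha}$ of $\mathcal B^{\langle k\rangle}_{\bar z}$ corresponding to $\tilde V$, that is, $\pi^{\langle k\rangle}_{-\bar\alpha}(B^{\langle k\rangle}_a(x))\,v=\tilde b_a(x)\,v$ for $a=1,\dots,k$.
   Context: $\mathfrak P_{kn}$ is the space of polynomials in pairwise anticommuting variables $\xi_{ai}$ ($a\le k$, $i\le n$); $\partial_{ai}$ is the left derivation: on a monomial $\xi_{c_1}\cdots\xi_{c_l}$ it gives $(-1)^{s-1}$ times the monomial with the $s$-th factor removed if $c_s=(a,i)$, and $0$ otherwise. $\mathcal Z_{kn}$ is the set of pairs $(\boldsymbol l,\boldsymbol m)\in\mathbb Z_{\ge0}^k\times\mathbb Z_{\ge0}^n$ with $l_a\le n$, $m_i\le k$, $\sum l_a=\sum m_i$; $\mathfrak P_{kn}[\boldsymbol l,\boldsymbol m]$ is the span of monomials $\prod\xi_{ai}^{d_{ai}}$ ($d_{ai}\in\{0,1\}$) with $\sum_a d_{ai}=m_i$ and $\sum_i d_{ai}=l_a$. Actions: $\pi^{\langle n\rangle}_{\bar z}(e^{\langle n\rangle}_{ij}\otimes t^s)=\sum_a z_a^s\xi_{ai}\partial_{aj}$, $\pi^{\langle k\rangle}_{-\bar\alpha}(e^{\langle k\rangle}_{ab}\otimes t^s)=\sum_i(-\alpha_i)^s\xi_{ai}\partial_{bi}$. Bethe algebra: for $\mathfrak{gl}_N[t]$ with generators $e_{ij}$, $g(x)=\sum_{s\ge0}(g\otimes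 t^s)x^{-s-1}$; for pairwise distinct $\bar\beta\in\mathbb C^N$, $\operatorname{rdet}\bigl((\tfrac d{dx}-\beta_i)\delta_{ij}-e_{ji}(x)\bigr)_{i,j=1}^N=(d/dx)^N+\sum_{i=1}^N B_i(x)(d/dx)^{N-i}$ (powers of $d/dx$ moved to the right; $\operatorname{rdet}A=\sum_\sigma(-1)^\sigma a_{1\sigma(1)}\cdots a_{N\sigma(N)}$), $B_i(x)=\sum_{j\ge0}B_{ij}x^{-j}$; $\mathcal B^{\langle N\rangle}_{\bar\beta}$ is generated by $B_{ij}$, $j\ge1$. Here $B^{\langle n\rangle}_i$ is built with $\bar\beta=\bar\alpha$ and $B^{\langle k\rangle}_a$ with $\bar\beta=\bar z$. Partitions, conjugates $\mu'$, spaces of quasi-exponentials: for pairwise distinct $\alpha_i$, $z_a$ and partitions $\mu^{(i)},\lambda^{(a)}$, $V$ is a space of quasi-exponentials with data $(\bar\mu,\bar\lambda;\bar\alpha,\bar z)$ if it has a basis $q_{ij}(x)e^{\alpha_ix}$ ($\mu^{(i)}\ne0$, $j\le(\mu^{(i)})'_1$) with $\deg q_{ij}=(\mu^{(i)})'_1+\mu^{(i)}_j-j$, its singular points are exactly the $z_a$ with $\lambda^{(a)}\ne0$, and its exponents at such $z_a$ are $M'+\lambda^{(a)}_j-j$, $j=1,\dots,M'$, $M'=\dim V$ (exponents at $z$: integers $e_1>\dots>e_{M'}$ with $f_j\in V$, $f_j=(x-z)^{e_j}(1+o(1))$; $z$ singular if exponents $\ne\{0,\dots,M'-1\}$). $D_V$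 is the monic order-$M'$ differential operator with kernel $V$; $D_V^{\mathrm{aug}}=D_V\prod_{i:\,\mu^{(i)}=0}(d/dx-\alpha_i)$. $\Psi\mathfrak D$ is the algebra of pseudodifferential operators $\sum_{m\le M}\sum_{k\le K}C_{km}x^k(d/dx)^m$ with $(d/dx)^mx^k=\sum_{j\ge0}\frac{(m)_j(k)_j}{j!}x^{k-j}(d/dx)^{m-j}$; rational coefficients are replaced by Laurent series at infinity; $(\sum C_{km}x^k(d/dx)^m)^\dagger=\sum C_{km}(-d/dx)^mx^k$, $(\sum C_{km}x^k(d/dx)^m)^\ddagger=\sum C_{km}x^m(d/dx)^k$, $D^\#=(D^\dagger)^\ddagger$. *)

theory Defs
  imports Complex_Main "HOL-Analysis.Derivative" "HOL-Combinatorics.Permutations"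
    "HOL-Computational_Algebra.Polynomial" "HOL-Library.Function_Algebras"
begin

(* ===== Indexing conventions =====
   Variables xi_{ai} are indexed 0-based: a < k, i < n (paper: 1-based).
   Partitions are functions nat => nat with parts indexed from 1. *)

(* ===== The Grassmann algebra P_kn =====
   A vector is given by its coefficients on the monomials; a monomial is the
   set S of variables (a,i) occurring in it, written in increasing
   lexicographic order of (a,i). *)
type_synonym gvec = "(nat \<times> nat) set \<Rightarrow> complex"
type_synonym gop = "gvec \<Rightarrow> gvec"

definition lexless :: "nat \<times> nat \<Rightarrow> nat \<times> nat \<Rightarrow> bool" where
  "lexless c d \<longleftrightarrow> fst c < fst d \<or> (fst c = fst d \<and> snd c < snd d)"

definition gscale :: "complex \<Rightarrow> gvec \<Rightarrow> gvec" where
  "gscale c w = (\<lambda>S. c * w S)"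

definition op_scale :: "complex \<Rightarrow> gop \<Rightarrow> gop" where
  "op_scale c A = (\<lambda>w. gscale c (A w))"

(* left multiplication by xi_c *)
definition xi :: "nat \<times> nat \<Rightarrow> gop" where
  "xi c w = (\<lambda>S. if c \<in> S then (-1) ^ card {d \<in> S. lexless d c} * w (S - {c}) else 0)"

(* left derivation partial_c *)
definition dd :: "nat \<times> nat \<Rightarrow> gop" where
  "dd c w = (\<lambda>S. if c \<notin> S then (-1) ^ card {d \<in> S. lexless d c} * w (insert c S) else 0)"

definition Pkn_wt :: "nat \<Rightarrow> nat \<Rightarrow> (nat \<Rightarrow> nat) \<Rightarrow> (nat \<Rightarrow> nat) \<Rightarrow> gvec set" where
  "Pkn_wt k n l m = {v. \<forall>S. v S \<noteq> 0 \<longrightarrow>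
      S \<subseteq> {..<k} \<times> {..<n} \<and> (\<forall>a<k. card {i. (a,i) \<in> S} = l a)
      \<and> (\<forall>i<n. card {a. (a,i) \<in> S} = m i)}"

definition Zkn :: "nat \<Rightarrow> nat \<Rightarrow> ((nat \<Rightarrow> nat) \<times> (nat \<Rightarrow> nat)) set" where
  "Zkn k n = {(l,m). (\<forall>a<k. l a \<le> n) \<and> (\<forall>i<n. m i \<le> k) \<and> (\<Sum>a<k. l a) = (\<Sum>i<n. m i)}"

(* representations: images of e_{ij} (x) t^s *)
definition pi_n :: "nat \<Rightarrow> (nat \<Rightarrow> complex) \<Rightarrow> nat \<Rightarrow> nat \<Rightarrow> nat \<Rightarrow> gop" where
  "pi_n k z s i j = (\<Sum>a<k. op_scale (z a ^ s) (xi (a,i) \<circ> dd (a,j)))"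

definition pi_k :: "nat \<Rightarrow> (nat \<Rightarrow> complex) \<Rightarrow> nat \<Rightarrow> nat \<Rightarrow> nat \<Rightarrow> gop" where
  "pi_k n alpha s a b = (\<Sum>i<n. op_scale ((- alpha i) ^ s) (xi (a,i) \<circ> dd (b,i)))"

definition ff :: "int \<Rightarrow> nat \<Rightarrow> complex" where
  "ff m j = (\<Prod>i<j. of_int (m - int i))"

(* ===== Operator-valued differential operators:  F kk m  is the coefficient
   (an operator on P_kn) of  x^kk (d/dx)^m,  normally ordered (d/dx to the right). *)
type_synonym opser = "int \<Rightarrow> int \<Rightarrow> gop"

definition os_one :: opser where
  "os_one a b = (if a = 0 \<and> b = 0 then id else 0)"

definition os_scale :: "complex \<Rightarrow> opser \<Rightarrow> opser" where
  "os_scale c F = (\<lambda>a b. op_scale c (F a b))"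

definition osmult :: "opser \<Rightarrow> opser \<Rightarrow> opser" where
  "osmult F G a b = (\<Sum>(j,kk,m,k2,m2) \<in> {(j::nat,kk,m,k2,m2). F kk m \<noteq> 0 \<and> G k2 m2 \<noteq> 0
        \<and> kk + k2 - int j = a \<and> m + m2 - int j = b}.
      op_scale (ff m j * ff k2 j / fact j) (F kk m \<circ> G k2 m2))"

definition rdet :: "nat \<Rightarrow> (nat \<Rightarrow> nat \<Rightarrow> opser) \<Rightarrow> opser" where
  "rdet N A = (\<Sum>\<sigma> \<in> {\<sigma>. \<sigma> permutes {..<N}}.
      os_scale (of_int (sign \<sigma>)) (foldr osmult (map (\<lambda>r. A r (\<sigma> r)) [0..<N]) os_one))"

(* the matrix  ((d/dx - beta_r) delta_rc - e_{cr}(x)),  E s i j = image of e_{ij} (x) t^s,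
   e(x) = sum_s (e (x) t^s) x^(-s-1) *)
definition bethe_mat :: "(nat \<Rightarrow> complex) \<Rightarrow> (nat \<Rightarrow> nat \<Rightarrow> nat \<Rightarrow> gop) \<Rightarrow> nat \<Rightarrow> nat \<Rightarrow> opser" where
  "bethe_mat beta E r c = (\<lambda>kk m.
      (if r = c then (if kk = 0 \<and> m = 1 then id
                      else if kk = 0 \<and> m = 0 then op_scale (- beta r) id else 0) else 0)
      - (if m = 0 \<and> kk \<le> -1 then E (nat (- kk - 1)) c r else 0))"

(* image of B_i(x): its coefficient of x^kk (kk <= 0), i.e. B_{i,-kk} *)
definition bethe_coeff :: "nat \<Rightarrow> (nat \<Rightarrow> complex) \<Rightarrow> (nat \<Rightarrow> nat \<Rightarrow> nat \<Rightarrow> gop) \<Rightarrow> nat \<Rightarrow> int \<Rightarrow> gop" where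
  "bethe_coeff N beta E i kk = rdet N (bethe_mat beta E) kk (int N - int i)"

(* ===== Pseudodifferential operators: f kk m = coefficient C_{kk m} of x^kk (d/dx)^m ===== *)
type_synonym psd = "int \<Rightarrow> int \<Rightarrow> complex"

definition psd_valid :: "psd \<Rightarrow> bool" where
  "psd_valid f \<longleftrightarrow> (\<exists>K M. \<forall>kk m. f kk m \<noteq> 0 \<longrightarrow> kk \<le> K \<and> m \<le> M)"

definition psd_one :: psd where
  "psd_one a b = (if a = 0 \<and> b = 0 then 1 else 0)"

definition psd_const :: "complex \<Rightarrow> psd" where
  "psd_const c a b = (if a = 0 \<and> b = 0 then c else 0)"

(* product, using (d/dx)^m x^k = sum_j (m)_j (k)_j / j! x^(k-j) (d/dx)^(m-j) *)
definition psd_mult :: "psd \<Rightarrow> psd \<Rightarrow> psd" where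
  "psd_mult f g a b = (\<Sum>(j,kk,m,k2,m2) \<in> {(j::nat,kk,m,k2,m2). f kk m \<noteq> 0 \<and> g k2 m2 \<noteq> 0
        \<and> kk + k2 - int j = a \<and> m + m2 - int j = b}.
      f kk m * g k2 m2 * ff m j * ff k2 j / fact j)"

definition psd_prod :: "psd list \<Rightarrow> psd" where
  "psd_prod xs = foldr psd_mult xs psd_one"

definition psd_pow :: "psd \<Rightarrow> nat \<Rightarrow> psd" where
  "psd_pow D e = (psd_mult D ^^ e) psd_one"

definition psd_inv :: "psd \<Rightarrow> psd" where
  "psd_inv D = (THE E. psd_valid E \<and> psd_mult D E = psd_one)"

(* dagger: sum C x^k (d/dx)^m  |->  sum C (-d/dx)^m x^k, normally ordered *)
definition psd_dag :: "psd \<Rightarrow> psd" where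
  "psd_dag f a b = (\<Sum>(j,kk,m) \<in> {(j::nat,kk,m). f kk m \<noteq> 0 \<and> kk - int j = a \<and> m - int j = b}.
      (if even m then 1 else -1) * f kk m * ff m j * ff kk j / fact j)"

definition psd_ddag :: "psd \<Rightarrow> psd" where
  "psd_ddag f a b = f b a"

definition psd_sharp :: "psd \<Rightarrow> psd" where
  "psd_sharp f = psd_ddag (psd_dag f)"

definition psd_poly :: "complex poly \<Rightarrow> psd" where
  "psd_poly P a b = (if b = 0 \<and> a \<ge> 0 then coeff P (nat a) else 0)"

definition psd_dminus :: "complex \<Rightarrow> psd" where
  "psd_dminus c a b = (if a = 0 then (if b = 1 then 1 else if b = 0 then - c else 0) else 0)"

(* Laurent expansion at x = infinity of the rational function p/q:
   c kk = coefficient of x^kk *)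
definition lexp :: "complex poly \<Rightarrow> complex poly \<Rightarrow> int \<Rightarrow> complex" where
  "lexp p q = (THE c. (\<exists>K. \<forall>kk>K. c kk = 0) \<and>
      (\<forall>a. (\<Sum>i\<le>degree q. coeff q i * c (a - int i)) = (if a \<ge> 0 then coeff p (nat a) else 0)))"

definition conj1 :: "(nat \<Rightarrow> nat) \<Rightarrow> nat" where
  "conj1 mu = card {j. 1 \<le> j \<and> mu j \<noteq> 0}"

definition mu_of :: "(nat \<Rightarrow> nat) \<Rightarrow> nat \<Rightarrow> nat \<Rightarrow> nat" where
  "mu_of m i j = (if j = 1 then m i else 0)"

definition lam_of :: "(nat \<Rightarrow> nat) \<Rightarrow> nat \<Rightarrow> nat \<Rightarrow> nat" where
  "lam_of l a j = (if 1 \<le> j \<and> j \<le> l a then 1 else 0)"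

definition qe_index :: "nat \<Rightarrow> (nat \<Rightarrow> nat \<Rightarrow> nat) \<Rightarrow> (nat \<times> nat) set" where
  "qe_index n mu = {(i,j). i < n \<and> 1 \<le> j \<and> j \<le> conj1 (mu i)}"

definition exps :: "(complex \<Rightarrow> complex) set \<Rightarrow> complex \<Rightarrow> nat set" where
  "exps V x = {e. \<exists>f\<in>V. ((\<lambda>y. f y / (y - x) ^ e) \<longlongrightarrow> 1) (at x)}"

definition quasi_exp_space :: "nat \<Rightarrow> nat \<Rightarrow> (nat \<Rightarrow> complex) \<Rightarrow> (nat \<Rightarrow> complex)
    \<Rightarrow> (nat \<Rightarrow> nat \<Rightarrow> nat) \<Rightarrow> (nat \<Rightarrow> nat \<Rightarrow> nat) \<Rightarrow> (complex \<Rightarrow> complex) set \<Rightarrow> bool" where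
  "quasi_exp_space n k alpha z mu lam V \<longleftrightarrow>
    (let I = qe_index n mu; M' = card I in
     (\<exists>q :: nat \<Rightarrow> nat \<Rightarrow> complex poly.
        (\<forall>(i,j)\<in>I. degree (q i j) = conj1 (mu i) + mu i j - j) \<and>
        (\<forall>c. (\<forall>y. (\<Sum>(i,j)\<in>I. c (i,j) * (poly (q i j) y * exp (alpha i * y))) = 0)
              \<longrightarrow> (\<forall>ij\<in>I. c ij = 0)) \<and>
        V = {f. \<exists>c. f = (\<lambda>y. \<Sum>(i,j)\<in>I. c (i,j) * (poly (q i j) y * exp (alpha i * y)))}) \<and>
     (\<forall>x. exps V x \<noteq> {0..<M'} \<longleftrightarrow> (\<exists>a<k. (\<exists>j. lam a j \<noteq> 0) \<and> x = z a)) \<and>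
     (\<forall>a<k. (\<exists>j. lam a j \<noteq> 0) \<longrightarrow>
        exps V (z a) = {M' + lam a j - j | j. 1 \<le> j \<and> j \<le> M'}))"

definition is_DV :: "(complex \<Rightarrow> complex) set \<Rightarrow> nat \<Rightarrow> (nat \<Rightarrow> complex poly) \<Rightarrow> (nat \<Rightarrow> complex poly) \<Rightarrow> bool" where
  "is_DV V M p q \<longleftrightarrow> (\<forall>j<M. q j \<noteq> 0) \<and>
     (\<forall>f\<in>V. \<forall>y. (\<forall>j<M. poly (q j) y \<noteq> 0) \<longrightarrow>
        (deriv ^^ M) f y + (\<Sum>j<M. poly (p j) y / poly (q j) y * (deriv ^^ j) f y) = 0)"

definition DV_psd :: "nat \<Rightarrow> (nat \<Rightarrow> complex poly) \<Rightarrow> (nat \<Rightarrow> complex poly) \<Rightarrow> psd" where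
  "DV_psd M p q = (\<lambda>kk m. if m = int M then (if kk = 0 then 1 else 0)
       else if 0 \<le> m \<and> m < int M then lexp (p (nat m)) (q (nat m)) kk else 0)"

definition DV_aug :: "nat \<Rightarrow> (nat \<Rightarrow> complex) \<Rightarrow> (nat \<Rightarrow> nat \<Rightarrow> nat) \<Rightarrow> psd \<Rightarrow> psd" where
  "DV_aug n alpha mu D = psd_prod (D # [psd_dminus (alpha i). i \<leftarrow> [0..<n], \<forall>j. mu i j = 0])"

definition tDV :: "nat \<Rightarrow> nat \<Rightarrow> (nat \<Rightarrow> complex) \<Rightarrow> (nat \<Rightarrow> complex)
    \<Rightarrow> (nat \<Rightarrow> nat \<Rightarrow> nat) \<Rightarrow> (nat \<Rightarrow> nat \<Rightarrow> nat) \<Rightarrow> nat \<Rightarrow> psd \<Rightarrow> psd" where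
  "tDV n k alpha z mu lam M D = psd_prod (
      [psd_const ((-1) ^ M)]
    @ [psd_pow (psd_poly [:alpha i, 1:]) (conj1 (mu i)). i \<leftarrow> [0..<n]]
    @ [psd_sharp (psd_inv D)]
    @ [psd_pow (psd_dminus (z a)) (lam a 1). a \<leftarrow> [0..<k]])"

definition tDV_aug :: "nat \<Rightarrow> (nat \<Rightarrow> complex) \<Rightarrow> (nat \<Rightarrow> nat) \<Rightarrow> psd \<Rightarrow> psd" where
  "tDV_aug k z l tD = psd_prod (tD # [psd_dminus (z a). a \<leftarrow> [0..<k], l a = 0])"

inductive_set poly_fun :: "nat \<Rightarrow> nat \<Rightarrow> ((nat \<Rightarrow> complex) \<Rightarrow> (nat \<Rightarrow> complex) \<Rightarrow> complex) set"
  for n k where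
  pf_const: "(\<lambda>al z. c) \<in> poly_fun n k"
| pf_alpha: "i < n \<Longrightarrow> (\<lambda>al z. al i) \<in> poly_fun n k"
| pf_z: "a < k \<Longrightarrow> (\<lambda>al z. z a) \<in> poly_fun n k"
| pf_add: "P \<in> poly_fun n k \<Longrightarrow> Q \<in> poly_fun n k \<Longrightarrow> (\<lambda>al z. P al z + Q al z) \<in> poly_fun n k"
| pf_mult: "P \<in> poly_fun n k \<Longrightarrow> Q \<in> poly_fun n k \<Longrightarrow> (\<lambda>al z. P al z * Q al z) \<in> poly_fun n k"

end

theory Submission
  imports Defs "HOL-Computational_Algebra.Formal_Laurent_Series"
begin

text \<open>
  The correspondence is a consequence of an operator identity on the whole Grassmann algebra.
  Let $y_i$, $d_a$ be invertible with $[d_a,y_i]=1$, the $y$'s and the $d$'s commuting among themselves and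
  with the Clifford generators $\xi_{ai},\partial_{ai}$. Then
  \[ \mathrm{rdet}\Bigl(d_a\delta_{ab}-\sum_i\xi_{bi}y_i^{-1}\partial_{ai}\Bigr)\,\prod_a d_a^{-1}\,
     \mathrm{rdet}\Bigl(y_i\delta_{ij}+\sum_a\xi_{aj}\partial_{ai}d_a^{-1}\Bigr)=\prod_i y_i . \]
  With auxiliary odd variables $\theta_a,\psi_i$ the determinants become products of anticommuting forms
  $\Phi_a=\theta_ad_a+\sum_i w_i\partial_{ai}$, $w_i=\sum_b\xi_{bi}\theta_b\,y_i^{-1}$, and
  $\Psi_i=\psi_iy_i-\sum_a\partial_{ai}u_a$, $u_a=\sum_j\xi_{aj}\psi_j\,d_a^{-1}$. Because $w_i$ commutes with
  every $\Phi_a$, the product of the $\Phi_a$ expands in powers of $w_i$, and multiplying by one $\Psi_i$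
  makes this expansion telescope, which removes the index $i$.

  For $d_a=x-z_a$, $y_i=\alpha_i-d/dx$ the second determinant is, up to sign, the generating operator of the
  Bethe algebra of $\mathfrak{gl}_n$, and $\#$ maps the first one to that of $\mathfrak{gl}_k$. On an
  eigenvector the identity therefore expresses one eigenvalue operator through the inverse of the other.
\<close>

section \<open>Pseudodifferential operators with coefficients in an algebra\<close>

text \<open>The entries of the two matrices do not commute, so their determinants cannot be
  multiplied by the usual rule; products of forms keep the row order automatically. The factor prod
  d_a^{-1} has its origin in normal ordering: moving psi_i out of the second matrix shifts y_i by
  sum_a d_a^{-1}, and conjugation by prod d_a produces exactly this shift. The determinants need
  operator coefficients, the eigenvalue operators scalar ones. Hence one type \<open>pdo\<close>
  over a real algebra, used with linear operators and with \<open>complex\<close>. The inverse of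
  the eigenvalue operator is not built as a series. Applied to the eigenvector and read off in one
  coordinate, the identity itself gives a left inverse up to the invertible factor prod (d/dx -
  alpha_i), and the absence of zero divisors makes it two-sided. The auxiliary odd variables require
  no larger space: vectors are functions on arbitrary sets of index pairs, so one more row and one
  more column of generators are at hand.\<close>

definition leibniz :: "int \<Rightarrow> int \<Rightarrow> nat \<Rightarrow> real" where
  "leibniz m k j = fact j * (of_int m gchoose j) * (of_int k gchoose j)"

lemma leibniz_0 [simp]: "leibniz m k 0 = 1"
  by (simp add: leibniz_def)

lemma gchoose_split:
  "((a::real) gchoose j) * ((a - of_nat j) gchoose s) * (fact j * fact s) = (a gchoose (j + s)) * fact (j + s)"
proof -
  have "(a gchoose (j+s)) * (of_nat (j+s) gchoose j) = (a gchoose j) * (a - of_nat j gchoose (j + s - j))"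
    by (rule gbinomial_trinomial_revision) simp
  moreover have "(of_nat (j+s) gchoose j :: real) * (fact j * fact s) = fact (j+s)"
  proof -
    have "real (fact j * fact s * (j + s choose j)) = real (fact (j + s))"
      using binomial_fact_lemma[of j "j+s"] by simp
    thus ?thesis
      unfolding binomial_gbinomial[symmetric] by (simp only: of_nat_mult of_nat_fact mult_ac)
  qed
  ultimately show ?thesis
    by (metis (no_types, lifting) add_diff_cancel_left' mult.assoc)
qed

lemma sum_triple:
  fixes g :: "nat \<Rightarrow> nat \<Rightarrow> nat \<Rightarrow> real"
  shows "(\<Sum>j\<le>J. \<Sum>s\<le>J-j. g j s (J-j-s)) = (\<Sum>t\<le>J. \<Sum>i\<le>J-t. g i (J-t-i) t)"
  unfolding sum.Sigma[OF finite_atMost ballI[OF finite_atMost]]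
  by (rule sum.reindex_bij_witness[where i="\<lambda>(t,i). (i, J-t-i)" and j="\<lambda>(j,s). (J-j-s,j)"]) auto

text \<open>The sides are the two bracketings of a triple product at depth J. Vandermonde's identity
  splits the binomial with a composite upper argument, and both sides become one sum over triples
  with total J: how many derivations of the first monomial hit the second, of the first hit the
  third, of the second hit the third.\<close>

lemma leibniz_assoc:
  "(\<Sum>j\<le>J. leibniz m1 k2 j * leibniz (m1 + m2 - int j) k3 (J - j)) =
   (\<Sum>j\<le>J. leibniz m2 k3 j * leibniz m1 (k2 + k3 - int j) (J - j))" (is "?L = ?R")
proof -
  let ?c = "\<lambda>m j. (of_int m :: real) gchoose j"
  let ?g = "\<lambda>j s t. fact (j+s) * fact (s+t) / fact s * ?c m1 (j+s) * ?c k3 (s+t) * ?c k2 j * ?c m2 t"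
  have L: "leibniz m1 k2 j * leibniz (m1 + m2 - int j) k3 (J - j) = (\<Sum>s\<le>J-j. ?g j s (J-j-s))" if "j \<le> J" for j
  proof -
    have "?c (m1 + m2 - int j) (J-j) = (\<Sum>s\<le>J-j. (of_int m1 - of_nat j gchoose s) * ?c m2 (J-j-s))"
      using gbinomial_Vandermonde[of "of_int m1 - of_nat j :: real" "of_int m2" "J-j"]
      by (simp add: algebra_simps atLeast0AtMost)
    hence "leibniz m1 k2 j * leibniz (m1 + m2 - int j) k3 (J - j)
       = (\<Sum>s\<le>J-j. (?c m1 j * (of_int m1 - of_nat j gchoose s)) * fact j * fact (J-j) * ?c m2 (J-j-s) * ?c k2 j * ?c k3 (J-j))"
      by (simp add: leibniz_def sum_distrib_left sum_distrib_right mult_ac)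
    also have "\<dots> = (\<Sum>s\<le>J-j. ?g j s (J-j-s))"
    proof (rule sum.cong[OF refl])
      fix s assume "s \<in> {..J-j}"
      hence e: "s + (J - j - s) = J - j" by auto
      have f: "?c m1 j * (of_int m1 - of_nat j gchoose s) * fact j = ?c m1 (j+s) * fact (j+s) / fact s"
        using gchoose_split[of "of_int m1" j s] by (simp add: field_simps)
      show "(?c m1 j * (of_int m1 - of_nat j gchoose s)) * fact j * fact (J-j) * ?c m2 (J-j-s) * ?c k2 j * ?c k3 (J-j)
          = ?g j s (J-j-s)"
        unfolding f e by (simp add: field_simps)
    qed
    finally show ?thesis .
  qed
  have R: "leibniz m2 k3 t * leibniz m1 (k2 + k3 - int t) (J - t) = (\<Sum>i\<le>J-t. ?g i (J-t-i) t)" if "t \<le> J" for t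
  proof -
    have "?c (k2 + k3 - int t) (J-t) = (\<Sum>i\<le>J-t. ?c k2 i * (of_int k3 - of_nat t gchoose (J-t-i)))"
      using gbinomial_Vandermonde[of "of_int k2" "of_int k3 - of_nat t :: real" "J-t"]
      by (simp add: algebra_simps atLeast0AtMost)
    hence "leibniz m2 k3 t * leibniz m1 (k2 + k3 - int t) (J - t)
       = (\<Sum>i\<le>J-t. (?c k3 t * (of_int k3 - of_nat t gchoose (J-t-i))) * fact t * fact (J-t) * ?c m2 t * ?c k2 i * ?c m1 (J-t))"
      by (simp add: leibniz_def sum_distrib_left sum_distrib_right mult_ac)
    also have "\<dots> = (\<Sum>i\<le>J-t. ?g i (J-t-i) t)"
    proof (rule sum.cong[OF refl])
      fix i assume "i \<in> {..J-t}"
      hence e: "i + (J - t - i) = J - t" by auto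
      have f: "?c k3 t * (of_int k3 - of_nat t gchoose (J-t-i)) * fact t = ?c k3 (J-t-i+t) * fact (J-t-i+t) / fact (J-t-i)"
        using gchoose_split[of "of_int k3" t "J-t-i"] by (simp add: field_simps)
      show "(?c k3 t * (of_int k3 - of_nat t gchoose (J-t-i))) * fact t * fact (J-t) * ?c m2 t * ?c k2 i * ?c m1 (J-t) = ?g i (J-t-i) t"
        unfolding f e by (simp add: field_simps)
    qed
    finally show ?thesis .
  qed
  have "?L = (\<Sum>j\<le>J. \<Sum>s\<le>J-j. ?g j s (J-j-s))" using L by simp
  also have "\<dots> = (\<Sum>t\<le>J. \<Sum>i\<le>J-t. ?g i (J-t-i) t)" by (rule sum_triple)
  also have "\<dots> = ?R" using R by simp
  finally show ?thesis .
qed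

text \<open>Structure constants: $x^{k_1}\partial^{m_1}\cdot x^{k_2}\partial^{m_2}=\sum_r c_r\,x^{r_1}\partial^{r_2}$, monomials being
  encoded by their exponent pairs.\<close>

definition mcoeff :: "int \<times> int \<Rightarrow> int \<times> int \<Rightarrow> int \<times> int \<Rightarrow> real" where
  "mcoeff p q r = (let j = fst p + fst q - fst r in
     if 0 \<le> j \<and> snd p + snd q - snd r = j then leibniz (snd p) (fst q) (nat j) else 0)"

lemma mcoeff_le: "mcoeff p q r \<noteq> 0 \<Longrightarrow> fst r \<le> fst p + fst q \<and> snd r \<le> snd p + snd q"
  by (auto simp: mcoeff_def Let_def split: if_splits)

text \<open>The sum over intermediate monomials is formally infinite; S is any finite set that
  misses no contributing term. At a common depth N the intermediate exponent pair is determined by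
  its own depth j, which reduces the claim to \<open>leibniz_assoc\<close>. Without a common depth
  all terms are 0.\<close>

lemma mcoeff_assoc:
  assumes "finite S" "\<And>s. mcoeff p q s \<noteq> 0 \<Longrightarrow> mcoeff s t r \<noteq> 0 \<Longrightarrow> s \<in> S"
  assumes "\<And>s. mcoeff q t s \<noteq> 0 \<Longrightarrow> mcoeff p s r \<noteq> 0 \<Longrightarrow> s \<in> S"
  shows "(\<Sum>s\<in>S. mcoeff p q s * mcoeff s t r) = (\<Sum>s\<in>S. mcoeff q t s * mcoeff p s r)"
proof -
  define J where "J = fst p + fst q + fst t - fst r"
  obtain k1 m1 where p: "p = (k1,m1)" by force
  obtain k2 m2 where q: "q = (k2,m2)" by force
  obtain k3 m3 where t: "t = (k3,m3)" by force
  obtain a b where r: "r = (a,b)" by force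
  show ?thesis
  proof (cases "0 \<le> J \<and> snd p + snd q + snd t - snd r = J")
    case False
    have "mcoeff p q s * mcoeff s t r = 0" for s
      using False by (auto simp: mcoeff_def Let_def J_def split: if_splits)
    moreover have "mcoeff q t s * mcoeff p s r = 0" for s
      using False by (auto simp: mcoeff_def Let_def J_def split: if_splits)
    ultimately show ?thesis by (simp only: sum.neutral_const)
  next
    case True
    define N where "N = nat J"
    have N: "int N = J" using True by (simp add: N_def)
    let ?f = "\<lambda>j. (k1 + k2 - int j, m1 + m2 - int j)"
    let ?h = "\<lambda>j. (k2 + k3 - int j, m2 + m3 - int j)"
    have 1: "(\<Sum>s\<in>S. mcoeff p q s * mcoeff s t r) = (\<Sum>s\<in>?f ` {..N}. mcoeff p q s * mcoeff s t r)"
    proof (rule sum.mono_neutral_cong)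
      fix s assume "s \<in> S - ?f ` {..N}"
      hence s: "s \<notin> ?f ` {..N}" by auto
      show "mcoeff p q s * mcoeff s t r = 0"
      proof (rule ccontr)
        assume nz: "mcoeff p q s * mcoeff s t r \<noteq> 0"
        hence "s = ?f (nat (k1 + k2 - fst s))" "nat (k1 + k2 - fst s) \<le> N"
          using N True by (auto simp: mcoeff_def Let_def p q t r J_def prod_eq_iff split: if_splits)
        thus False using s by blast
      qed
    next
      fix s assume "s \<in> ?f ` {..N} - S" thus "mcoeff p q s * mcoeff s t r = 0"
        using assms(2) by auto
    qed (use assms in auto)
    have 2: "(\<Sum>s\<in>S. mcoeff q t s * mcoeff p s r) = (\<Sum>s\<in>?h ` {..N}. mcoeff q t s * mcoeff p s r)"
    proof (rule sum.mono_neutral_cong)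
      fix s assume "s \<in> S - ?h ` {..N}"
      hence s: "s \<notin> ?h ` {..N}" by auto
      show "mcoeff q t s * mcoeff p s r = 0"
      proof (rule ccontr)
        assume nz: "mcoeff q t s * mcoeff p s r \<noteq> 0"
        hence "s = ?h (nat (k2 + k3 - fst s))" "nat (k2 + k3 - fst s) \<le> N"
          using N True by (auto simp: mcoeff_def Let_def p q t r J_def prod_eq_iff split: if_splits)
        thus False using s by blast
      qed
    next
      fix s assume "s \<in> ?h ` {..N} - S" thus "mcoeff q t s * mcoeff p s r = 0"
        using assms(3) by auto
    qed (use assms in auto)
    have e1: "mcoeff p q (?f j) * mcoeff (?f j) t r = leibniz m1 k2 j * leibniz (m1 + m2 - int j) k3 (N - j)" if "j \<le> N" for j
    proof -
      have "nat (k1 + k2 - int j + k3 - a) = N - j" using N that by (auto simp: J_def p q t r)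
      thus ?thesis using N that True by (auto simp: mcoeff_def Let_def p q t r J_def)
    qed
    have e2: "mcoeff q t (?h j) * mcoeff p (?h j) r = leibniz m2 k3 j * leibniz m1 (k2 + k3 - int j) (N - j)" if "j \<le> N" for j
    proof -
      have "nat (k1 + (k2 + k3 - int j) - a) = N - j" using N that by (auto simp: J_def p q t r)
      thus ?thesis using N that True by (auto simp: mcoeff_def Let_def p q t r J_def)
    qed
    have "(\<Sum>s\<in>S. mcoeff p q s * mcoeff s t r) = (\<Sum>j\<le>N. leibniz m1 k2 j * leibniz (m1 + m2 - int j) k3 (N - j))"
      unfolding 1 by (subst sum.reindex) (auto simp: inj_on_def e1 o_def intro!: sum.cong)
    also have "\<dots> = (\<Sum>j\<le>N. leibniz m2 k3 j * leibniz m1 (k2 + k3 - int j) (N - j))" by (rule leibniz_assoc)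
    also have "\<dots> = (\<Sum>s\<in>S. mcoeff q t s * mcoeff p s r)"
      unfolding 2 by (subst sum.reindex) (auto simp: inj_on_def e2 o_def intro!: sum.cong)
    finally show ?thesis .
  qed
qed

section \<open>Coefficient arrays with exponents bounded above, and their product\<close>

definition bdd :: "int \<Rightarrow> (int \<times> int \<Rightarrow> 'a::zero) \<Rightarrow> bool" where
  "bdd K f \<longleftrightarrow> (\<forall>p. f p \<noteq> 0 \<longrightarrow> fst p \<le> K \<and> snd p \<le> K)"

lemma bddD: "bdd K f \<Longrightarrow> f p \<noteq> 0 \<Longrightarrow> fst p \<le> K \<and> snd p \<le> K"
  unfolding bdd_def by blast

lemma bdd_mono: "bdd K f \<Longrightarrow> K \<le> K' \<Longrightarrow> bdd K' f"
  by (force simp: bdd_def)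

text \<open>For \<open>bdd\<close> arguments the index set is finite: the exponents are at most K
  and at least those of r minus K. On an infinite index set the sum would have the default value
  0.\<close>

definition pmult :: "(int \<times> int \<Rightarrow> 'a::real_algebra_1) \<Rightarrow> (int \<times> int \<Rightarrow> 'a) \<Rightarrow> int \<times> int \<Rightarrow> 'a" where
  "pmult f g r = (\<Sum>(p,q)\<in>{(p,q). f p \<noteq> 0 \<and> g q \<noteq> 0 \<and> mcoeff p q r \<noteq> 0}. mcoeff p q r *\<^sub>R (f p * g q))"

definition sqbox :: "int \<Rightarrow> int \<Rightarrow> (int \<times> int) set" where
  "sqbox L K = {L..K} \<times> {L..K}"

lemma finite_box [simp]: "finite (sqbox L K)"
  by (simp add: sqbox_def)

lemma pmult_sum:
  assumes "finite A" "finite B"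
    and "\<And>p q. f p \<noteq> 0 \<Longrightarrow> g q \<noteq> 0 \<Longrightarrow> mcoeff p q r \<noteq> 0 \<Longrightarrow> p \<in> A \<and> q \<in> B"
  shows "pmult f g r = (\<Sum>p\<in>A. \<Sum>q\<in>B. mcoeff p q r *\<^sub>R (f p * g q))"
  unfolding pmult_def sum.cartesian_product
  by (rule sum.mono_neutral_left) (use assms in auto)

text \<open>The box depends only on the bound and on r, so sums for several operators can be added
  and rearranged over the same finite index set.\<close>

lemma pmult_box:
  assumes "bdd K f" "bdd K g" "L \<le> fst r - K" "L \<le> snd r - K"
  shows "pmult f g r = (\<Sum>p\<in>sqbox L K. \<Sum>q\<in>sqbox L K. mcoeff p q r *\<^sub>R (f p * g q))"
proof (rule pmult_sum)
  fix p q assume "f p \<noteq> 0" "g q \<noteq> 0" "mcoeff p q r \<noteq> 0"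
  with bddD[OF assms(1), of p] bddD[OF assms(2), of q] mcoeff_le[of p q r] assms(3,4)
  show "p \<in> sqbox L K \<and> q \<in> sqbox L K" unfolding sqbox_def mem_Times_iff by simp
qed auto

lemma bdd_pmult:
  assumes "bdd K f" "bdd K g" shows "bdd (2 * K) (pmult f g)"
  unfolding bdd_def
proof (intro allI impI)
  fix r assume "pmult f g r \<noteq> 0"
  then obtain p q where "f p \<noteq> 0" "g q \<noteq> 0" "mcoeff p q r \<noteq> 0"
    unfolding pmult_def by (auto elim!: sum.not_neutral_contains_not_neutral)
  with bddD[OF assms(1), of p] bddD[OF assms(2), of q] mcoeff_le[of p q r]
  show "fst r \<le> 2 * K \<and> snd r \<le> 2 * K" by simp
qed

text \<open>A coefficient of a triple product involves finitely many monomials. All sums are moved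
  to boxes that serve both bracketings; after interchanging them only the scalar identity
  \<open>mcoeff_assoc\<close> is left.\<close>

lemma pmult_assoc:
  assumes "bdd K0 f" "bdd K0 g" "bdd K0 h"
  shows "pmult (pmult f g) h r = pmult f (pmult g h) r"
proof -
  \<comment> \<open>A nonnegative bound K makes 2 * K a bound for the factors as well as for the
    products of two of them.\<close>
  define K where "K = max K0 0"
  have K: "bdd K f" "bdd K g" "bdd K h" "0 \<le> K"
    using assms by (auto simp: K_def intro: bdd_mono)
  define K2 where "K2 = 2 * K"
  have K2: "bdd K2 f" "bdd K2 g" "bdd K2 h" "bdd K2 (pmult f g)" "bdd K2 (pmult g h)"
    using K by (auto simp: K2_def intro: bdd_mono bdd_pmult)
  define L where "L = min (fst r) (snd r) - K2"
  define L' where "L' = L - K2"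
  let ?S = "sqbox L K2" and ?B = "sqbox L' K2"
  have fg: "pmult f g s = (\<Sum>p\<in>?B. \<Sum>q\<in>?B. mcoeff p q s *\<^sub>R (f p * g q))" if "s \<in> ?S" for s
    by (rule pmult_box) (use K2 that in \<open>auto simp: sqbox_def L'_def\<close>)
  have gh: "pmult g h s = (\<Sum>p\<in>?B. \<Sum>q\<in>?B. mcoeff p q s *\<^sub>R (g p * h q))" if "s \<in> ?S" for s
    by (rule pmult_box) (use K2 that in \<open>auto simp: sqbox_def L'_def\<close>)
  have LL: "L' \<le> L" "L \<le> fst r - K2" "L \<le> snd r - K2" using K by (auto simp: L'_def K2_def L_def)
  have "pmult (pmult f g) h r = (\<Sum>s\<in>?S. \<Sum>t\<in>?B. mcoeff s t r *\<^sub>R (pmult f g s * h t))"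
  proof (rule pmult_sum)
    fix p q assume "pmult f g p \<noteq> 0" "h q \<noteq> 0" "mcoeff p q r \<noteq> 0"
    with bddD[OF K2(4), of p] bddD[OF K2(3), of q] mcoeff_le[of p q r] LL
    show "p \<in> ?S \<and> q \<in> ?B" unfolding sqbox_def mem_Times_iff by auto
  qed auto
  also have "\<dots> = (\<Sum>s\<in>?S. \<Sum>t\<in>?B. \<Sum>p\<in>?B. \<Sum>q\<in>?B. (mcoeff p q s * mcoeff s t r) *\<^sub>R (f p * g q * h t))"
    by (intro sum.cong refl) (simp add: fg sum_distrib_right scaleR_sum_right mult.commute)
  also have "\<dots> = (\<Sum>p\<in>?B. \<Sum>q\<in>?B. \<Sum>t\<in>?B. \<Sum>s\<in>?S. (mcoeff p q s * mcoeff s t r) *\<^sub>R (f p * g q * h t))"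
  proof -
    have "(\<Sum>s\<in>?S. \<Sum>t\<in>?B. \<Sum>p\<in>?B. \<Sum>q\<in>?B. F s t p q) = (\<Sum>p\<in>?B. \<Sum>q\<in>?B. \<Sum>t\<in>?B. \<Sum>s\<in>?S. F s t p q)"
      for F :: "int \<times> int \<Rightarrow> int \<times> int \<Rightarrow> int \<times> int \<Rightarrow> int \<times> int \<Rightarrow> 'a"
      unfolding sum.cartesian_product
      by (rule sum.reindex_bij_witness[where i="\<lambda>(p,q,t,s). (s,t,p,q)" and j="\<lambda>(s,t,p,q). (p,q,t,s)"]) auto
    thus ?thesis .
  qed
  also have "\<dots> = (\<Sum>p\<in>?B. \<Sum>q\<in>?B. \<Sum>t\<in>?B. \<Sum>s\<in>?S. (mcoeff q t s * mcoeff p s r) *\<^sub>R (f p * g q * h t))"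
  proof (rule sum.cong[OF refl], rule sum.cong[OF refl], rule sum.cong[OF refl])
    fix p q t
    show "(\<Sum>s\<in>?S. (mcoeff p q s * mcoeff s t r) *\<^sub>R (f p * g q * h t)) = (\<Sum>s\<in>?S. (mcoeff q t s * mcoeff p s r) *\<^sub>R (f p * g q * h t))"
    proof (cases "f p = 0 \<or> g q = 0 \<or> h t = 0")
      case False
      hence b: "fst p \<le> K" "snd p \<le> K" "fst q \<le> K" "snd q \<le> K" "fst t \<le> K" "snd t \<le> K"
        using K(1-3) by (auto dest: bddD)
      have "(\<Sum>s\<in>?S. mcoeff p q s * mcoeff s t r) = (\<Sum>s\<in>?S. mcoeff q t s * mcoeff p s r)"
      proof (rule mcoeff_assoc)
        fix s assume "mcoeff p q s \<noteq> 0" "mcoeff s t r \<noteq> 0"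
        with mcoeff_le[of p q s] mcoeff_le[of s t r] b K(4) LL show "s \<in> ?S" unfolding sqbox_def mem_Times_iff K2_def by auto
      next
        fix s assume "mcoeff q t s \<noteq> 0" "mcoeff p s r \<noteq> 0"
        with mcoeff_le[of q t s] mcoeff_le[of p s r] b K(4) LL show "s \<in> ?S" unfolding sqbox_def mem_Times_iff K2_def by auto
      qed auto
      thus ?thesis by (simp only: scaleR_sum_left[symmetric])
    qed auto
  qed
  also have "\<dots> = (\<Sum>p\<in>?B. \<Sum>s\<in>?S. \<Sum>q\<in>?B. \<Sum>t\<in>?B. (mcoeff q t s * mcoeff p s r) *\<^sub>R (f p * g q * h t))"
  proof (rule sum.cong[OF refl])
    fix p
    have "(\<Sum>q\<in>?B. \<Sum>t\<in>?B. \<Sum>s\<in>?S. F q t s) = (\<Sum>s\<in>?S. \<Sum>q\<in>?B. \<Sum>t\<in>?B. F q t s)"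
      for F :: "int \<times> int \<Rightarrow> int \<times> int \<Rightarrow> int \<times> int \<Rightarrow> 'a"
      unfolding sum.cartesian_product
      by (rule sum.reindex_bij_witness[where i="\<lambda>(s,q,t). (q,t,s)" and j="\<lambda>(q,t,s). (s,q,t)"]) auto
    thus "(\<Sum>q\<in>?B. \<Sum>t\<in>?B. \<Sum>s\<in>?S. (mcoeff q t s * mcoeff p s r) *\<^sub>R (f p * g q * h t)) = (\<Sum>s\<in>?S. \<Sum>q\<in>?B. \<Sum>t\<in>?B. (mcoeff q t s * mcoeff p s r) *\<^sub>R (f p * g q * h t))" .
  qed
  also have "\<dots> = (\<Sum>p\<in>?B. \<Sum>s\<in>?S. mcoeff p s r *\<^sub>R (f p * pmult g h s))"
    by (intro sum.cong refl) (simp add: gh sum_distrib_left scaleR_sum_right mult.commute mult.assoc)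
  also have "\<dots> = pmult f (pmult g h) r"
  proof (rule pmult_sum[symmetric])
    fix p q assume "f p \<noteq> 0" "pmult g h q \<noteq> 0" "mcoeff p q r \<noteq> 0"
    with bddD[OF K2(1), of p] bddD[OF K2(5), of q] mcoeff_le[of p q r] LL
    show "p \<in> ?B \<and> q \<in> ?S" unfolding sqbox_def mem_Times_iff by auto
  qed auto
  finally show ?thesis .
qed

section \<open>The ring of pseudodifferential operators\<close>

typedef (overloaded) 'a pdo = "{f :: int \<times> int \<Rightarrow> 'a::zero. \<exists>K. bdd K f}"
  morphisms cf Abs_pdo
  by (rule exI[of _ "\<lambda>_. 0"]) (simp add: bdd_def)

setup_lifting type_definition_pdo

lemma bdd_cf: "\<exists>K. bdd K (cf F)"
  using cf by auto

lemma bdd_cf2: obtains K where "bdd K (cf F)" "bdd K (cf G)"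
proof -
  obtain K1 K2 where "bdd K1 (cf F)" "bdd K2 (cf G)" using bdd_cf by meson
  hence "bdd (max K1 K2) (cf F)" "bdd (max K1 K2) (cf G)" by (auto intro: bdd_mono)
  thus ?thesis by (rule that)
qed

lemma pdo_eqI: "(\<And>a b. cf F (a, b) = cf G (a, b)) \<Longrightarrow> F = G"
  by (metis cf_inject ext surj_pair)

lemma bdd_add: "bdd K f \<Longrightarrow> bdd K' g \<Longrightarrow> bdd (max K K') (\<lambda>p. f p + g p :: 'a::group_add)"
  unfolding bdd_def by (metis add.right_neutral max.coboundedI1 max.coboundedI2)

lemma bdd_uminus: "bdd K f \<Longrightarrow> bdd K (\<lambda>p. - f p :: 'a::group_add)"
  unfolding bdd_def by simp

lemma bdd_ex3:
  assumes "\<exists>K. bdd K f" "\<exists>K. bdd K g" "\<exists>K. bdd K h"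
  shows "\<exists>K. bdd K f \<and> bdd K g \<and> bdd K h"
  using assms by (meson bdd_mono linorder_le_cases)

instantiation pdo :: (real_algebra_1) ring_1
begin

lift_definition zero_pdo :: "'a pdo" is "\<lambda>_. 0" by (simp add: bdd_def)

lift_definition one_pdo :: "'a pdo" is "\<lambda>p. if p = (0,0) then 1 else 0"
  by (rule exI[of _ 0]) (simp add: bdd_def)

lift_definition plus_pdo :: "'a pdo \<Rightarrow> 'a pdo \<Rightarrow> 'a pdo" is "\<lambda>f g p. f p + g p"
  using bdd_add by blast

lift_definition minus_pdo :: "'a pdo \<Rightarrow> 'a pdo \<Rightarrow> 'a pdo" is "\<lambda>f g p. f p - g p"
proof -
  fix f g :: "int \<times> int \<Rightarrow> 'a" assume "\<exists>K. bdd K f" "\<exists>K. bdd K g"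
  thus "\<exists>K. bdd K (\<lambda>p. f p - g p)"
    unfolding diff_conv_add_uminus using bdd_add bdd_uminus by blast
qed

lift_definition uminus_pdo :: "'a pdo \<Rightarrow> 'a pdo" is "\<lambda>f p. - f p"
  by (simp add: bdd_def)

lift_definition times_pdo :: "'a pdo \<Rightarrow> 'a pdo \<Rightarrow> 'a pdo" is pmult
proof -
  fix f g :: "int \<times> int \<Rightarrow> 'a" assume "\<exists>K. bdd K f" "\<exists>K. bdd K g"
  then obtain K1 K2 where "bdd K1 f" "bdd K2 g" by auto
  hence "bdd (max K1 K2) f" "bdd (max K1 K2) g" by (auto intro: bdd_mono)
  thus "\<exists>K. bdd K (pmult f g)" using bdd_pmult by blast
qed

lemma mcoeff_zero_left: "mcoeff (0,0) q r = (if q = r then 1 else 0)"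
proof -
  have "leibniz 0 k j = (if j = 0 then 1 else 0)" for k j by (cases j) (auto simp: leibniz_def)
  thus ?thesis by (cases q; cases r) (auto simp: mcoeff_def Let_def)
qed

lemma mcoeff_zero_right: "mcoeff p (0,0) r = (if p = r then 1 else 0)"
proof -
  have "leibniz k 0 j = (if j = 0 then 1 else 0)" for k j by (cases j) (auto simp: leibniz_def)
  thus ?thesis by (cases p; cases r) (auto simp: mcoeff_def Let_def)
qed

instance
proof
  fix F G H :: "'a pdo"
  show "F * G * H = F * (G * H)"
  proof (transfer, rule ext)
    fix f g h :: "int \<times> int \<Rightarrow> 'a" and r
    assume "\<exists>K. bdd K f" "\<exists>K. bdd K g" "\<exists>K. bdd K h"
    thus "pmult (pmult f g) h r = pmult f (pmult g h) r"
      using bdd_ex3 pmult_assoc by blast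
  qed
  show "1 * F = F"
  proof (transfer, rule ext)
    fix f :: "int \<times> int \<Rightarrow> 'a" and r
    show "pmult (\<lambda>p. if p = (0,0) then 1 else 0) f r = f r"
      by (subst pmult_sum[where A="{(0,0)}" and B="{r}"]) (auto simp: mcoeff_zero_left split: if_splits)
  qed
  show "F * 1 = F"
  proof (transfer, rule ext)
    fix f :: "int \<times> int \<Rightarrow> 'a" and r
    show "pmult f (\<lambda>p. if p = (0,0) then 1 else 0) r = f r"
      by (subst pmult_sum[where B="{(0,0)}" and A="{r}"]) (auto simp: mcoeff_zero_right split: if_splits)
  qed
  show "(F + G) * H = F * H + G * H"
  proof (transfer, rule ext)
    fix f g h :: "int \<times> int \<Rightarrow> 'a" and r
    assume "\<exists>K. bdd K f" "\<exists>K. bdd K g" "\<exists>K. bdd K h"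
    then obtain K where K: "bdd K f" "bdd K g" "bdd K h" using bdd_ex3 by blast
    hence K': "bdd K (\<lambda>p. f p + g p)" by (auto simp: bdd_def) (metis add.right_neutral add_0)+
    have L: "min (fst r) (snd r) - K \<le> fst r - K" "min (fst r) (snd r) - K \<le> snd r - K" by auto
    show "pmult (\<lambda>p. f p + g p) h r = pmult f h r + pmult g h r"
      by (simp only: pmult_box[OF K(1) K(3) L] pmult_box[OF K(2) K(3) L] pmult_box[OF K' K(3) L]
          sum.distrib[symmetric] distrib_right scaleR_add_right)
  qed
  show "F * (G + H) = F * G + F * H"
  proof (transfer, rule ext)
    fix f g h :: "int \<times> int \<Rightarrow> 'a" and r
    assume "\<exists>K. bdd K f" "\<exists>K. bdd K g" "\<exists>K. bdd K h"
    then obtain K where K: "bdd K f" "bdd K g" "bdd K h" using bdd_ex3 by blast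
    hence K': "bdd K (\<lambda>p. g p + h p)" by (auto simp: bdd_def) (metis add.right_neutral add_0)+
    have L: "min (fst r) (snd r) - K \<le> fst r - K" "min (fst r) (snd r) - K \<le> snd r - K" by auto
    show "pmult f (\<lambda>p. g p + h p) r = pmult f g r + pmult f h r"
      by (simp only: pmult_box[OF K(1) K(2) L] pmult_box[OF K(1) K(3) L] pmult_box[OF K(1) K' L]
          sum.distrib[symmetric] distrib_left scaleR_add_right)
  qed
  show "(0 :: 'a pdo) \<noteq> 1"
    by transfer (metis zero_neq_one)
qed (transfer; simp add: fun_eq_iff algebra_simps)+

end

lemma cf_sum: "cf (sum f A) r = (\<Sum>x\<in>A. cf (f x) r)"
  by (induction A rule: infinite_finite_induct) (auto simp: zero_pdo.rep_eq plus_pdo.rep_eq)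

lemmas cf_simps = zero_pdo.rep_eq one_pdo.rep_eq plus_pdo.rep_eq minus_pdo.rep_eq uminus_pdo.rep_eq

section \<open>Monomials, the generators, and inverses of shifted generators\<close>

lift_definition pmon :: "int \<times> int \<Rightarrow> 'a \<Rightarrow> 'a::zero pdo" is "\<lambda>p c q. if q = p then c else 0"
  subgoal for p c by (rule exI[of _ "max (fst p) (snd p)"]) (auto simp: bdd_def)
  done

abbreviation pconst :: "'a \<Rightarrow> 'a::zero pdo" where "pconst \<equiv> pmon (0,0)"
abbreviation pX :: "'a::real_algebra_1 pdo" where "pX \<equiv> pmon (1,0) 1"
abbreviation pD :: "'a::real_algebra_1 pdo" where "pD \<equiv> pmon (0,1) 1"

lemma cf_pmon: "cf (pmon p c) q = (if q = p then c else 0)"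
  by transfer simp

lemma cf_pconst_mult: "cf (pconst c * F) r = c * cf F r"
  unfolding times_pdo.rep_eq
  by (subst pmult_sum[where A="{(0,0)}" and B="{r}"]) (auto simp: mcoeff_zero_left cf_pmon split: if_splits)

lemma cf_mult_pconst: "cf (F * pconst c) r = cf F r * c"
  unfolding times_pdo.rep_eq
  by (subst pmult_sum[where B="{(0,0)}" and A="{r}"]) (auto simp: mcoeff_zero_right cf_pmon split: if_splits)

lemma pconst_1: "pconst 1 = 1" and pconst_0: "pconst 0 = 0"
  and pconst_add: "pconst (c + d) = pconst c + pconst (d::'a::real_algebra_1)"
  and pconst_diff: "pconst (c - d) = pconst c - pconst (d::'a::real_algebra_1)"
  and pconst_uminus: "pconst (- c) = - pconst (c::'a::real_algebra_1)"
  and pconst_mult: "pconst (c * d) = pconst c * pconst (d::'a::real_algebra_1)"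
  by (rule pdo_eqI; simp add: cf_pmon cf_simps cf_pconst_mult)+

lemma leibniz_1_left: "leibniz 1 k j = (if j = 0 then 1 else if j = 1 then of_int k else 0)"
proof (cases j)
  case (Suc i)
  have "((1::real) gchoose Suc i) = (if i = 0 then 1 else 0)"
    using binomial_gbinomial[of 1 "Suc i", where 'a=real] by (cases i) auto
  thus ?thesis by (simp add: leibniz_def Suc)
qed simp

lemma leibniz_commute: "leibniz m k j = leibniz k m j"
  by (simp add: leibniz_def)

lemma cf_X_mult: "cf (pX * F) (a,b) = cf F (a - 1, b)"
proof -
  have 0: "leibniz 0 k j = (if j = 0 then 1 else 0)" for k j by (cases j) (auto simp: leibniz_def)
  have "mcoeff (1,0) q (a,b) = (if q = (a-1,b) then 1 else 0)" for q
    by (cases q) (auto simp: mcoeff_def Let_def 0)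
  thus ?thesis unfolding times_pdo.rep_eq
    by (subst pmult_sum[where A="{(1,0)}" and B="{(a-1,b)}"]) (auto simp: cf_pmon split: if_splits)
qed

lemma cf_mult_D: "cf (F * pD) (a,b) = cf F (a, b - 1)"
proof -
  have 0: "leibniz k 0 j = (if j = 0 then 1 else 0)" for k j by (cases j) (auto simp: leibniz_def)
  have "mcoeff q (0,1) (a,b) = (if q = (a,b-1) then 1 else 0)" for q
    by (cases q) (auto simp: mcoeff_def Let_def 0)
  thus ?thesis unfolding times_pdo.rep_eq
    by (subst pmult_sum[where B="{(0,1)}" and A="{(a,b-1)}"]) (auto simp: cf_pmon split: if_splits)
qed

lemma cf_D_mult: "cf (pD * F) (a,b) = cf F (a, b - 1) + of_int (a + 1) *\<^sub>R cf F (a + 1, b)"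
proof -
  have "mcoeff (0,1) q (a,b) = (if q = (a,b-1) then 1 else if q = (a+1,b) then of_int (a+1) else 0)" for q
    by (cases q) (auto simp: mcoeff_def Let_def leibniz_1_left)
  thus ?thesis unfolding times_pdo.rep_eq
    by (subst pmult_sum[where A="{(0,1)}" and B="{(a,b-1),(a+1,b)}"]) (auto simp: cf_pmon split: if_splits)
qed

lemma cf_mult_X: "cf (F * pX) (a,b) = cf F (a - 1, b) + of_int (b + 1) *\<^sub>R cf F (a, b + 1)"
proof -
  have "mcoeff q (1,0) (a,b) = (if q = (a-1,b) then 1 else if q = (a,b+1) then of_int (b+1) else 0)" for q
    by (cases q) (auto simp: mcoeff_def Let_def leibniz_1_left leibniz_commute[of _ 1])
  thus ?thesis unfolding times_pdo.rep_eq
    by (subst pmult_sum[where B="{(1,0)}" and A="{(a-1,b),(a,b+1)}"]) (auto simp: cf_pmon split: if_splits)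
qed

lemma pD_pX: "pD * pX = pX * pD + (1 :: 'a::real_algebra_1 pdo)"
  by (rule pdo_eqI) (simp add: cf_X_mult cf_mult_D cf_mult_X cf_simps cf_pmon)

lemma pconst_pX: "pconst c * pX = pX * pconst c" and pconst_pD: "pconst c * pD = pD * pconst c"
  by (rule pdo_eqI; simp add: cf_pconst_mult cf_mult_pconst cf_pmon)+

text \<open>The expansion of (x - z)^{-1} in negative powers of x, a geometric series in z;
  \<open>dinv\<close> is the same series in d/dx. Here z may be any element of the coefficient
  algebra.\<close>

lift_definition xinv :: "'a::real_algebra_1 \<Rightarrow> 'a pdo" is
  "\<lambda>z (a,b). if b = 0 \<and> a \<le> -1 then z ^ nat (- a - 1) else 0"
  by (rule exI[of _ 0]) (auto simp: bdd_def split: if_splits)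

lift_definition dinv :: "'a::real_algebra_1 \<Rightarrow> 'a pdo" is
  "\<lambda>z (a,b). if a = 0 \<and> b \<le> -1 then z ^ nat (- b - 1) else 0"
  by (rule exI[of _ 0]) (auto simp: bdd_def split: if_splits)

lemma cf_xinv: "cf (xinv z) (a,b) = (if b = 0 \<and> a \<le> -1 then z ^ nat (- a - 1) else 0)"
  by transfer simp

lemma cf_dinv: "cf (dinv z) (a,b) = (if a = 0 \<and> b \<le> -1 then z ^ nat (- b - 1) else 0)"
  by transfer simp

lemma nat_Suc_aux: "a \<le> (-1::int) \<Longrightarrow> nat (- (a - 1) - 1) = Suc (nat (- a - 1))"
  and nat_Suc_aux2: "a \<le> (-1::int) \<Longrightarrow> nat (- a) = Suc (nat (- a - 1))"
  by simp_all

lemma xinv_left: "xinv z * (pX - pconst z) = 1" and xinv_right: "(pX - pconst z) * xinv z = 1"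
  and dinv_left: "dinv z * (pD - pconst z) = 1" and dinv_right: "(pD - pconst z) * dinv z = 1"
proof -
  have *: "a - 1 \<le> (-1::int) \<longleftrightarrow> a \<le> -1 \<or> a = 0" "\<not> (a \<le> - 1 \<and> a = 0)" for a by auto
  show "xinv z * (pX - pconst z) = 1"
    by (rule pdo_eqI) (auto simp: right_diff_distrib cf_simps cf_mult_X cf_mult_pconst cf_xinv * nat_Suc_aux nat_Suc_aux2 power_commutes simp del: power_Suc2 minus_diff_eq)
  show "(pX - pconst z) * xinv z = 1"
    by (rule pdo_eqI) (auto simp: left_diff_distrib cf_simps cf_X_mult cf_pconst_mult cf_xinv * nat_Suc_aux nat_Suc_aux2 simp del: minus_diff_eq)
  show "dinv z * (pD - pconst z) = 1"
    by (rule pdo_eqI) (auto simp: right_diff_distrib cf_simps cf_mult_D cf_mult_pconst cf_dinv * nat_Suc_aux nat_Suc_aux2 power_commutes simp del: power_Suc2 minus_diff_eq)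
  show "(pD - pconst z) * dinv z = 1"
    by (rule pdo_eqI) (auto simp: left_diff_distrib cf_simps cf_D_mult cf_pconst_mult cf_dinv * nat_Suc_aux nat_Suc_aux2 simp del: minus_diff_eq)
qed

section \<open>The map # and multiplication by generators\<close>

abbreviation alt :: "int \<Rightarrow> real" where "alt i \<equiv> if even i then 1 else -1"

text \<open>Bringing (d/dx)^(b+j) (-x)^(a+j) into normal order lowers both exponents by j at depth
  j; this is the contribution to the coefficient of x^a (d/dx)^b. The arguments of f are exchanged
  because # exchanges x and d/dx up to sign.\<close>

definition sterm :: "(int \<times> int \<Rightarrow> 'a::real_algebra_1) \<Rightarrow> int \<Rightarrow> int \<Rightarrow> nat \<Rightarrow> 'a" where
  "sterm f a b j = (alt (a + int j) * leibniz (b + int j) (a + int j) j) *\<^sub>R f (b + int j, a + int j)"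

text \<open>The monomial $x^k\partial^m$ is sent to $\partial^k(-x)^m$, here already in normal order.\<close>

definition sharp_fun :: "(int \<times> int \<Rightarrow> 'a::real_algebra_1) \<Rightarrow> int \<times> int \<Rightarrow> 'a" where
  "sharp_fun f = (\<lambda>(a,b). \<Sum>j\<in>{j. f (b + int j, a + int j) \<noteq> 0}. sterm f a b j)"

lemma sharp_fun_sum:
  assumes "bdd K f" "K - b < int N"
  shows "sharp_fun f (a,b) = (\<Sum>j<N. sterm f a b j)"
  unfolding sharp_fun_def prod.case
proof (rule sum.mono_neutral_left)
  show "{j. f (b + int j, a + int j) \<noteq> 0} \<subseteq> {..<N}"
    using assms by (force dest!: bddD)
qed (auto simp: sterm_def)

lift_definition sharp :: "'a::real_algebra_1 pdo \<Rightarrow> 'a pdo" is sharp_fun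
proof -
  fix f :: "int \<times> int \<Rightarrow> 'a" assume "\<exists>K. bdd K f"
  then obtain K where K: "bdd K f" by auto
  have "bdd K (sharp_fun f)" unfolding bdd_def
  proof (intro allI impI)
    fix p assume "sharp_fun f p \<noteq> 0"
    then obtain j where "f (snd p + int j, fst p + int j) \<noteq> 0"
      unfolding sharp_fun_def by (auto elim!: sum.not_neutral_contains_not_neutral split: prod.splits)
    from bddD[OF K this] show "fst p \<le> K \<and> snd p \<le> K" by auto
  qed
  thus "\<exists>K. bdd K (sharp_fun f)" by blast
qed

abbreviation sharp_sum :: "'a::real_algebra_1 pdo \<Rightarrow> int \<Rightarrow> int \<Rightarrow> nat \<Rightarrow> 'a" where
  "sharp_sum F a b M \<equiv> \<Sum>j<M. sterm (cf F) a b j"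

text \<open>The number of relevant terms depends on the bound of the operator. Having the value for
  all large M allows coefficients of different operators to be compared at one common
  truncation.\<close>

lemma cf_sharp:
  obtains N where "\<And>M. N \<le> M \<Longrightarrow> cf (sharp F) (a,b) = sharp_sum F a b M"
proof -
  obtain K where K: "bdd K (cf F)" using bdd_cf by blast
  show ?thesis
  proof (rule that)
    fix M assume "Suc (nat (K - b)) \<le> M"
    hence "K - b < int M" by linarith
    thus "cf (sharp F) (a,b) = sharp_sum F a b M"
      unfolding sharp.rep_eq by (rule sharp_fun_sum[OF K])
  qed
qed

lemma cf_sharp2:
  obtains M where "cf (sharp F) (a,b) = sharp_sum F a b M" "cf (sharp G) (a,b) = sharp_sum G a b M"
proof -
  obtain N1 where N1: "\<And>M. N1 \<le> M \<Longrightarrow> cf (sharp F) (a,b) = sharp_sum F a b M" using cf_sharp by blast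
  obtain N2 where N2: "\<And>M. N2 \<le> M \<Longrightarrow> cf (sharp G) (a,b) = sharp_sum G a b M" using cf_sharp by blast
  show ?thesis by (rule that[of "N1 + N2"]) (simp_all add: N1 N2)
qed

lemma sharp_add: "sharp (F + G) = sharp F + sharp G"
proof (rule pdo_eqI)
  fix a b
  obtain N where N: "\<And>M. N \<le> M \<Longrightarrow> cf (sharp (F + G)) (a,b) = sharp_sum (F + G) a b M" using cf_sharp by blast
  obtain N1 where N1: "\<And>M. N1 \<le> M \<Longrightarrow> cf (sharp F) (a,b) = sharp_sum F a b M" using cf_sharp by blast
  obtain N2 where N2: "\<And>M. N2 \<le> M \<Longrightarrow> cf (sharp G) (a,b) = sharp_sum G a b M" using cf_sharp by blast
  show "cf (sharp (F + G)) (a,b) = cf (sharp F + sharp G) (a,b)"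
    using N[of "N + N1 + N2"] N1[of "N + N1 + N2"] N2[of "N + N1 + N2"]
    by (simp add: sterm_def cf_simps scaleR_add_right sum.distrib)
qed

lemma sharp_pconst_mult: "sharp (pconst c * F) = pconst c * sharp F"
proof (rule pdo_eqI)
  fix a b
  obtain M where "cf (sharp F) (a,b) = sharp_sum F a b M" "cf (sharp (pconst c * F)) (a,b) = sharp_sum (pconst c * F) a b M"
    by (rule cf_sharp2)
  thus "cf (sharp (pconst c * F)) (a,b) = cf (pconst c * sharp F) (a,b)"
    by (simp add: sterm_def cf_pconst_mult sum_distrib_left)
qed

text \<open>Pascal's rule in the upper argument k. This recursion and \<open>leibniz_rec2\<close>
  differ in how the falling factorial of m is shortened: by its last factor or by its first.\<close>

lemma leibniz_rec1: "leibniz k m (Suc j) = leibniz (k - 1) m (Suc j) + (of_int m - of_nat j) * leibniz (k - 1) m j"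
proof -
  have a: "(of_int k gchoose Suc j :: real) = (of_int (k - 1) gchoose Suc j) + (of_int (k - 1) gchoose j)"
    using gbinomial_addition_formula[of "of_int k :: real" j] by (simp add: add.commute)
  have b: "fact (Suc j) * (of_int m gchoose Suc j :: real) = fact j * ((of_int m - of_nat j) * (of_int m gchoose j))"
    using gbinomial_mult_1[of "of_int m :: real" j] by (simp add: algebra_simps)
  have c: "leibniz k m (Suc j) = (fact j * ((of_int m - of_nat j) * (of_int m gchoose j))) * (of_int k gchoose Suc j)" for k
    unfolding b[symmetric] by (simp add: leibniz_def)
  show ?thesis unfolding c a by (simp add: leibniz_def algebra_simps)
qed

lemma leibniz_rec2: "leibniz k m (Suc j) = leibniz (k - 1) m (Suc j) + of_int m * leibniz (k - 1) (m - 1) j"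
  using gbinomial_absorb_comp[of "of_int m :: real" j] unfolding leibniz_rec1[of k] by (simp add: leibniz_def)

lemma scaleR_split_aux:
  assumes "c = m + k * c'" "s' = - s"
  shows "(s * c) *\<^sub>R (f1 + t *\<^sub>R f2) = - ((s' * m) *\<^sub>R f1) + (k * (s * c')) *\<^sub>R f1 + (s * c * t) *\<^sub>R (f2 :: 'a :: real_vector)"
    and "(s * c) *\<^sub>R (f1 + t *\<^sub>R f2) = (s * m) *\<^sub>R f1 + (k * (s * c')) *\<^sub>R f1 + (s * c * t) *\<^sub>R (f2 :: 'a :: real_vector)"
  using assms(2) unfolding assms(1) by (simp_all add: algebra_simps)

text \<open>Rules for multiplication by one generator suffice, since # is later applied to products
  whose factors, except at most one, are built from generators, constants and inverses of shifted
  generators. The second term of the Leibniz rule for d/dx on the left is the second term of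
  \<open>leibniz_rec1\<close> after shifting the summation index.\<close>

lemma sharp_pX_mult: "sharp (pX * F) = pD * sharp F"
proof (rule pdo_eqI)
  fix a b :: int
  obtain N1 where N1: "\<And>M. N1 \<le> M \<Longrightarrow> cf (sharp F) (a,b-1) = sharp_sum F a (b-1) M" using cf_sharp by blast
  obtain N2 where N2: "\<And>M. N2 \<le> M \<Longrightarrow> cf (sharp F) (a+1,b) = sharp_sum F (a+1) b M" using cf_sharp by blast
  obtain N3 where N3: "\<And>M. N3 \<le> M \<Longrightarrow> cf (sharp (pX * F)) (a,b) = sharp_sum (pX * F) a b M" using cf_sharp by blast
  define M where "M = N1 + N2 + N3"
  have 0: "sterm (cf (pX * F)) a b 0 = sterm (cf F) a (b-1) 0"
    by (simp add: sterm_def cf_X_mult)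
  have S: "sterm (cf (pX * F)) a b (Suc i) = sterm (cf F) a (b-1) (Suc i) + of_int (a+1) *\<^sub>R sterm (cf F) (a+1) b i" for i
  proof -
    have e: "b + int (Suc i) - 1 = b + int i" "b - 1 + int (Suc i) = b + int i" "a + int (Suc i) = a + 1 + int i" by auto
    have "real_of_int (a + 1 + int i) - real i = of_int (a+1)" by simp
    note c = leibniz_rec1[of "b + int (Suc i)" "a + 1 + int i" i, unfolded e this]
    show ?thesis unfolding sterm_def cf_X_mult e c by (simp add: algebra_simps)
  qed
  have "cf (sharp (pX * F)) (a,b) = sharp_sum (pX * F) a b (Suc M)" by (rule N3) (simp add: M_def)
  also have "\<dots> = sharp_sum F a (b-1) (Suc M) + of_int (a+1) *\<^sub>R sharp_sum F (a+1) b M"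
    unfolding sum.lessThan_Suc_shift S 0 scaleR_sum_right by (simp only: sum.distrib add.assoc)
  also have "\<dots> = cf (sharp F) (a,b-1) + of_int (a+1) *\<^sub>R cf (sharp F) (a+1,b)"
    using N1[of "Suc M"] N2[of M] by (simp add: M_def)
  finally show "cf (sharp (pX * F)) (a, b) = cf (pD * sharp F) (a, b)"
    by (simp add: cf_D_mult)
qed

text \<open>Two corrections arise, one from d/dx differentiating the powers of x in F, one from
  \<open>leibniz_rec2\<close>. They are equal up to sign after shifting the summation index by one,
  so they cancel.\<close>

lemma sharp_pD_mult: "sharp (pD * F) = - (pX * sharp F)"
proof (rule pdo_eqI)
  fix a b :: int
  obtain N1 where N1: "\<And>M. N1 \<le> M \<Longrightarrow> cf (sharp F) (a-1,b) = sharp_sum F (a-1) b M" using cf_sharp by blast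
  obtain N3 where N3: "\<And>M. N3 \<le> M \<Longrightarrow> cf (sharp (pD * F)) (a,b) = sharp_sum (pD * F) a b M" using cf_sharp by blast
  obtain K where K: "bdd K (cf F)" using bdd_cf by blast
  \<comment> \<open>The summand beyond the bound K makes the unmatched last term of the shifted sum
    vanish.\<close>
  define M where "M = N1 + N3 + Suc (nat (K - b))"
  let ?e = "\<lambda>j. of_int (b + int j) * (alt (a + int j) * leibniz (b + int j - 1) (a + int j - 1) (j - 1))"
  have "K < b + int (Suc M)" unfolding M_def by linarith
  hence z: "cf F (b + int (Suc M), a + int M) = 0"
    using bddD[OF K, of "(b + int (Suc M), a + int M)"] by auto
  have g: "alt (a + int j) * leibniz (b + int j) (a + int j) j * of_int (b + int j + 1) = - (?e (Suc j))" for j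
  proof -
    have e: "b + int (Suc j) - 1 = b + int j" "a + int (Suc j) - 1 = a + int j" "even (a + int (Suc j)) = odd (a + int j)"
      "b + int j + 1 = b + int (Suc j)" "Suc j - 1 = j" by auto
    show ?thesis unfolding e by (cases "even (a + int j)") (simp_all only: if_True if_False not_False_eq_True simp_thms mult_1 mult_minus1 mult_minus_left mult_minus_right minus_minus mult.commute)
  qed
  have t: "sterm (cf (pD * F)) a b j = - sterm (cf F) (a-1) b j + (if j = 0 then 0 else ?e j *\<^sub>R cf F (b + int j, a + int j - 1))
      + (alt (a + int j) * leibniz (b + int j) (a + int j) j * of_int (b + int j + 1)) *\<^sub>R cf F (b + int (Suc j), a + int j)" for j
  proof (cases j)
    case 0 thus ?thesis by (simp add: sterm_def cf_D_mult algebra_simps)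
  next
    case (Suc i)
    have e: "a + int (Suc i) - 1 = a + int i" "a - 1 + int (Suc i) = a + int i" by auto
    have "leibniz (b + int (Suc i)) (a + int (Suc i)) (Suc i) = leibniz (b + int (Suc i)) (a + int i) (Suc i)
        + of_int (b + int (Suc i)) * leibniz (b + int (Suc i) - 1) (a + int i) i"
      using leibniz_rec2[of "a + int (Suc i)" "b + int (Suc i)" i] by (simp add: leibniz_commute[of _ "b + _"] leibniz_commute[of _ "1 + _"] e)
    note c = this
    have e': "b + int (Suc (Suc i)) = b + int (Suc i) + 1" "Suc i - 1 = i" "(Suc i = 0) = False" by auto
    show ?thesis unfolding sterm_def cf_D_mult Suc e e' if_False
      by (rule scaleR_split_aux(1)[OF c]) simp
  qed
  have "cf (sharp (pD * F)) (a,b) = sharp_sum (pD * F) a b (Suc M)" by (rule N3) (simp add: M_def)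
  also have "\<dots> = - sharp_sum F (a-1) b (Suc M) + ((\<Sum>j<Suc M. (if j = 0 then 0 else ?e j *\<^sub>R cf F (b + int j, a + int j - 1)))
      + (\<Sum>j<Suc M. (alt (a + int j) * leibniz (b + int j) (a + int j) j * of_int (b + int j + 1)) *\<^sub>R cf F (b + int (Suc j), a + int j)))"
    unfolding t by (simp only: sum.distrib sum_negf add.assoc)
  also have "(\<Sum>j<Suc M. (if j = 0 then 0 else ?e j *\<^sub>R cf F (b + int j, a + int j - 1)))
      = (\<Sum>j<M. ?e (Suc j) *\<^sub>R cf F (b + int (Suc j), a + int j))"
    unfolding sum.lessThan_Suc_shift by simp
  also have "(\<Sum>j<Suc M. (alt (a + int j) * leibniz (b + int j) (a + int j) j * of_int (b + int j + 1)) *\<^sub>R cf F (b + int (Suc j), a + int j))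
      = (\<Sum>j<M. - (?e (Suc j) *\<^sub>R cf F (b + int (Suc j), a + int j)))"
    by (simp only: g sum.lessThan_Suc z scaleR_minus_left scaleR_zero_right add_0_right minus_zero)
  also have "(\<Sum>j<M. ?e (Suc j) *\<^sub>R cf F (b + int (Suc j), a + int j)) + (\<Sum>j<M. - (?e (Suc j) *\<^sub>R cf F (b + int (Suc j), a + int j))) = 0"
    unfolding sum_negf by simp
  also have "sharp_sum F (a-1) b (Suc M) = cf (sharp F) (a-1,b)"
    using N1[of "Suc M"] by (simp add: M_def)
  finally show "cf (sharp (pD * F)) (a, b) = cf (- (pX * sharp F)) (a, b)"
    by (simp add: cf_X_mult cf_simps)
qed

lemma sharp_mult_pX: "sharp (F * pX) = sharp F * pD"
proof (rule pdo_eqI)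
  fix a b :: int
  obtain N1 where N1: "\<And>M. N1 \<le> M \<Longrightarrow> cf (sharp F) (a,b-1) = sharp_sum F a (b-1) M" using cf_sharp by blast
  obtain N3 where N3: "\<And>M. N3 \<le> M \<Longrightarrow> cf (sharp (F * pX)) (a,b) = sharp_sum (F * pX) a b M" using cf_sharp by blast
  obtain K where K: "bdd K (cf F)" using bdd_cf by blast
  define M where "M = N1 + N3 + Suc (nat (K - b))"
  let ?e = "\<lambda>j. of_int (a + int j) * (alt (a + int j) * leibniz (b + int j - 1) (a + int j - 1) (j - 1))"
  have "K < b + int M" unfolding M_def by linarith
  hence z: "cf F (b + int M, a + int (Suc M)) = 0"
    using bddD[OF K, of "(b + int M, a + int (Suc M))"] by auto
  have g: "alt (a + int j) * leibniz (b + int j) (a + int j) j * of_int (a + int j + 1) = - (?e (Suc j))" for j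
  proof -
    have e: "b + int (Suc j) - 1 = b + int j" "a + int (Suc j) - 1 = a + int j" "even (a + int (Suc j)) = odd (a + int j)"
      "a + int j + 1 = a + int (Suc j)" "Suc j - 1 = j" by auto
    show ?thesis unfolding e by (cases "even (a + int j)") (simp_all only: if_True if_False not_False_eq_True simp_thms mult_1 mult_minus1 mult_minus_left mult_minus_right minus_minus mult.commute)
  qed
  have t: "sterm (cf (F * pX)) a b j = sterm (cf F) a (b-1) j + (if j = 0 then 0 else ?e j *\<^sub>R cf F (b + int j - 1, a + int j))
      + (alt (a + int j) * leibniz (b + int j) (a + int j) j * of_int (a + int j + 1)) *\<^sub>R cf F (b + int j, a + int (Suc j))" for j
  proof (cases j)
    case 0 thus ?thesis by (simp add: sterm_def cf_mult_X algebra_simps)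
  next
    case (Suc i)
    have e: "b + int (Suc i) - 1 = b + int i" "b - 1 + int (Suc i) = b + int i" by auto
    have "leibniz (b + int (Suc i)) (a + int (Suc i)) (Suc i) = leibniz (b + int i) (a + int (Suc i)) (Suc i)
        + of_int (a + int (Suc i)) * leibniz (b + int i) (a + int (Suc i) - 1) i"
      using leibniz_rec2[of "b + int (Suc i)" "a + int (Suc i)" i] unfolding e .
    note c = this
    have e': "a + int (Suc (Suc i)) = a + int (Suc i) + 1" "Suc i - 1 = i" "(Suc i = 0) = False" by auto
    show ?thesis unfolding sterm_def cf_mult_X Suc e e' if_False
      by (rule scaleR_split_aux(2)[OF c refl])
  qed
  have "cf (sharp (F * pX)) (a,b) = sharp_sum (F * pX) a b (Suc M)" by (rule N3) (simp add: M_def)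
  also have "\<dots> = sharp_sum F a (b-1) (Suc M) + ((\<Sum>j<Suc M. (if j = 0 then 0 else ?e j *\<^sub>R cf F (b + int j - 1, a + int j)))
      + (\<Sum>j<Suc M. (alt (a + int j) * leibniz (b + int j) (a + int j) j * of_int (a + int j + 1)) *\<^sub>R cf F (b + int j, a + int (Suc j))))"
    unfolding t by (simp only: sum.distrib add.assoc)
  also have "(\<Sum>j<Suc M. (if j = 0 then 0 else ?e j *\<^sub>R cf F (b + int j - 1, a + int j)))
      = (\<Sum>j<M. ?e (Suc j) *\<^sub>R cf F (b + int j, a + int (Suc j)))"
    unfolding sum.lessThan_Suc_shift by simp
  also have "(\<Sum>j<Suc M. (alt (a + int j) * leibniz (b + int j) (a + int j) j * of_int (a + int j + 1)) *\<^sub>R cf F (b + int j, a + int (Suc j)))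
      = (\<Sum>j<M. - (?e (Suc j) *\<^sub>R cf F (b + int j, a + int (Suc j))))"
    by (simp only: g sum.lessThan_Suc z scaleR_minus_left scaleR_zero_right add_0_right minus_zero)
  also have "(\<Sum>j<M. ?e (Suc j) *\<^sub>R cf F (b + int j, a + int (Suc j))) + (\<Sum>j<M. - (?e (Suc j) *\<^sub>R cf F (b + int j, a + int (Suc j)))) = 0"
    unfolding sum_negf by simp
  also have "sharp_sum F a (b-1) (Suc M) = cf (sharp F) (a,b-1)"
    using N1[of "Suc M"] by (simp add: M_def)
  finally show "cf (sharp (F * pX)) (a, b) = cf (sharp F * pD) (a, b)"
    by (simp add: cf_mult_D)
qed

lemma sharp_0: "sharp 0 = 0"
  using sharp_add[of 0 0] by simp

lemma sharp_uminus: "sharp (- F) = - sharp F"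
  using sharp_add[of F "- F"] by (simp add: sharp_0 eq_neg_iff_add_eq_0 add.commute)

lemma sharp_diff: "sharp (F - G) = sharp F - sharp G"
  by (simp add: diff_conv_add_uminus sharp_add sharp_uminus del: add_uminus_conv_diff)

lemma sharp_sum: "sharp (sum f A) = (\<Sum>x\<in>A. sharp (f x))"
  by (induction A rule: infinite_finite_induct) (auto simp: sharp_0 sharp_add)

lemma sharp_1: "sharp 1 = 1"
proof (rule pdo_eqI)
  fix a b
  have "{j. cf (1::'a pdo) (b + int j, a + int j) \<noteq> 0} \<subseteq> {nat (-a)}"
    by (auto simp: cf_simps)
  hence "cf (sharp (1::'a pdo)) (a,b) = (\<Sum>j\<in>{nat (-a)}. (alt (a + int j) * leibniz (b + int j) (a + int j) j) *\<^sub>R cf 1 (b + int j, a + int j))"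
    unfolding sharp.rep_eq sharp_fun_def prod.case sterm_def by (intro sum.mono_neutral_left) auto
  moreover have "leibniz 0 0 j = (if j = 0 then 1 else 0)" for j by (cases j) (auto simp: leibniz_def)
  ultimately show "cf (sharp (1::'a pdo)) (a,b) = cf 1 (a,b)"
    by (auto simp: cf_simps)
qed

lemma sharp_D_minus_mult: "sharp ((pD - pconst z) * F) = - ((pX + pconst z) * sharp F)"
  by (simp add: left_diff_distrib distrib_right sharp_diff sharp_pD_mult sharp_pconst_mult)

text \<open>No series is manipulated: the rule for \<open>pD - pconst z\<close>, applied to its
  product with \<open>dinv z * F\<close>, already determines the image.\<close>

lemma sharp_dinv_mult: "sharp (dinv z * F) = - (xinv (- z) * sharp F)"
proof -
  have "sharp F = sharp ((pD - pconst z) * (dinv z * F))"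
    by (simp add: mult.assoc[symmetric] dinv_right)
  also have "\<dots> = - ((pX - pconst (- z)) * sharp (dinv z * F))"
    by (simp add: sharp_D_minus_mult pconst_uminus)
  finally have "xinv (- z) * sharp F = - (xinv (- z) * (pX - pconst (- z)) * sharp (dinv z * F))"
    by (simp add: mult.assoc)
  thus ?thesis by (simp add: xinv_left)
qed

lemma pconst_cm: "pconst c * F = F * pconst (c :: 'a :: {real_algebra_1, comm_ring_1})"
  by (rule pdo_eqI) (simp add: cf_pconst_mult cf_mult_pconst mult.commute)

text \<open>With commutative coefficients the constant on the right can pass to the left, where # is
  known to preserve it.\<close>

lemma sharp_mult_X_minus:
  "sharp (F * (pX - pconst z)) = sharp F * (pD - pconst (z :: 'a :: {real_algebra_1, comm_ring_1}))"
  by (simp add: right_diff_distrib sharp_diff sharp_mult_pX sharp_pconst_mult flip: pconst_cm)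

section \<open>Leading terms and the absence of zero divisors\<close>

lemma pdo_leading:
  assumes "(F :: 'a :: real_algebra_1 pdo) \<noteq> 0"
  obtains p where "cf F p \<noteq> 0" "\<And>q. cf F q \<noteq> 0 \<Longrightarrow> fst q < fst p \<or> fst q = fst p \<and> snd q \<le> snd p"
proof -
  obtain K where K: "bdd K (cf F)" using bdd_cf by blast
  obtain r where r: "cf F r \<noteq> 0" using assms pdo_eqI[of F 0] by (auto simp: cf_simps)
  obtain p1 where p1: "cf F p1 \<noteq> 0" "\<And>q. cf F q \<noteq> 0 \<Longrightarrow> fst q \<le> fst p1"
  proof -
    \<comment> \<open>Exponents are bounded above by K, so a maximal exponent is a minimum of this
      distance to K in the natural numbers.\<close>
    define g where "g = (\<lambda>q :: int \<times> int. nat (K - fst q))"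
    obtain p where "cf F p \<noteq> 0" "\<And>q. cf F q \<noteq> 0 \<Longrightarrow> g p \<le> g q"
      using arg_min_nat_lemma[of "\<lambda>q. cf F q \<noteq> 0" r g] r by blast
    moreover from this have "fst q \<le> fst p" if "cf F q \<noteq> 0" for q
      using bddD[OF K that] bddD[OF K, of p] calculation(2)[OF that] by (auto simp: g_def nat_le_eq_zle)
    ultimately show ?thesis using that by blast
  qed
  obtain p2 where p2: "cf F (fst p1, p2) \<noteq> 0" "\<And>m. cf F (fst p1, m) \<noteq> 0 \<Longrightarrow> m \<le> p2"
  proof -
    define g where "g = (\<lambda>m. nat (K - m))"
    obtain p where p: "cf F (fst p1, p) \<noteq> 0" "\<And>q. cf F (fst p1, q) \<noteq> 0 \<Longrightarrow> g p \<le> g q"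
      using arg_min_nat_lemma[of "\<lambda>q. cf F (fst p1, q) \<noteq> 0" "snd p1" g] p1(1) by auto
    moreover from this have "q \<le> p" if "cf F (fst p1, q) \<noteq> 0" for q
      using bddD[OF K that] bddD[OF K p(1)] p(2)[OF that] by (auto simp: g_def nat_le_eq_zle)
    ultimately show ?thesis using that by blast
  qed
  show ?thesis
  proof (rule that[of "(fst p1, p2)"])
    fix q assume q: "cf F q \<noteq> 0"
    have "snd q \<le> p2" if "fst q = fst p1" using p2(2)[of "snd q"] q by (simp flip: that)
    thus "fst q < fst (fst p1, p2) \<or> fst q = fst (fst p1, p2) \<and> snd q \<le> snd (fst p1, p2)"
      using p1(2)[OF q] by auto
  qed (rule p2(1))
qed

text \<open>Products of monomials only involve exponents at most the sums of the given ones. Hence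
  at the sum of the lexicographically leading exponents exactly one pair contributes, with structure
  constant 1.\<close>

lemma pdo_no_zero_divisors:
  fixes F G :: "'a :: {real_algebra_1, ring_no_zero_divisors} pdo"
  assumes "F * G = 0" shows "F = 0 \<or> G = 0"
proof (rule ccontr)
  assume "\<not> ?thesis"
  then obtain p q where p: "cf F p \<noteq> 0" "\<And>q. cf F q \<noteq> 0 \<Longrightarrow> fst q < fst p \<or> fst q = fst p \<and> snd q \<le> snd p"
    and q: "cf G q \<noteq> 0" "\<And>p. cf G p \<noteq> 0 \<Longrightarrow> fst p < fst q \<or> fst p = fst q \<and> snd p \<le> snd q"
    by (metis pdo_leading)
  define r where "r = (fst p + fst q, snd p + snd q)"
  have "cf (F * G) r = (\<Sum>p'\<in>{p}. \<Sum>q'\<in>{q}. mcoeff p' q' r *\<^sub>R (cf F p' * cf G q'))"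
    unfolding times_pdo.rep_eq
  proof (rule pmult_sum)
    fix p' q' assume *: "cf F p' \<noteq> 0" "cf G q' \<noteq> 0" "mcoeff p' q' r \<noteq> 0"
    from p(2)[OF *(1)] q(2)[OF *(2)] mcoeff_le[OF *(3)]
    show "p' \<in> {p} \<and> q' \<in> {q}" by (auto simp: r_def prod_eq_iff)
  qed auto
  also have "\<dots> = cf F p * cf G q"
    by (simp add: mcoeff_def r_def)
  finally show False using assms p(1) q(1) by (simp add: cf_simps)
qed

text \<open>(G F - 1) G is 0, and G is not 0 because F G = 1. This turns one-sided inverses of
  eigenvalue operators into two-sided ones.\<close>

lemma pdo_left_inverse_right:
  fixes F G :: "'a :: {real_algebra_1, ring_no_zero_divisors} pdo"
  assumes "F * G = 1" shows "G * F = 1"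
proof -
  have "(G * F - 1) * G = G * (F * G) - G" by (simp add: algebra_simps)
  also have "\<dots> = 0" by (simp add: assms)
  finally have "G * F - 1 = 0 \<or> G = 0" by (rule pdo_no_zero_divisors)
  thus ?thesis using assms by auto
qed

section \<open>Linear operators on the Grassmann algebra\<close>

definition glinear :: "gop \<Rightarrow> bool" where
  "glinear A \<longleftrightarrow> (\<forall>v w. A (\<lambda>S. v S + w S) = (\<lambda>S. A v S + A w S)) \<and> (\<forall>c v. A (\<lambda>S. c * v S) = (\<lambda>S. c * A v S))"

text \<open>A type of class \<open>real_algebra_1\<close> can serve as coefficients of
  \<open>pdo\<close>. Complex scalars enter as the central operators \<open>lsc\<close>.\<close>

typedef lop = "{A. glinear A}" morphisms ap Abs_lop
  by (rule exI[of _ id]) (simp add: glinear_def)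

setup_lifting type_definition_lop

instantiation lop :: real_algebra_1
begin

lift_definition zero_lop :: lop is "\<lambda>v S. 0" by (simp add: glinear_def)
lift_definition one_lop :: lop is "\<lambda>v. v" by (simp add: glinear_def)
lift_definition plus_lop :: "lop \<Rightarrow> lop \<Rightarrow> lop" is "\<lambda>A B v S. A v S + B v S"
  by (simp add: glinear_def fun_eq_iff algebra_simps)
lift_definition minus_lop :: "lop \<Rightarrow> lop \<Rightarrow> lop" is "\<lambda>A B v S. A v S - B v S"
  by (simp add: glinear_def fun_eq_iff algebra_simps)
lift_definition uminus_lop :: "lop \<Rightarrow> lop" is "\<lambda>A v S. - A v S"
  by (simp add: glinear_def fun_eq_iff algebra_simps)
lift_definition times_lop :: "lop \<Rightarrow> lop \<Rightarrow> lop" is "\<lambda>A B v. A (B v)"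
  by (simp add: glinear_def)
lift_definition scaleR_lop :: "real \<Rightarrow> lop \<Rightarrow> lop" is "\<lambda>c A v S. of_real c * A v S"
  by (simp add: glinear_def fun_eq_iff algebra_simps)

instance
proof
  show "(0::lop) \<noteq> 1"
  proof
    assume "(0::lop) = 1"
    hence "(\<lambda>v S. 0) = (\<lambda>v. v :: gvec)" by transfer
    hence "(0::complex) = 1" by (auto dest!: fun_cong[of _ _ "\<lambda>_. 1"] simp: fun_eq_iff)
    thus False by simp
  qed
qed (transfer; (auto simp: fun_eq_iff algebra_simps glinear_def)[1]; fail)+

end

lift_definition lsc :: "complex \<Rightarrow> lop" is "\<lambda>c v S. c * v S"
  by (simp add: glinear_def fun_eq_iff algebra_simps)

lemma ap_simps: "ap 0 v = (\<lambda>S. 0)" "ap 1 v = v" "ap (A + B) v = (\<lambda>S. ap A v S + ap B v S)"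
  "ap (A - B) v = (\<lambda>S. ap A v S - ap B v S)" "ap (- A) v = (\<lambda>S. - ap A v S)" "ap (A * B) v = ap A (ap B v)"
  "ap (r *\<^sub>R A) v = (\<lambda>S. of_real r * ap A v S)" "ap (lsc c) v = (\<lambda>S. c * v S)"
  by (transfer, simp)+

lemma ap_sum: "ap (sum f X) v = (\<lambda>S. \<Sum>x\<in>X. ap (f x) v S)"
  by (induction X rule: infinite_finite_induct) (auto simp: ap_simps)

lemma lop_eqI: "(\<And>v S. ap A v S = ap B v S) \<Longrightarrow> A = B"
  by (metis ap_inject ext)

lemma glinear_ap: "glinear (ap A)"
  using ap by simp

lemma ap_scale: "ap A (\<lambda>S. c * v S) = (\<lambda>S. c * ap A v S)"
  using glinear_ap[of A] by (simp add: glinear_def)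

lemma lsc_cm: "lsc c * A = A * lsc c"
  by (rule lop_eqI) (simp add: ap_simps ap_scale)

lemma lsc_hom: "lsc (c + d) = lsc c + lsc d" "lsc (c * d) = lsc c * lsc d" "lsc 1 = 1" "lsc 0 = 0"
  "lsc (- c) = - lsc c" "lsc (r *\<^sub>R c) = r *\<^sub>R lsc c" "lsc (c ^ k) = lsc c ^ k" "lsc (c - d) = lsc c - lsc d"
proof -
  show 1: "lsc (c * d) = lsc c * lsc d" for c d by (rule lop_eqI; simp add: ap_simps)
  show 2: "lsc 1 = 1" by (rule lop_eqI; simp add: ap_simps)
  show "lsc (c ^ k) = lsc c ^ k" by (induction k) (simp_all add: 1 2)
qed (rule lop_eqI; simp add: ap_simps algebra_simps scaleR_conv_of_real[where 'a=complex])+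

lemma lsc_sum: "lsc (sum f X) = (\<Sum>x\<in>X. lsc (f x))"
  by (induction X rule: infinite_finite_induct) (auto simp: lsc_hom)

text \<open>The sign counts only elements of \<open>B\<close>: unlike with the sign in \<^const>\<open>xi\<close>, which degenerates on infinite
  sets, the Clifford relations then hold on all vectors as soon as \<open>B\<close> is finite.\<close>

definition gsgn :: "(nat \<times> nat) set \<Rightarrow> (nat \<times> nat) set \<Rightarrow> nat \<times> nat \<Rightarrow> complex" where
  "gsgn B S c = (-1) ^ card {d \<in> S \<inter> B. lexless d c}"

lemma gsgn_square: "gsgn B S c * gsgn B S c = 1" "gsgn B S c * (gsgn B S c * x) = x"
  by (simp_all add: gsgn_def flip: power_mult_distrib mult.assoc)

lift_definition lxi :: "(nat \<times> nat) set \<Rightarrow> nat \<times> nat \<Rightarrow> lop" is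
  "\<lambda>B c w S. if c \<in> S then gsgn B S c * w (S - {c}) else 0"
  by (simp add: glinear_def fun_eq_iff algebra_simps)

lift_definition ldd :: "(nat \<times> nat) set \<Rightarrow> nat \<times> nat \<Rightarrow> lop" is
  "\<lambda>B c w S. if c \<notin> S then gsgn B S c * w (insert c S) else 0"
  by (simp add: glinear_def fun_eq_iff algebra_simps)

text \<open>The number of predecessors of d drops by one exactly when c is one of them. All Clifford
  relations below follow from this sign change, because of two distinct generators exactly one
  precedes the other.\<close>

lemma gsgn_remove:
  assumes "finite B" "c \<in> B" "c \<in> S"
  shows "gsgn B (S - {c}) d = (if lexless c d then -1 else 1) * gsgn B S d"
proof (cases "lexless c d")
  case True
  have "{e \<in> S \<inter> B. lexless e d} = insert c {e \<in> (S - {c}) \<inter> B. lexless e d}"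
    using assms True by auto
  moreover have "finite {e \<in> (S - {c}) \<inter> B. lexless e d}" using assms(1) by auto
  ultimately have "card {e \<in> S \<inter> B. lexless e d} = Suc (card {e \<in> (S - {c}) \<inter> B. lexless e d})"
    by simp
  thus ?thesis using True by (simp add: gsgn_def)
next
  case False
  hence "{e \<in> S \<inter> B. lexless e d} = {e \<in> (S - {c}) \<inter> B. lexless e d}" by auto
  thus ?thesis using False by (simp add: gsgn_def)
qed

lemma gsgn_insert:
  assumes "finite B" "c \<in> B" "c \<notin> S"
  shows "gsgn B (insert c S) d = (if lexless c d then -1 else 1) * gsgn B S d"
  using gsgn_remove[OF assms(1,2), of "insert c S" d] assms(3) by (auto split: if_splits)

lemma lexless_irrefl: "\<not> lexless c c" and lexless_total: "c \<noteq> d \<Longrightarrow> lexless c d \<longleftrightarrow> \<not> lexless d c"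
  by (auto simp: lexless_def prod_eq_iff)

lemma ap_lxi: "ap (lxi B c) w S = (if c \<in> S then gsgn B S c * w (S - {c}) else 0)"
  by transfer simp
lemma ap_ldd: "ap (ldd B c) w S = (if c \<notin> S then gsgn B S c * w (insert c S) else 0)"
  by transfer simp

lemma lxi_lxi:
  assumes "finite B" "c \<in> B" "d \<in> B"
  shows "lxi B c * lxi B d = - (lxi B d * lxi B c)"
proof (rule lop_eqI)
  fix v S
  have "S - {c} - {d} = S - {d} - {c}" by auto
  thus "ap (lxi B c * lxi B d) v S = ap (- (lxi B d * lxi B c)) v S"
    using assms lexless_irrefl lexless_total[of c d]
    by (cases "c = d") (simp_all add: ap_simps ap_lxi gsgn_remove)
qed

lemma ldd_ldd:
  assumes "finite B" "c \<in> B" "d \<in> B"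
  shows "ldd B c * ldd B d = - (ldd B d * ldd B c)"
proof (rule lop_eqI)
  fix v S
  have "insert c (insert d S) = insert d (insert c S)" by auto
  thus "ap (ldd B c * ldd B d) v S = ap (- (ldd B d * ldd B c)) v S"
    using assms lexless_irrefl lexless_total[of c d]
    by (cases "c = d") (simp_all add: ap_simps ap_ldd gsgn_insert)
qed

lemma ldd_lxi:
  assumes "finite B" "c \<in> B" "d \<in> B"
  shows "ldd B c * lxi B d = (if c = d then 1 else 0) - lxi B d * ldd B c"
proof (rule lop_eqI)
  fix v S
  show "ap (ldd B c * lxi B d) v S = ap ((if c = d then 1 else 0) - lxi B d * ldd B c) v S"
  proof (cases "c = d")
    case True
    have "insert d (S - {d}) = S" if "d \<in> S" using that by auto
    thus ?thesis using assms True lexless_irrefl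
      by (cases "d \<in> S") (simp_all add: ap_simps ap_lxi ap_ldd gsgn_insert gsgn_remove gsgn_square insert_absorb)
  next
    case False
    have "insert c S - {d} = insert c (S - {d})" using False by auto
    thus ?thesis using assms False lexless_irrefl lexless_total[OF False]
      by (simp add: ap_simps ap_lxi ap_ldd gsgn_insert gsgn_remove)
  qed
qed

section \<open>Scalar operators, and equality of operators on one vector\<close>

lift_definition emb :: "complex pdo \<Rightarrow> lop pdo" is "\<lambda>f p. lsc (f p)"
  unfolding bdd_def using lsc_hom(4) by metis

lemma cf_emb: "cf (emb F) p = lsc (cf F p)"
  by transfer simp

lemma emb_mult: "emb (F * G) = emb F * emb G"
proof (rule pdo_eqI)
  fix a b
  obtain K where K: "bdd K (cf F)" "bdd K (cf G)" using bdd_cf2 by blast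
  hence K': "bdd K (cf (emb F))" "bdd K (cf (emb G))"
    unfolding bdd_def cf_emb using lsc_hom(4) by metis+
  define L where "L = min a b - K"
  have L: "L \<le> fst (a,b) - K" "L \<le> snd (a,b) - K" by (auto simp: L_def)
  show "cf (emb (F * G)) (a, b) = cf (emb F * emb G) (a, b)"
    unfolding times_pdo.rep_eq cf_emb pmult_box[OF K L] pmult_box[OF K' L]
    by (simp add: lsc_sum lsc_hom)
qed

lemma emb_1: "emb 1 = 1" and emb_diff: "emb (F - G) = emb F - emb G"
  by (rule pdo_eqI; simp add: cf_emb cf_simps lsc_hom)+

lemma emb_pmon: "emb (pmon p c) = pmon p (lsc c)"
  by (rule pdo_eqI) (simp add: cf_emb cf_pmon lsc_hom)

definition veq :: "gvec \<Rightarrow> lop pdo \<Rightarrow> lop pdo \<Rightarrow> bool" where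
  "veq v F G \<longleftrightarrow> (\<forall>r. ap (cf F r) v = ap (cf G r) v)"

lemma veq_mult_cong:
  assumes "\<And>p q. ap (cf F p * cf G q) v = ap (cf F' p * cf G' q) v" shows "veq v (F * G) (F' * G')"
  unfolding veq_def
proof
  fix r
  obtain K1 where K1: "bdd K1 (cf F)" "bdd K1 (cf G)" using bdd_cf2 by blast
  obtain K2 where K2: "bdd K2 (cf F')" "bdd K2 (cf G')" using bdd_cf2 by blast
  define K where "K = max K1 K2"
  have K: "bdd K (cf F)" "bdd K (cf G)" "bdd K (cf F')" "bdd K (cf G')"
    using K1 K2 by (auto simp: K_def intro: bdd_mono)
  define L where "L = min (fst r) (snd r) - K"
  have L: "L \<le> fst r - K" "L \<le> snd r - K" by (auto simp: L_def)
  show "ap (cf (F * G) r) v = ap (cf (F' * G') r) v"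
    unfolding times_pdo.rep_eq pmult_box[OF K(1,2) L] pmult_box[OF K(3,4) L]
    by (simp only: ap_sum ap_simps(7) assms)
qed

lemma veqD: "veq v F G \<Longrightarrow> ap (cf F p) v = ap (cf G p) v"
  unfolding veq_def by blast

text \<open>Coefficients multiplied from the left act after those already applied to v, so any
  operator is allowed there. On the right only scalar coefficients are, as in
  \<open>veq_mult_emb\<close>, since they can be moved past the others.\<close>

lemma veq_mult: "veq v F G \<Longrightarrow> veq v (H * F) (H * G)"
  by (rule veq_mult_cong) (simp only: ap_simps(6) veqD[of v F G])

lemma veq_mult_emb: "veq v F G \<Longrightarrow> veq v (F * emb H) (G * emb H)"
  by (rule veq_mult_cong) (simp only: cf_emb lsc_cm[symmetric] ap_simps(6) veqD[of v F G])

lemma veq_sharp: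
  assumes "veq v F G" shows "veq v (sharp F) (sharp G)"
  unfolding veq_def
proof
  fix r :: "int \<times> int"
  obtain a b where r: "r = (a,b)" by force
  obtain M where "cf (sharp F) (a,b) = sharp_sum F a b M" "cf (sharp G) (a,b) = sharp_sum G a b M"
    by (rule cf_sharp2)
  thus "ap (cf (sharp F) r) v = ap (cf (sharp G) r) v"
    using assms by (simp add: r ap_sum sterm_def ap_simps veq_def)
qed

lemma sharp_emb: "sharp (emb F) = emb (sharp F)"
proof (rule pdo_eqI)
  fix a b
  obtain N1 where N1: "\<And>M. N1 \<le> M \<Longrightarrow> cf (sharp F) (a,b) = sharp_sum F a b M" using cf_sharp by blast
  obtain N2 where N2: "\<And>M. N2 \<le> M \<Longrightarrow> cf (sharp (emb F)) (a,b) = sharp_sum (emb F) a b M" using cf_sharp by blast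
  show "cf (sharp (emb F)) (a, b) = cf (emb (sharp F)) (a, b)"
    using N1[of "N1+N2"] N2[of "N1+N2"] by (simp add: cf_emb lsc_sum sterm_def lsc_hom)
qed

text \<open>A functional dual to the eigenvector turns operator coefficients into scalars.\<close>

lemma lin_functional_left_inverse:
  assumes "v S0 \<noteq> 0" "veq v (H * emb F) (emb G)"
  obtains H' where "H' * F = G"
proof -
  obtain K1 where K1: "bdd K1 (cf H)" using bdd_cf by blast
  define h where "h = (\<lambda>p. ap (cf H p) v S0 / v S0)"
  have h: "bdd K1 h" using K1 unfolding bdd_def h_def by (metis ap_simps(1) div_0)
  define H' where "H' = Abs_pdo h"
  have cfH: "cf H' = h" unfolding H'_def using h by (intro Abs_pdo_inverse) auto
  have "H' * F = G"
  proof (rule pdo_eqI)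
    fix a b
    obtain K2 where K2: "bdd K2 (cf F)" "bdd K2 (cf (emb F))"
    proof -
      obtain K where "bdd K (cf F)" using bdd_cf by blast
      moreover from this have "bdd K (cf (emb F))" unfolding bdd_def cf_emb using lsc_hom(4) by metis
      ultimately show ?thesis using that by blast
    qed
    define K where "K = max K1 K2"
    have K: "bdd K (cf H)" "bdd K h" "bdd K (cf F)" "bdd K (cf (emb F))" using K1 K2 h by (auto simp: K_def intro: bdd_mono)
    define L where "L = min a b - K"
    have L: "L \<le> fst (a,b) - K" "L \<le> snd (a,b) - K" by (auto simp: L_def)
    have "cf (H' * F) (a,b) = ap (cf (H * emb F) (a,b)) v S0 / v S0"
      unfolding times_pdo.rep_eq cfH pmult_box[OF K(2,3) L] pmult_box[OF K(1,4) L]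
      by (simp add: ap_sum ap_simps cf_emb h_def sum_divide_distrib scaleR_conv_of_real[where 'a=complex] ap_scale)
        (simp add: mult_ac)
    also have "\<dots> = cf G (a,b)"
      using assms by (simp add: veq_def cf_emb ap_simps)
    finally show "cf (H' * F) (a,b) = cf G (a,b)" .
  qed
  thus ?thesis using that by blast
qed

section \<open>Row determinants in noncommutative rings\<close>

definition cm :: "'r::ring_1 \<Rightarrow> 'r \<Rightarrow> bool" where "cm a b \<longleftrightarrow> a * b = b * a"
definition acm :: "'r::ring_1 \<Rightarrow> 'r \<Rightarrow> bool" where "acm a b \<longleftrightarrow> a * b = - (b * a)"

lemma cm_sym: "cm a b \<Longrightarrow> cm b a" and acm_sym: "acm a b \<Longrightarrow> acm b a"
  by (simp_all add: cm_def acm_def)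

lemma cm_0 [simp]: "cm a 0" "cm 0 a" and cm_1 [simp]: "cm a 1" "cm 1 a" and acm_0 [simp]: "acm a 0" "acm 0 a"
  and cm_self [simp]: "cm a a"
  by (simp_all add: cm_def acm_def)

lemma cm_add: "cm a b \<Longrightarrow> cm a c \<Longrightarrow> cm a (b + c)" and cm_diff: "cm a b \<Longrightarrow> cm a c \<Longrightarrow> cm a (b - c)"
  and acm_add: "acm a b \<Longrightarrow> acm a c \<Longrightarrow> acm a (b + c)" and acm_diff: "acm a b \<Longrightarrow> acm a c \<Longrightarrow> acm a (b - c)"
  by (simp_all add: cm_def acm_def algebra_simps)

lemma cm_sum: "(\<And>x. x \<in> X \<Longrightarrow> cm a (f x)) \<Longrightarrow> cm a (sum f X)"
  by (induction X rule: infinite_finite_induct) (auto intro: cm_add)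

lemma acm_sum: "(\<And>x. x \<in> X \<Longrightarrow> acm a (f x)) \<Longrightarrow> acm a (sum f X)"
  by (induction X rule: infinite_finite_induct) (auto intro: acm_add)

lemma cm_mult: "cm a b \<Longrightarrow> cm a c \<Longrightarrow> cm a (b * c)"
  unfolding cm_def by (metis mult.assoc)

lemma cm_mult_ac: "acm a b \<Longrightarrow> acm a c \<Longrightarrow> cm a (b * c)"
  unfolding cm_def acm_def by (metis mult.assoc mult_minus_left mult_minus_right minus_minus)

lemma acm_mult1: "acm a b \<Longrightarrow> cm a c \<Longrightarrow> acm a (b * c)"
  unfolding cm_def acm_def by (metis mult.assoc mult_minus_left)

lemma acm_mult2: "cm a b \<Longrightarrow> acm a c \<Longrightarrow> acm a (b * c)"
  unfolding cm_def acm_def by (metis mult.assoc mult_minus_right)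

lemma cm_prod_list: "(\<And>x. x \<in> set xs \<Longrightarrow> cm a x) \<Longrightarrow> cm a (prod_list xs)"
  by (induction xs) (auto intro: cm_mult)

lemma cm_of_int: "cm a (of_int z :: 'r::ring_1)"
  by (simp add: cm_def mult_of_int_commute)

lemma cm_inverse:
  assumes "cm a b" "b * bi = 1" "bi * b = 1" shows "cm a bi"
proof -
  have "a * bi = (bi * b) * (a * bi)" by (simp add: assms)
  also have "\<dots> = bi * (b * a) * bi" by (simp add: mult.assoc)
  also have "\<dots> = bi * (a * b) * bi" using assms(1) by (simp add: cm_def)
  also have "\<dots> = bi * a * (b * bi)" by (simp add: mult.assoc)
  finally show ?thesis by (simp add: cm_def assms)
qed

lemma prod_list_ac:
  "(\<And>x. x \<in> set xs \<Longrightarrow> acm x z) \<Longrightarrow> prod_list xs * z = (-1) ^ length xs * (z * prod_list xs)"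
proof (induction xs)
  case (Cons x xs)
  have "prod_list (x # xs) * z = x * (prod_list xs * z)" by (simp add: mult.assoc)
  also have "\<dots> = x * ((-1) ^ length xs * (z * prod_list xs))" using Cons by simp
  also have "\<dots> = (-1) ^ length xs * ((x * z) * prod_list xs)"
    by (cases "even (length xs)") (simp_all add: mult.assoc)
  also have "x * z = - (z * x)" using Cons.prems[of x] by (simp add: acm_def)
  finally show ?case by (simp add: mult.assoc)
qed simp

text \<open>The factor z is moved through the product, changing only the sign, until it meets its
  own copy.\<close>

lemma prod_list_annihilate:
  assumes "z \<in> set xs" "z * z = 0" "\<And>x. x \<in> set xs \<Longrightarrow> acm z x"
  shows "z * prod_list xs = 0"
  using assms
proof (induction xs)
  case (Cons x xs)
  show ?case
  proof (cases "z = x")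
    case True thus ?thesis using Cons.prems(2) by (simp add: mult.assoc[symmetric])
  next
    case False
    have "z * prod_list (x # xs) = - (x * (z * prod_list xs))"
      using Cons.prems(3)[of x] by (simp add: acm_def mult.assoc[symmetric])
    thus ?thesis using Cons False by simp
  qed
qed simp

section \<open>Row determinants as products of anticommuting forms\<close>

abbreviation lprod :: "(nat \<Rightarrow> 'r::monoid_mult) \<Rightarrow> nat \<Rightarrow> 'r" where
  "lprod f N \<equiv> prod_list (map f [0..<N])"

lemma upt_cons_app: "i \<le> a \<Longrightarrow> a < N \<Longrightarrow> [i..<N] = [i..<a] @ a # [Suc a..<N]"
  using upt_add_eq_append[of i a "N - a"] upt_conv_Cons[of a N] by simp

text \<open>Each of the two exchanged factors passes the block between them with the same sign, and
  these signs cancel. What remains is the sign from exchanging the two factors themselves.\<close>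

lemma prod_list_transpose:
  fixes h :: "nat \<Rightarrow> 'r::ring_1"
  assumes "a < b" "b < N" "\<And>i j. i < N \<Longrightarrow> j < N \<Longrightarrow> acm (h i) (h j)"
  shows "lprod (h \<circ> Transposition.transpose a b) N = - lprod h N"
proof -
  have l: "[0..<N] = [0..<a] @ [a] @ [Suc a..<b] @ [b] @ [Suc b..<N]"
    using upt_cons_app[of 0 a N] upt_cons_app[of "Suc a" b N] assms(1,2) by simp
  let ?M = "prod_list (map h [Suc a..<b])"
  have m: "map (h \<circ> Transposition.transpose a b) xs = map h xs" if "a \<notin> set xs" "b \<notin> set xs" for xs
    using that by (auto simp: Transposition.transpose_def)
  let ?s = "(-1 :: 'r) ^ length (map h [Suc a..<b])"
  have 1: "?M * h a = ?s * (h a * ?M)" and 2: "?M * h b = ?s * (h b * ?M)"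
    by (rule prod_list_ac; use assms in auto)+
  have 3: "h b * h a = - (h a * h b)" using assms(3)[of b a] assms(1,2) by (simp add: acm_def)
  have F: "h b * (?M * h a) = - (h a * (?M * h b))"
  proof -
    have 4: "h b * (h a * ?M) = - (h a * (h b * ?M))"
      by (simp only: mult.assoc[symmetric] 3 mult_minus_left)
    have "?s = 1 \<or> ?s = - 1" by (cases "even (length (map h [Suc a..<b]))") simp_all
    thus ?thesis using 1 2 4 by (elim disjE) (simp_all del: length_map length_upt)
  qed
  have "P * (h b * (?M * (h a * Q))) = - (P * (h a * (?M * (h b * Q))))" for P Q
  proof -
    have "P * (h b * (?M * (h a * Q))) = P * ((h b * (?M * h a)) * Q)" by (simp only: mult.assoc)
    also have "\<dots> = - (P * (h a * (?M * (h b * Q))))" unfolding F by (simp only: mult.assoc mult_minus_left mult_minus_right)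
    finally show ?thesis .
  qed
  note G = this
  have m1: "map (h \<circ> Transposition.transpose a b) [0..<a] = map h [0..<a]"
    and m2: "map (h \<circ> Transposition.transpose a b) [Suc a..<b] = map h [Suc a..<b]"
    and m3: "map (h \<circ> Transposition.transpose a b) [Suc b..<N] = map h [Suc b..<N]"
    using assms(1) by (auto intro!: m)
  show ?thesis unfolding l
    by (simp only: map_append list.map m1 m2 m3 o_apply transpose_apply_first transpose_apply_second
        prod_list.append prod_list.Cons prod_list.Nil mult_1_right mult.assoc) (rule G)
qed

lemma prod_list_permutes:
  fixes h :: "nat \<Rightarrow> 'r::ring_1"
  assumes "p permutes {..<N}" "\<And>i j. i < N \<Longrightarrow> j < N \<Longrightarrow> acm (h i) (h j)"
  shows "lprod (h \<circ> p) N = of_int (sign p) * lprod h N"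
  using assms(1) finite_lessThan assms(2)
proof (induction p arbitrary: h rule: permutes_induct)
  case id thus ?case by simp
next
  case (swap a b p)
  let ?t = "Transposition.transpose a b"
  have t: "?t i < N" if "i < N" for i using swap.hyps that by (auto simp: Transposition.transpose_def)
  have p: "permutation p" using swap.hyps by (meson finite_lessThan permutes_imp_permutation)
  have "lprod (h \<circ> (?t \<circ> p)) N = lprod ((h \<circ> ?t) \<circ> p) N"
    by (simp only: comp_assoc)
  also have "\<dots> = of_int (sign p) * lprod (h \<circ> ?t) N"
    by (rule swap.IH) (use swap.prems t in auto)
  also have "lprod (h \<circ> ?t) N = - lprod h N"
  proof (cases "a < b")
    case True thus ?thesis using swap by (intro prod_list_transpose) auto
  next
    case False
    thus ?thesis using swap prod_list_transpose[of b a N h] by (simp add: Transposition.transpose_commute)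
  qed
  moreover have "sign (?t \<circ> p) = - sign p"
    using swap.hyps(3) by (subst sign_compose[OF permutation_swap_id p]) (simp add: sign_swap_id)
  ultimately show ?case by (simp only: of_int_minus mult_minus_left mult_minus_right)
qed

definition rdetR :: "nat \<Rightarrow> (nat \<Rightarrow> nat \<Rightarrow> 'r::ring_1) \<Rightarrow> 'r" where
  "rdetR N A = (\<Sum>\<sigma> \<in> {\<sigma>. \<sigma> permutes {..<N}}. of_int (sign \<sigma>) * lprod (\<lambda>r. A r (\<sigma> r)) N)"

lemma prod_list_sum_distrib:
  fixes g :: "nat \<Rightarrow> nat \<Rightarrow> 'r::ring_1"
  assumes "finite S"
  shows "lprod (\<lambda>r. \<Sum>c\<in>S. g r c) N = (\<Sum>f \<in> {..<N} \<rightarrow>\<^sub>E S. lprod (\<lambda>r. g r (f r)) N)"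
proof (induction N)
  case (Suc N)
  have "lprod (\<lambda>r. \<Sum>c\<in>S. g r c) (Suc N)
      = (\<Sum>(c,f)\<in>S \<times> ({..<N} \<rightarrow>\<^sub>E S). lprod (\<lambda>r. g r (f r)) N * g N c)"
    by (simp add: Suc sum_product sum.cartesian_product[symmetric]) (rule sum.swap)
  also have "\<dots> = (\<Sum>f \<in> {..<Suc N} \<rightarrow>\<^sub>E S. lprod (\<lambda>r. g r (f r)) (Suc N))"
  proof (rule sum.reindex_bij_witness[where i="\<lambda>f. (f N, f(N := undefined))" and j="\<lambda>(c,f). f(N := c)"])
    fix cf assume "cf \<in> S \<times> ({..<N} \<rightarrow>\<^sub>E S)"
    thus "(\<lambda>f. (f N, f(N := undefined))) ((\<lambda>(c,f). f(N := c)) cf) = cf"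
      by (auto simp: PiE_def extensional_def fun_eq_iff)
    show "(\<lambda>(c,f). f(N := c)) cf \<in> {..<Suc N} \<rightarrow>\<^sub>E S" if "cf \<in> S \<times> ({..<N} \<rightarrow>\<^sub>E S)"
      using that by (auto simp: PiE_def extensional_def Pi_def lessThan_Suc)
    obtain c f where cf: "cf = (c, f)" by force
    have "map (\<lambda>r. g r ((f(N := c)) r)) [0..<N] = map (\<lambda>r. g r (f r)) [0..<N]"
      by auto
    thus "lprod (\<lambda>r. g r (((\<lambda>(c,f). f(N := c)) cf) r)) (Suc N) = (case cf of (c,f) \<Rightarrow> lprod (\<lambda>r. g r (f r)) N * g N c)"
      unfolding cf prod.case by (simp only: upt_Suc_append[OF le0] map_append prod_list.append) simp
  next
    fix f assume "f \<in> {..<Suc N} \<rightarrow>\<^sub>E S"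
    thus "(\<lambda>(c,f). f(N := c)) ((\<lambda>f. (f N, f(N := undefined))) f) = f" "(f N, f(N := undefined)) \<in> S \<times> ({..<N} \<rightarrow>\<^sub>E S)"
      by (auto simp: PiE_def extensional_def Pi_def)
  qed
  finally show ?case .
qed simp

lemma prod_list_cm_split:
  fixes g h :: "nat \<Rightarrow> 'r::ring_1"
  assumes "\<And>i j. i < N \<Longrightarrow> j < N \<Longrightarrow> cm (h i) (g j)"
  shows "lprod (\<lambda>r. g r * h r) N = lprod g N * lprod h N"
  using assms
proof (induction N)
  case (Suc N)
  have "cm (g N) (lprod h N)" by (rule cm_prod_list) (use Suc.prems in \<open>auto intro: cm_sym\<close>)
  hence c: "lprod h N * g N = g N * lprod h N" by (simp add: cm_def)
  have "lprod (\<lambda>r. g r * h r) (Suc N) = lprod g N * (lprod h N * g N) * h N"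
    using Suc by (simp add: mult.assoc)
  also have "\<dots> = lprod g (Suc N) * lprod h (Suc N)"
    unfolding c by (simp add: mult.assoc)
  finally show ?case .
qed simp

text \<open>Expanding the product gives one term for each choice of columns. A repeated column
  repeats an odd variable and kills the term; a permutation contributes its sign. The entries pass
  only the odd variables and never each other, so they stay in the order of the rows.\<close>

lemma rdetR_forms:
  fixes th :: "nat \<Rightarrow> 'r::ring_1"
  assumes acm: "\<And>i j. i < N \<Longrightarrow> j < N \<Longrightarrow> acm (th i) (th j)" and sq: "\<And>i. i < N \<Longrightarrow> th i * th i = 0"
    and cmA: "\<And>i r c. i < N \<Longrightarrow> r < N \<Longrightarrow> c < N \<Longrightarrow> cm (th i) (A r c)"
  shows "lprod (\<lambda>r. \<Sum>c<N. A r c * th c) N = rdetR N A * lprod th N"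
proof -
  let ?P = "lprod th N"
  let ?t = "\<lambda>f. lprod (\<lambda>r. A r (f r)) N * lprod (\<lambda>r. th (f r)) N"
  have "lprod (\<lambda>r. \<Sum>c<N. A r c * th c) N
     = (\<Sum>f \<in> {..<N} \<rightarrow>\<^sub>E {..<N}. lprod (\<lambda>r. A r (f r) * th (f r)) N)"
    by (rule prod_list_sum_distrib) simp
  also have "\<dots> = (\<Sum>f \<in> {..<N} \<rightarrow>\<^sub>E {..<N}. ?t f)"
    by (rule sum.cong[OF refl], rule prod_list_cm_split, rule cmA) auto
  also have "\<dots> = (\<Sum>f \<in> {f\<in>{..<N} \<rightarrow>\<^sub>E {..<N}. inj_on f {..<N}}. ?t f)"
  proof (rule sum.mono_neutral_right)
    show "\<forall>f\<in>({..<N} \<rightarrow>\<^sub>E {..<N}) - {f \<in> {..<N} \<rightarrow>\<^sub>E {..<N}. inj_on f {..<N}}. ?t f = 0"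
    proof
      fix f assume f: "f \<in> ({..<N} \<rightarrow>\<^sub>E {..<N}) - {f \<in> {..<N} \<rightarrow>\<^sub>E {..<N}. inj_on f {..<N}}"
      hence "\<not> inj_on f {..<N}" by auto
      then obtain i' j' where ij': "i' < N" "j' < N" "f i' = f j'" "i' \<noteq> j'" by (auto simp: inj_on_def)
      obtain i j where ij: "i < j" "j < N" "f i = f j"
      proof (cases "i' < j'")
        case True thus ?thesis using ij' that by blast
      next
        case False thus ?thesis using ij' that[of j' i'] by simp
      qed
      have fl: "f r < N" if "r < N" for r using f that by auto
      have l: "[0..<N] = [0..<i] @ i # [Suc i..<N]"
        using ij by (intro upt_cons_app) auto
      have "th (f i) * prod_list (map (\<lambda>r. th (f r)) [Suc i..<N]) = 0"
      proof (rule prod_list_annihilate)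
        show "th (f i) \<in> set (map (\<lambda>r. th (f r)) [Suc i..<N])" using ij by auto
      qed (use fl ij in \<open>auto intro!: sq acm\<close>)
      thus "?t f = 0" unfolding l by simp
    qed
  qed (auto intro: finite_PiE)
  also have "\<dots> = (\<Sum>\<sigma> | \<sigma> permutes {..<N}. ?t \<sigma>)"
  proof (rule sum.reindex_bij_witness[where i="\<lambda>\<sigma> r. if r < N then \<sigma> r else undefined" and j="\<lambda>f r. if r < N then f r else r"])
    fix f assume f: "f \<in> {f \<in> {..<N} \<rightarrow>\<^sub>E {..<N}. inj_on f {..<N}}"
    thus "(\<lambda>r. if r < N then if r < N then f r else r else undefined) = f"
      by (auto simp: PiE_def extensional_def)
    have "bij_betw f {..<N} {..<N}"
      using f endo_inj_surj[of "{..<N}" f] by (fastforce simp: bij_betw_def)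
    hence "bij_betw (\<lambda>r. if r < N then f r else r) {..<N} {..<N}"
      by (rule bij_betw_cong[THEN iffD1, rotated]) auto
    thus "(\<lambda>r. if r < N then f r else r) \<in> {\<sigma>. \<sigma> permutes {..<N}}"
      by (auto intro!: bij_imp_permutes split: if_splits)
    have "map (\<lambda>r. A r (if r < N then f r else r)) [0..<N] = map (\<lambda>r. A r (f r)) [0..<N]"
      "map (\<lambda>r. th (if r < N then f r else r)) [0..<N] = map (\<lambda>r. th (f r)) [0..<N]" by auto
    thus "?t (\<lambda>r. if r < N then f r else r) = ?t f" by (simp only:)
  next
    fix \<sigma> assume "\<sigma> \<in> {\<sigma>. \<sigma> permutes {..<N}}"
    hence s: "\<sigma> permutes {..<N}" by simp
    show "(\<lambda>r. if r < N then if r < N then \<sigma> r else undefined else r) = \<sigma>"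
      using s by (auto simp: permutes_def)
    have "\<sigma> r < N" if "r < N" for r using permutes_in_image[OF s, of r] that by auto
    thus "(\<lambda>r. if r < N then \<sigma> r else undefined) \<in> {f \<in> {..<N} \<rightarrow>\<^sub>E {..<N}. inj_on f {..<N}}"
      using permutes_inj[OF s] by (auto simp: inj_on_def split: if_splits)
  qed
  also have "\<dots> = rdetR N A * ?P"
    unfolding rdetR_def sum_distrib_right
  proof (rule sum.cong[OF refl])
    fix \<sigma> assume "\<sigma> \<in> {\<sigma>. \<sigma> permutes {..<N}}"
    hence h: "lprod (\<lambda>r. th (\<sigma> r)) N = of_int (sign \<sigma>) * ?P"
      using prod_list_permutes[of \<sigma> N th] acm by (simp add: o_def)
    have "?t \<sigma> = (lprod (\<lambda>r. A r (\<sigma> r)) N * of_int (sign \<sigma>)) * ?P"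
      unfolding h by (simp only: mult.assoc)
    thus "?t \<sigma> = of_int (sign \<sigma>) * lprod (\<lambda>r. A r (\<sigma> r)) N * ?P"
      by (simp only: mult_of_int_commute)
  qed
  finally show ?thesis .
qed

text \<open>The sum of all products $f_0\cdots f_{N-1}$ in which exactly $j$ factors $f_a$ are replaced by $g_a$.\<close>

fun mixed :: "(nat \<Rightarrow> 'r::ring_1) \<Rightarrow> (nat \<Rightarrow> 'r) \<Rightarrow> nat \<Rightarrow> nat \<Rightarrow> 'r" where
  "mixed f g 0 0 = 1"
| "mixed f g 0 (Suc j) = 0"
| "mixed f g (Suc N) 0 = mixed f g N 0 * f N"
| "mixed f g (Suc N) (Suc j) = mixed f g N (Suc j) * f N + mixed f g N j * g N"

lemma mixed_0: "mixed f g N 0 = lprod f N"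
  by (induction N) auto

lemma mixed_gt: "N < j \<Longrightarrow> mixed f g N j = 0"
  by (induction f g N j rule: mixed.induct) auto

text \<open>With a central formal parameter t, the elements \<open>mixed f g N j\<close> are the
  coefficients of t^j in the product of the factors f_a + t g_a. These factors anticommute and have
  square 0, so the product is killed by each of them on the right; the claims are the coefficients
  of this relation.\<close>

lemma mixed_annihilate:
  fixes f g :: "nat \<Rightarrow> 'r::ring_1"
  assumes ff: "\<And>a b. a < K \<Longrightarrow> b < K \<Longrightarrow> acm (f a) (f b)" and gg: "\<And>a b. a < K \<Longrightarrow> b < K \<Longrightarrow> acm (g a) (g b)"
    and fg: "\<And>a b. a < K \<Longrightarrow> b < K \<Longrightarrow> acm (f a) (g b)"
    and f2: "\<And>a. a < K \<Longrightarrow> f a * f a = 0" and g2: "\<And>a. a < K \<Longrightarrow> g a * g a = 0"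
  shows "N \<le> K \<Longrightarrow> a < N \<Longrightarrow> mixed f g N 0 * f a = 0 \<and> (\<forall>j. mixed f g N (Suc j) * f a + mixed f g N j * g a = 0)"
proof (induction N)
  case (Suc N)
  have N: "N < K" "a < K" using Suc.prems by auto
  have F: "f N * f a = - (f a * f N)" "g N * f a = - (f a * g N)" "f N * g a = - (g a * f N)" "g N * g a = - (g a * g N)"
    using ff[OF N] gg[OF N] fg[OF N] fg[OF N(2,1)] by (auto simp: acm_def)
  have F': "X * f N * f a = - (X * f a * f N)" "X * g N * f a = - (X * f a * g N)"
     "X * f N * g a = - (X * g a * f N)" "X * g N * g a = - (X * g a * g N)" for X
    using F by (simp_all add: mult.assoc)
  show ?case
  proof (cases "a = N")
    case True
    have "X * f N * f N = 0" "X * g N * g N = 0" "X * f N * g N + X * g N * f N = 0" for X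
      using f2[OF N(1)] g2[OF N(1)] F' F'(3)[of X] True by (simp_all add: mult.assoc)
    note Z = this
    have "mixed f g (Suc N) (Suc j) * f N + mixed f g (Suc N) j * g N = 0" for j
      using Z(3)[of "mixed f g N j"] by (cases j) (simp_all add: algebra_simps Z(1,2)[unfolded mult.assoc] mult.assoc)
    thus ?thesis using Z True by simp
  next
    case False
    hence IH: "mixed f g N 0 * f a = 0" "mixed f g N (Suc j) * f a + mixed f g N j * g a = 0" for j
      using Suc by auto
    have IH': "mixed f g N (Suc j) * f a = - (mixed f g N j * g a)" for j
      using IH(2)[of j] by (simp add: eq_neg_iff_add_eq_0)
    have "mixed f g (Suc N) 0 * f a = 0" by (simp add: F' IH)
    moreover have "mixed f g (Suc N) (Suc j) * f a + mixed f g (Suc N) j * g a = 0" for j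
      by (cases j) (simp_all add: distrib_right F' IH IH')
    ultimately show ?thesis by blast
  qed
qed simp

lemma diff_add_diff_eq:
  fixes a b c d :: "'r::ab_group_add"
  shows "a - b = c - d \<Longrightarrow> a' - b' = c' - d' \<Longrightarrow> a + a' - (b + b') = c + c' - (d + d')"
  by (simp only: add_diff_add)

text \<open>With the same formal parameter t, the element t y - z commutes with every f_a + t g_a,
  because the two terms t th_a cancel. Hence it commutes with their product, and the claims compare
  powers of t.\<close>

lemma mixed_commutator:
  fixes f g th :: "nat \<Rightarrow> 'r::ring_1"
  assumes "\<And>a. a < K \<Longrightarrow> f a * y = y * f a + th a" "\<And>a. a < K \<Longrightarrow> g a * z = z * g a + th a"
    "\<And>a. a < K \<Longrightarrow> f a * z = z * f a" "\<And>a. a < K \<Longrightarrow> g a * y = y * g a"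
  shows "N \<le> K \<Longrightarrow> mixed f g N 0 * z = z * mixed f g N 0 \<and>
    (\<forall>j. mixed f g N j * y - y * mixed f g N j = mixed f g N (Suc j) * z - z * mixed f g N (Suc j))"
proof (induction N)
  case 0
  have "mixed f g 0 j * y - y * mixed f g 0 j = 0" for j by (cases j) auto
  thus ?case by auto
next
  case (Suc N)
  have N: "N < K" using Suc.prems by simp
  have 0: "mixed f g N 0 * z = z * mixed f g N 0"
    and IH: "mixed f g N j * y - y * mixed f g N j = mixed f g N (Suc j) * z - z * mixed f g N (Suc j)" for j
    using Suc by auto
  have c: "X * f N * y = X * y * f N + X * th N" "X * g N * z = X * z * g N + X * th N"
    "X * f N * z = X * z * f N" "X * g N * y = X * y * g N" for X
    using assms[OF N] by (simp_all add: mult.assoc distrib_left)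
  have "mixed f g (Suc N) j * y - y * mixed f g (Suc N) j = mixed f g (Suc N) (Suc j) * z - z * mixed f g (Suc N) (Suc j)" for j
  proof (cases j)
    case 0
    have "(mixed f g N 0 * y - y * mixed f g N 0) * f N = (mixed f g N (Suc 0) * z - z * mixed f g N (Suc 0)) * f N"
      "(mixed f g N 0 * z - z * mixed f g N 0) * g N = 0"
      using IH[of 0] \<open>mixed f g N 0 * z = z * mixed f g N 0\<close> by simp_all
    thus ?thesis using 0 by (simp add: c distrib_left distrib_right left_diff_distrib mult.assoc[symmetric])
  next
    case (Suc i)
    have "(mixed f g N j * y - y * mixed f g N j) * f N = (mixed f g N (Suc j) * z - z * mixed f g N (Suc j)) * f N"
      "(mixed f g N i * y - y * mixed f g N i) * g N = (mixed f g N (Suc i) * z - z * mixed f g N (Suc i)) * g N"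
      unfolding IH by simp_all
    thus ?thesis using Suc by (simp add: c distrib_left distrib_right left_diff_distrib mult.assoc[symmetric]) (rule diff_add_diff_eq; assumption)
  qed
  moreover have "mixed f g (Suc N) 0 * z = z * mixed f g (Suc N) 0"
    by (simp add: c 0 mult.assoc[symmetric])
  ultimately show ?case by blast
qed

text \<open>Only the whole factor f_a + w g_a is assumed to commute with w. This is enough: in each
  induction step the partial product is a product of such whole factors, so the new w moves to the
  front of it.\<close>

lemma mixed_prod:
  fixes f g :: "nat \<Rightarrow> 'r::ring_1"
  assumes "\<And>a. a < K \<Longrightarrow> (f a + w * g a) * w = w * (f a + w * g a)"
  shows "N \<le> K \<Longrightarrow> lprod (\<lambda>a. f a + w * g a) N = (\<Sum>j\<le>N. w ^ j * mixed f g N j)"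
proof (induction N)
  case (Suc N)
  let ?P = "lprod (\<lambda>a. f a + w * g a) N"
  have w: "cm w ?P" by (rule cm_prod_list) (use assms Suc.prems in \<open>auto simp: cm_def\<close>)
  have "lprod (\<lambda>a. f a + w * g a) (Suc N) = ?P * (f N + w * g N)" by simp
  also from w have "?P * (f N + w * g N) = ?P * f N + w * (?P * g N)"
    by (simp add: cm_def distrib_left mult.assoc[symmetric])
  also have "?P = (\<Sum>j\<le>N. w ^ j * mixed f g N j)" using Suc by simp
  also have "(\<Sum>j\<le>N. w ^ j * mixed f g N j) * f N + w * ((\<Sum>j\<le>N. w ^ j * mixed f g N j) * g N)
     = (\<Sum>j\<le>Suc N. w ^ j * (mixed f g N j * f N)) + (\<Sum>j\<le>N. w ^ Suc j * (mixed f g N j * g N))"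
    by (simp add: mixed_gt sum_distrib_left sum_distrib_right mult.assoc)
  also have "\<dots> = (\<Sum>j\<le>Suc N. w ^ j * mixed f g (Suc N) j)"
    unfolding sum.atMost_Suc_shift by (simp add: distrib_left sum.distrib add_ac mult.assoc)
  finally show ?case .
qed simp

section \<open>The Clifford-Weyl duality of row determinants\<close>

text \<open>Since each whole form commutes with w, the inner w of the product can be moved to the
  front. The result is a quadratic polynomial in w, with w on the left, whose coefficients change
  sign when the forms are exchanged.\<close>

lemma acm_shift_left:
  assumes "acm hr hs" "acm gr gs" "acm hr gs" "acm hs gr"
    "(hr + w * gr) * w = w * (hr + w * gr)" "(hs + w * gs) * w = w * (hs + w * (gs :: 'r::ring_1))"
  shows "acm (hr + w * gr) (hs + w * gs)"
proof -
  have "(hr + w * gr) * (hs + w * gs) = (hr + w * gr) * hs + ((hr + w * gr) * w) * gs" by (simp add: distrib_left mult.assoc)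
  also have "\<dots> = hr * hs + w * (gr * hs + hr * gs) + w * w * (gr * gs)"
    unfolding assms by (simp add: distrib_left distrib_right mult.assoc add_ac)
  also have "\<dots> = - (hs * hr + w * (gs * hr + hs * gr) + w * w * (gs * gr))"
    using assms(1-4) by (simp add: acm_def distrib_left right_diff_distrib add_ac)
  also have "hs * hr + w * (gs * hr + hs * gr) + w * w * (gs * gr) = (hs + w * gs) * hr + ((hs + w * gs) * w) * gr"
    unfolding assms by (simp add: distrib_left distrib_right mult.assoc add_ac)
  also have "\<dots> = (hs + w * gs) * (hr + w * gr)" by (simp add: distrib_left mult.assoc)
  finally show ?thesis by (simp add: acm_def)
qed

lemma acm_shift_right:
  assumes "acm hr hs" "acm gr gs" "acm hr gs" "acm hs gr"
    "(hr - gr * u) * u = u * (hr - gr * u)" "(hs - gs * u) * u = u * (hs - gs * (u :: 'r::ring_1))"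
  shows "acm (hr - gr * u) (hs - gs * u)"
proof -
  have "(hr - gr * u) * (hs - gs * u) = hr * (hs - gs * u) - gr * (u * (hs - gs * u))" by (simp add: left_diff_distrib mult.assoc)
  also have "\<dots> = hr * hs - (hr * gs + gr * hs) * u + gr * gs * (u * u)"
    unfolding assms(6)[symmetric] by (simp add: algebra_simps)
  also have "\<dots> = - (hs * hr - (hs * gr + gs * hr) * u + gs * gr * (u * u))"
    using assms(1-4) by (simp add: acm_def algebra_simps)
  also have "hs * hr - (hs * gr + gs * hr) * u + gs * gr * (u * u) = hs * (hr - gr * u) - gs * (u * (hr - gr * u))"
    unfolding assms(5)[symmetric] by (simp add: algebra_simps)
  also have "\<dots> = (hs - gs * u) * (hr - gr * u)" by (simp add: left_diff_distrib mult.assoc)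
  finally show ?thesis by (simp add: acm_def)
qed

lemma acm_mult_mult:
  assumes "acm a b" "cm a e" "cm c b" "cm c e" shows "acm (a * c) (b * e)"
  by (rule acm_mult1; (rule acm_sym, rule acm_mult1 | rule cm_sym, rule cm_mult); rule assms acm_sym cm_sym; rule assms)

text \<open>The mixed relation \<open>dd_xi_eq\<close> covers the k by n array of generators
  together with one extra row and one extra column, reserved for auxiliary variables. The condition
  \<open>torsion\<close> turns self-anticommutation into square 0.\<close>

locale weyl_clifford =
  fixes k n :: nat and y yi d di :: "nat \<Rightarrow> 'r::ring_1" and xi dd :: "nat \<times> nat \<Rightarrow> 'r"
  assumes torsion: "\<And>x::'r. x + x = 0 \<Longrightarrow> x = 0"
    and y_yi: "y i * yi i = 1" and yi_y: "yi i * y i = 1"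
    and d_di: "d a * di a = 1" and di_d: "di a * d a = 1"
    and dy: "d a * y i = y i * d a + 1"
    and yy: "cm (y i) (y j)" and dcd: "cm (d a) (d b)"
    and y_xi: "cm (y i) (xi c)" and y_dd: "cm (y i) (dd c)"
    and d_xi: "cm (d a) (xi c)" and d_dd: "cm (d a) (dd c)"
    and xi_xi: "acm (xi c) (xi e)" and dd_dd: "acm (dd c) (dd e)"
    and dd_xi_ne: "c \<noteq> e \<Longrightarrow> acm (dd c) (xi e)"
    and dd_xi_eq: "c \<in> {..k} \<times> {..n} \<Longrightarrow> dd c * xi c = 1 - xi c * dd c"
begin

text \<open>The auxiliary odd variables $\theta_a$, $\psi_i$ are the unused generators in the extra column \<open>n\<close> and row \<open>k\<close>.\<close>

definition th where "th a = xi (a, n)"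
definition ps where "ps i = xi (k, i)"
definition "zeta i = (\<Sum>b<k. xi (b,i) * th b)"
definition "eta a = (\<Sum>c<n. xi (a,c) * ps c)"
definition "w i = zeta i * yi i"
definition "u a = eta a * di a"
text \<open>The complete forms are \<open>Phi n a\<close> and \<open>Psi k r\<close>. Truncation at
  m lets the indices be added one at a time, both for proving anticommutation and for removing them
  again from the product.\<close>

definition "Phi m a = th a * d a + (\<Sum>i<m. w i * dd (a,i))"
definition "Psi m r = ps r * y r - (\<Sum>a<m. dd (a,r) * u a)"

lemma sq0: "acm (x::'r) x \<Longrightarrow> x * x = 0"
  using torsion[of "x * x"] by (simp add: acm_def eq_neg_iff_add_eq_0)

lemma y_yi_cm: "cm x (y i) \<Longrightarrow> cm x (yi i)" using cm_inverse y_yi yi_y by blast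
lemma d_di_cm: "cm x (d a) \<Longrightarrow> cm x (di a)" using cm_inverse d_di di_d by blast

lemmas base_cm = yy dcd y_xi y_dd d_xi d_dd y_xi[THEN cm_sym] y_dd[THEN cm_sym] d_xi[THEN cm_sym] d_dd[THEN cm_sym]

lemma yi_cms: "cm (y i) (yi j)" "cm (yi j) (y i)" "cm (yi i) (yi j)" "cm (yi i) (xi c)" "cm (xi c) (yi i)" "cm (yi i) (dd c)" "cm (dd c) (yi i)"
proof -
  show 1: "cm (y i) (yi j)" for i j by (rule y_yi_cm[OF yy])
  show "cm (yi j) (y i)" by (rule cm_sym[OF 1])
  show "cm (yi i) (yi j)" by (rule y_yi_cm[OF cm_sym[OF 1]])
  show 2: "cm (xi c) (yi i)" "cm (dd c) (yi i)" by (rule y_yi_cm, rule cm_sym, rule y_xi y_dd)+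
  show "cm (yi i) (xi c)" "cm (yi i) (dd c)" by (rule cm_sym, rule 2)+
qed

lemma di_cms: "cm (d i) (di j)" "cm (di j) (d i)" "cm (di i) (di j)" "cm (di i) (xi c)" "cm (xi c) (di i)" "cm (di i) (dd c)" "cm (dd c) (di i)"
proof -
  show 1: "cm (d i) (di j)" for i j by (rule d_di_cm[OF dcd])
  show "cm (di j) (d i)" by (rule cm_sym[OF 1])
  show "cm (di i) (di j)" by (rule d_di_cm[OF cm_sym[OF 1]])
  show 2: "cm (xi c) (di i)" "cm (dd c) (di i)" by (rule d_di_cm, rule cm_sym, rule d_xi d_dd)+
  show "cm (di i) (xi c)" "cm (di i) (dd c)" by (rule cm_sym, rule 2)+
qed

lemma xi_dd_ne: "c \<noteq> e \<Longrightarrow> acm (xi c) (dd e)"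
  by (rule acm_sym, rule dd_xi_ne) auto

lemma zeta_cm: "(\<And>b. b < k \<Longrightarrow> acm x (xi (b,i))) \<Longrightarrow> (\<And>b. b < k \<Longrightarrow> acm x (th b)) \<Longrightarrow> cm x (zeta i)"
  unfolding zeta_def by (intro cm_sum cm_mult_ac) auto
lemma zeta_cm': "(\<And>b. b < k \<Longrightarrow> cm x (xi (b,i))) \<Longrightarrow> (\<And>b. b < k \<Longrightarrow> cm x (th b)) \<Longrightarrow> cm x (zeta i)"
  unfolding zeta_def by (intro cm_sum cm_mult) auto
lemma eta_cm: "(\<And>b. b < n \<Longrightarrow> acm x (xi (a,b))) \<Longrightarrow> (\<And>b. b < n \<Longrightarrow> acm x (ps b)) \<Longrightarrow> cm x (eta a)"
  unfolding eta_def by (intro cm_sum cm_mult_ac) auto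
lemma eta_cm': "(\<And>b. b < n \<Longrightarrow> cm x (xi (a,b))) \<Longrightarrow> (\<And>b. b < n \<Longrightarrow> cm x (ps b)) \<Longrightarrow> cm x (eta a)"
  unfolding eta_def by (intro cm_sum cm_mult) auto

lemma zeta_cms: "cm (xi c) (zeta i)" "cm (y j) (zeta i)" "cm (d j) (zeta i)" "cm (yi j) (zeta i)" "cm (di j) (zeta i)"
  by (intro zeta_cm zeta_cm'; simp add: th_def xi_xi base_cm yi_cms di_cms)+
lemma eta_cms: "cm (xi c) (eta i)" "cm (y j) (eta i)" "cm (d j) (eta i)" "cm (yi j) (eta i)" "cm (di j) (eta i)"
  by (intro eta_cm eta_cm'; simp add: ps_def xi_xi base_cm yi_cms di_cms)+

lemma zeta_zeta: "cm (zeta i) (zeta j)"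
  by (rule cm_sym, rule zeta_cm'; rule cm_sym; simp add: th_def zeta_cms)
lemma eta_eta: "cm (eta i) (eta j)"
  by (rule cm_sym, rule eta_cm'; rule cm_sym; simp add: ps_def eta_cms)

lemma dd_zeta_ne: "i \<noteq> j \<Longrightarrow> i < n \<Longrightarrow> cm (dd (a,i)) (zeta j)"
  by (rule zeta_cm; (unfold th_def)?; rule dd_xi_ne; simp)

lemma dd_eta_ne: "a \<noteq> b \<Longrightarrow> a < k \<Longrightarrow> cm (dd (a,r)) (eta b)"
  by (rule eta_cm; (unfold ps_def)?; rule dd_xi_ne; simp)

lemma dd_zeta_eq:
  assumes "a < k" "i < n" shows "dd (a,i) * zeta i = zeta i * dd (a,i) + th a"
proof -
  have "dd (a,i) * (xi (b,i) * th b) = xi (b,i) * th b * dd (a,i) + (if b = a then th a else 0)" if "b < k" for b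
  proof (cases "b = a")
    case True
    have "dd (a,i) * xi (a,i) = 1 - xi (a,i) * dd (a,i)" by (rule dd_xi_eq) (use assms in auto)
    hence "dd (a,i) * (xi (a,i) * th a) = th a - xi (a,i) * (dd (a,i) * th a)"
      by (simp add: mult.assoc[symmetric] left_diff_distrib)
    moreover have "acm (dd (a,i)) (th a)" unfolding th_def by (rule dd_xi_ne) (use assms in auto)
    ultimately show ?thesis using True by (simp add: acm_def mult.assoc)
  next
    case False
    have "cm (dd (a,i)) (xi (b,i) * th b)" unfolding th_def by (intro cm_mult_ac dd_xi_ne) (use assms False in auto)
    thus ?thesis using False by (simp add: cm_def)
  qed
  thus ?thesis unfolding zeta_def sum_distrib_left sum_distrib_right
    by (simp add: sum.distrib assms)
qed

lemma dd_eta_eq: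
  assumes "a < k" "r < n" shows "dd (a,r) * eta a = eta a * dd (a,r) + ps r"
proof -
  have "dd (a,r) * (xi (a,c) * ps c) = xi (a,c) * ps c * dd (a,r) + (if c = r then ps r else 0)" if "c < n" for c
  proof (cases "c = r")
    case True
    have "dd (a,r) * xi (a,r) = 1 - xi (a,r) * dd (a,r)" by (rule dd_xi_eq) (use assms in auto)
    hence "dd (a,r) * (xi (a,r) * ps r) = ps r - xi (a,r) * (dd (a,r) * ps r)"
      by (simp add: mult.assoc[symmetric] left_diff_distrib)
    moreover have "acm (dd (a,r)) (ps r)" unfolding ps_def by (rule dd_xi_ne) (use assms in auto)
    ultimately show ?thesis using True by (simp add: acm_def mult.assoc)
  next
    case False
    have "cm (dd (a,r)) (xi (a,c) * ps c)" unfolding ps_def by (intro cm_mult_ac dd_xi_ne) (use assms False in auto)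
    thus ?thesis using False by (simp add: cm_def)
  qed
  thus ?thesis unfolding eta_def sum_distrib_left sum_distrib_right
    by (simp add: sum.distrib assms)
qed

lemma d_yi: "d a * yi i = yi i * d a - yi i * yi i"
proof -
  have "yi i * (d a * y i) * yi i = yi i * (y i * d a + 1) * yi i" by (simp add: dy)
  hence "yi i * d a * (y i * yi i) = (yi i * y i) * d a * yi i + yi i * yi i"
    by (simp add: distrib_left distrib_right mult.assoc)
  thus ?thesis by (simp add: y_yi yi_y)
qed

lemma y_di: "y i * di a = di a * y i + di a * di a"
proof -
  have "di a * (d a * y i) * di a = di a * (y i * d a + 1) * di a" by (simp add: dy)
  hence "(di a * d a) * y i * di a = di a * y i * (d a * di a) + di a * di a"
    by (simp add: distrib_left distrib_right mult.assoc)
  thus ?thesis by (simp add: d_di di_d)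
qed

lemma w_cms: "cm (xi c) (w i)" "cm (y j) (w i)" "cm (yi j) (w i)" "cm (zeta j) (w i)" "cm (w i) (w j)"
proof -
  show 1: "cm (xi c) (w i)" "cm (y j) (w i)" "cm (yi j) (w i)" for c i j
    unfolding w_def by (intro cm_mult zeta_cms yi_cms)+
  show 2: "cm (zeta j) (w i)" for j i
    unfolding w_def by (intro cm_mult zeta_zeta cm_sym[OF zeta_cms(4)])
  show "cm (w i) (w j)" unfolding w_def[of j]
    by (intro cm_mult cm_sym[OF 1(3)] cm_sym[OF 2])
qed

lemma u_cms: "cm (xi c) (u a)" "cm (d j) (u a)" "cm (di j) (u a)"
  unfolding u_def by (intro cm_mult eta_cms di_cms)+

lemma u_u: "cm (u a) (u b)"
proof -
  have "cm (eta b) (u a)" unfolding u_def by (intro cm_mult eta_eta cm_sym[OF eta_cms(5)])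
  note c = this
  show ?thesis unfolding u_def[of b] by (rule cm_mult[OF cm_sym[OF c] cm_sym[OF u_cms(3)]])
qed

lemma zy: "w i * y i = zeta i"
  by (simp add: w_def mult.assoc yi_y)

text \<open>Two corrections cancel: moving d_a past the inverse of y_m gives -zeta_m theta_a
  y_m^{-2}, while the derivation \<open>dd (a,m)\<close> applied to zeta_m gives theta_a y_m^{-1},
  which carries the factor w_m in front. Neither \<open>Phi m a\<close> nor the added term need
  commute with w_m alone.\<close>

lemma Phi_w:
  assumes "a < k" "m < n"
  shows "(Phi m a + w m * dd (a,m)) * w m = w m * (Phi m a + w m * dd (a,m))"
proof -
  have 1: "th a * d a * w m = w m * (th a * d a) - zeta m * th a * (yi m * yi m)"
  proof -
    have "th a * d a * w m = th a * (d a * zeta m) * yi m" by (simp add: w_def mult.assoc)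
    also have "d a * zeta m = zeta m * d a" using zeta_cms by (simp add: cm_def)
    also have "th a * (zeta m * d a) * yi m = (th a * zeta m) * (d a * yi m)" by (simp add: mult.assoc)
    also have "th a * zeta m = zeta m * th a" using zeta_cms by (simp add: cm_def th_def)
    also have "zeta m * th a * (d a * yi m) = zeta m * (th a * yi m) * d a - zeta m * th a * (yi m * yi m)"
      by (simp add: d_yi right_diff_distrib mult.assoc)
    also have "th a * yi m = yi m * th a" using yi_cms by (simp add: cm_def th_def)
    finally show ?thesis by (simp add: w_def mult.assoc)
  qed
  have 2: "(\<Sum>i<m. w i * dd (a,i)) * w m = w m * (\<Sum>i<m. w i * dd (a,i))"
  proof -
    have "cm (w m) (\<Sum>i<m. w i * dd (a,i))"
    proof (intro cm_sum cm_mult w_cms(5))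
      fix i assume "i \<in> {..<m}"
      thus "cm (w m) (dd (a,i))" unfolding w_def
        by (intro cm_sym[OF cm_mult] dd_zeta_ne yi_cms) (use assms in auto)
    qed
    thus ?thesis by (simp add: cm_def)
  qed
  have 3: "dd (a,m) * w m = w m * dd (a,m) + th a * yi m"
  proof -
    have "dd (a,m) * w m = zeta m * (dd (a,m) * yi m) + th a * yi m"
      by (simp add: w_def mult.assoc[symmetric] dd_zeta_eq[OF assms] distrib_right)
    also have "dd (a,m) * yi m = yi m * dd (a,m)" using yi_cms by (simp add: cm_def)
    finally show ?thesis by (simp add: w_def mult.assoc)
  qed
  have 4: "w m * (th a * yi m) = zeta m * th a * (yi m * yi m)"
  proof -
    have "yi m * th a = th a * yi m" using yi_cms by (simp add: cm_def th_def)
    thus ?thesis by (simp add: w_def mult.assoc) (simp add: mult.assoc[symmetric])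
  qed
  have "(Phi m a + w m * dd (a,m)) * w m = th a * d a * w m + (\<Sum>i<m. w i * dd (a,i)) * w m + w m * (dd (a,m) * w m)"
    by (simp add: Phi_def distrib_right mult.assoc)
  also have "\<dots> = w m * (Phi m a + w m * dd (a,m))"
    unfolding 1 2 3 by (simp add: Phi_def distrib_left 4)
  finally show ?thesis .
qed

lemma Phi_Suc: "Phi (Suc m) a = Phi m a + w m * dd (a,m)"
  by (simp add: Phi_def add.assoc)

lemma Phi_dd: "m < n \<Longrightarrow> acm (Phi m a) (dd (b,m))"
  unfolding Phi_def
proof (rule acm_sym, rule acm_add, rule acm_mult1)
  assume m: "m < n"
  show "acm (dd (b,m)) (th a)" unfolding th_def by (rule dd_xi_ne) (use m in auto)
  show "cm (dd (b,m)) (d a)" by (rule base_cm)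
  show "acm (dd (b,m)) (\<Sum>i<m. w i * dd (a,i))"
  proof (rule acm_sum, rule acm_mult2)
    fix i assume i: "i \<in> {..<m}"
    show "cm (dd (b,m)) (w i)"
      unfolding w_def by (intro cm_mult dd_zeta_ne yi_cms) (use i m in auto)
  qed (rule dd_dd)
qed

lemma Phi_Phi: "m \<le> n \<Longrightarrow> a < k \<Longrightarrow> b < k \<Longrightarrow> acm (Phi m a) (Phi m b)"
proof (induction m)
  case 0
  have "cm (d a) (th b)" "cm (d b) (th a)" "cm (d a) (d b)" "acm (th a) (th b)" by (simp_all add: th_def base_cm xi_xi)
  thus ?case unfolding Phi_def
    using acm_mult_mult[of "th a" "th b" "d b" "d a"] by (simp add: cm_sym)
next
  case (Suc m)
  show ?case unfolding Phi_Suc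
    by (rule acm_shift_left) (use Suc Phi_dd Phi_w dd_dd in auto)
qed

lemma Psi_Suc: "Psi (Suc m) r = Psi m r - dd (m,r) * u m"
  by (simp add: Psi_def)

text \<open>The mirror image of \<open>Phi_w\<close>: moving y_r past d_m^{-1} and differentiating
  eta_m both produce eta_m psi_r d_m^{-2}, and the minus sign in the form makes them cancel.\<close>

lemma Psi_u:
  assumes "m < k" "r < n"
  shows "(Psi m r - dd (m,r) * u m) * u m = u m * (Psi m r - dd (m,r) * u m)"
proof -
  have 1: "ps r * y r * u m = u m * (ps r * y r) + eta m * ps r * (di m * di m)"
  proof -
    have "ps r * y r * u m = ps r * (y r * eta m) * di m" by (simp add: u_def mult.assoc)
    also have "y r * eta m = eta m * y r" using eta_cms by (simp add: cm_def)
    also have "ps r * (eta m * y r) * di m = (ps r * eta m) * (y r * di m)" by (simp add: mult.assoc)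
    also have "ps r * eta m = eta m * ps r" using eta_cms by (simp add: cm_def ps_def)
    also have "eta m * ps r * (y r * di m) = eta m * (ps r * di m) * y r + eta m * ps r * (di m * di m)"
      by (simp add: y_di distrib_left mult.assoc)
    also have "ps r * di m = di m * ps r" using di_cms by (simp add: cm_def ps_def)
    finally show ?thesis by (simp add: u_def mult.assoc)
  qed
  have 2: "(\<Sum>a<m. dd (a,r) * u a) * u m = u m * (\<Sum>a<m. dd (a,r) * u a)"
  proof -
    have "cm (u m) (\<Sum>a<m. dd (a,r) * u a)"
    proof (intro cm_sum cm_mult u_u)
      fix a assume "a \<in> {..<m}"
      thus "cm (u m) (dd (a,r))" unfolding u_def
        by (intro cm_sym[OF cm_mult] dd_eta_ne di_cms) (use assms in auto)
    qed
    thus ?thesis by (simp add: cm_def)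
  qed
  have 3: "dd (m,r) * u m = u m * dd (m,r) + ps r * di m"
  proof -
    have "dd (m,r) * u m = eta m * (dd (m,r) * di m) + ps r * di m"
      by (simp add: u_def mult.assoc[symmetric] dd_eta_eq[OF assms] distrib_right)
    also have "dd (m,r) * di m = di m * dd (m,r)" using di_cms by (simp add: cm_def)
    finally show ?thesis by (simp add: u_def mult.assoc)
  qed
  have 4: "ps r * di m * u m = eta m * ps r * (di m * di m)"
  proof -
    have "di m * eta m = eta m * di m" "ps r * eta m = eta m * ps r" using eta_cms by (simp_all add: cm_def ps_def)
    note c = this
    have "ps r * di m * u m = ps r * (di m * eta m) * di m" by (simp only: u_def mult.assoc)
    also have "\<dots> = (ps r * eta m) * (di m * di m)" unfolding c(1) by (simp only: mult.assoc)
    finally show ?thesis unfolding c(2) .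
  qed
  have "(Psi m r - dd (m,r) * u m) * u m = ps r * y r * u m - (\<Sum>a<m. dd (a,r) * u a) * u m - dd (m,r) * u m * u m"
    by (simp add: Psi_def left_diff_distrib)
  also have "dd (m,r) * u m * u m = u m * (dd (m,r) * u m) + eta m * ps r * (di m * di m)"
    by (subst 3) (simp only: distrib_right mult.assoc 4[unfolded mult.assoc])
  also have "ps r * y r * u m - (\<Sum>a<m. dd (a,r) * u a) * u m - (u m * (dd (m,r) * u m) + eta m * ps r * (di m * di m)) = u m * (Psi m r - dd (m,r) * u m)"
    unfolding 1 2 by (simp add: Psi_def right_diff_distrib)
  finally show ?thesis .
qed

lemma Psi_dd: "m < k \<Longrightarrow> acm (Psi m r) (dd (m,s))"
  unfolding Psi_def
proof (rule acm_sym, intro acm_diff acm_sum acm_mult1)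
  assume m: "m < k"
  show "acm (dd (m,s)) (ps r)" unfolding ps_def by (rule dd_xi_ne) (use m in auto)
  show "cm (dd (m,s)) (y r)" by (rule base_cm)
  fix a assume a: "a \<in> {..<m}"
  show "acm (dd (m,s)) (dd (a,r))" by (rule dd_dd)
  show "cm (dd (m,s)) (u a)"
    unfolding u_def by (intro cm_mult dd_eta_ne di_cms) (use a m in auto)
qed

lemma Psi_Psi: "m \<le> k \<Longrightarrow> r < n \<Longrightarrow> s < n \<Longrightarrow> acm (Psi m r) (Psi m s)"
proof (induction m)
  case 0
  have "cm (y r) (ps s)" "cm (y s) (ps r)" "cm (y r) (y s)" "acm (ps r) (ps s)" by (simp_all add: ps_def base_cm xi_xi)
  thus ?case unfolding Psi_def
    using acm_mult_mult[of "ps r" "ps s" "y s" "y r"] by (simp add: cm_sym)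
next
  case (Suc m)
  show ?case unfolding Psi_Suc
    by (rule acm_shift_right) (use Suc Psi_dd Psi_u dd_dd in auto)
qed

lemma Psi_ps:
  assumes "m \<le> k" shows "acm (Psi m r) (ps c)"
  unfolding Psi_def
proof (rule acm_sym, intro acm_diff acm_sum acm_mult1)
  show "acm (ps c) (ps r)" "cm (ps c) (y r)" by (simp_all add: ps_def xi_xi base_cm)
  fix a assume a: "a \<in> {..<m}"
  show "acm (ps c) (dd (a,r))" unfolding ps_def by (rule xi_dd_ne) (use a assms in auto)
  show "cm (ps c) (u a)" unfolding ps_def by (rule u_cms)
qed

end

lemma prod_list_rev_cm:
  "(\<And>x y. x \<in> set xs \<Longrightarrow> y \<in> set xs \<Longrightarrow> cm x y) \<Longrightarrow> prod_list (rev xs) = prod_list xs"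
proof (induction xs)
  case (Cons x xs)
  have "cm x (prod_list xs)" by (rule cm_prod_list) (use Cons.prems in auto)
  thus ?case using Cons by (simp add: cm_def)
qed simp

lemma prod_list_map_inverse:
  fixes f g :: "nat \<Rightarrow> 'r::ring_1"
  assumes "\<And>i. f i * g i = 1"
  shows "prod_list (map f xs) * prod_list (map g (rev xs)) = 1"
proof (induction xs)
  case (Cons x xs)
  have "prod_list (map f (x # xs)) * prod_list (map g (rev (x # xs)))
      = f x * (prod_list (map f xs) * prod_list (map g (rev xs))) * g x" by (simp add: mult.assoc)
  thus ?case using Cons assms by simp
qed simp

section \<open>The telescoping product\<close>

context weyl_clifford
begin

definition "PhiProd m = lprod (Phi m) k"
abbreviation "T m \<equiv> mixed (Phi m) (\<lambda>a. dd (a,m)) k"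

lemma PhiProd_Suc:
  assumes "m < n" shows "PhiProd (Suc m) = (\<Sum>j\<le>k. w m ^ j * T m j)"
proof -
  have "Phi (Suc m) = (\<lambda>a. Phi m a + w m * dd (a,m))" by (rule ext) (rule Phi_Suc)
  thus ?thesis unfolding PhiProd_def
    using mixed_prod[of k "Phi m" "w m" "\<lambda>a. dd (a,m)" k] Phi_w assms by simp
qed

lemma Phi_y:
  assumes "m \<le> i" "m < n" "a < k" shows "Phi m a * y i = y i * Phi m a + th a"
proof -
  have "th a * d a * y i = th a * y i * d a + th a" by (simp add: mult.assoc dy distrib_left)
  also have "th a * y i = y i * th a" using base_cm(3)[of i] by (simp add: cm_def th_def)
  finally have 1: "th a * d a * y i = y i * (th a * d a) + th a" by (simp add: mult.assoc)
  have "cm (y i) (\<Sum>i<m. w i * dd (a,i))" by (intro cm_sum cm_mult w_cms base_cm)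
  thus ?thesis using 1 by (simp add: Phi_def cm_def distrib_left distrib_right)
qed

lemma Phi_zeta:
  assumes "m < n" "a < k" shows "cm (zeta m) (Phi m a)"
  unfolding Phi_def
proof (rule cm_add, rule cm_mult)
  show "cm (zeta m) (th a)" unfolding th_def by (rule cm_sym[OF zeta_cms(1)])
  show "cm (zeta m) (d a)" by (rule cm_sym[OF zeta_cms(3)])
  show "cm (zeta m) (\<Sum>i<m. w i * dd (a, i))"
  proof (rule cm_sum, rule cm_mult)
    fix i assume "i \<in> {..<m}"
    thus "cm (zeta m) (dd (a,i))" by (intro cm_sym[OF dd_zeta_ne]) (use assms in auto)
  qed (rule w_cms)
qed

lemma T_annihilate:
  assumes "m < n" "a < k" shows "T m j * dd (a,m) = - (T m (Suc j) * Phi m a)"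
proof -
  have "T m (Suc j) * Phi m a + T m j * dd (a,m) = 0"
    using mixed_annihilate[of k "Phi m" "\<lambda>a. dd (a,m)" k a] assms
    by (simp add: Phi_Phi Phi_dd dd_dd sq0)
  thus ?thesis by (simp add: eq_neg_iff_add_eq_0 add.commute)
qed

lemma T_commutator:
  assumes "m < n"
  shows "T m j * y m - T m (Suc j) * zeta m = y m * T m j - zeta m * T m (Suc j)"
proof -
  have "T m j * y m - y m * T m j = T m (Suc j) * zeta m - zeta m * T m (Suc j)"
  proof (rule mixed_commutator[THEN conjunct2, rule_format])
    fix a assume a: "a < k"
    show "Phi m a * y m = y m * Phi m a + th a" using Phi_y assms a by simp
    show "dd (a, m) * zeta m = zeta m * dd (a, m) + th a" using dd_zeta_eq assms a by simp
    show "Phi m a * zeta m = zeta m * Phi m a" using Phi_zeta[OF assms a] by (simp add: cm_def)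
    show "dd (a, m) * y m = y m * dd (a, m)" using y_dd by (simp add: cm_def)
  qed simp
  thus ?thesis by (simp add: algebra_simps)
qed

text \<open>W stands for a product of \<open>Psi k i\<close> with i < m and of psi_c with c > m. The
  theta part of \<open>Phi m a\<close> yields -zeta_c psi_c for every c, and those with c > m are
  killed by W. For i < m, \<open>Psi k i * W = 0\<close> replaces the derivation terms by y_i psi_i,
  and w_i y_i = zeta_i then cancels the contributions with c < m. Only c = m survives.\<close>

lemma sum_Phi_u:
  assumes "m < n" "\<And>i. i < m \<Longrightarrow> Psi k i * W = 0" "\<And>c. m < c \<Longrightarrow> c < n \<Longrightarrow> ps c * W = 0"
  shows "(\<Sum>a<k. Phi m a * (u a * W)) = - (zeta m * (ps m * W))"
proof -
  have 1: "d a * u a = eta a" for a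
  proof -
    have "d a * u a = eta a * (d a * di a)" using eta_cms(3) by (simp add: u_def cm_def mult.assoc[symmetric])
    thus ?thesis by (simp add: d_di)
  qed
  have "(\<Sum>a<k. th a * eta a) = (\<Sum>a<k. \<Sum>c<n. - (xi (a,c) * th a * ps c))"
    unfolding eta_def sum_distrib_left
  proof (intro sum.cong refl)
    fix a c
    have "th a * xi (a,c) = - (xi (a,c) * th a)" using xi_xi[of "(a,n)" "(a,c)"] by (simp only: acm_def th_def)
    thus "th a * (xi (a,c) * ps c) = - (xi (a,c) * th a * ps c)" by (simp add: mult.assoc[symmetric])
  qed
  also have "\<dots> = - (\<Sum>c<n. zeta c * ps c)"
    by (subst sum.swap) (simp add: zeta_def sum_distrib_right sum_negf)
  finally have 2: "(\<Sum>a<k. th a * eta a) = - (\<Sum>c<n. zeta c * ps c)" .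
  have 3: "w i * ((\<Sum>a<k. dd (a,i) * u a) * W) = zeta i * (ps i * W)" if "i < m" for i
  proof -
    have "(\<Sum>a<k. dd (a,i) * u a) * W = ps i * y i * W - Psi k i * W"
      by (simp add: Psi_def left_diff_distrib)
    also have "\<dots> = y i * (ps i * W)" using assms(2)[OF that] base_cm(3)[of i "(k,i)"] by (simp add: cm_def ps_def mult.assoc[symmetric])
    finally show ?thesis by (simp add: zy mult.assoc[symmetric])
  qed
  have "(\<Sum>a<k. Phi m a * (u a * W)) = (\<Sum>a<k. th a * (d a * u a)) * W + (\<Sum>a<k. \<Sum>i<m. w i * (dd (a,i) * u a * W))"
    by (simp add: Phi_def distrib_right sum.distrib sum_distrib_right mult.assoc)
  also have "(\<Sum>a<k. \<Sum>i<m. w i * (dd (a,i) * u a * W)) = (\<Sum>i<m. w i * ((\<Sum>a<k. dd (a,i) * u a) * W))"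
    by (subst sum.swap) (simp add: sum_distrib_left sum_distrib_right)
  also have "\<dots> = (\<Sum>i<m. zeta i * (ps i * W))" using 3 by simp
  also have "(\<Sum>a<k. th a * (d a * u a)) * W = - (\<Sum>c<n. zeta c * (ps c * W))"
    by (simp add: 1 2 sum_distrib_right mult.assoc)
  also have "(\<Sum>c<n. zeta c * (ps c * W)) = (\<Sum>c<Suc m. zeta c * (ps c * W))"
    by (rule sum.mono_neutral_right) (use assms in auto)
  finally show ?thesis by simp
qed

text \<open>Multiplying the j-th term of the expansion by \<open>Psi k m\<close> yields the
  difference of two consecutive terms. At the upper end the term vanishes, since more than k of k
  factors cannot be replaced; at the lower end stands the product without index m.\<close>

lemma main_step:
  assumes "m < n" "\<And>i. i < m \<Longrightarrow> Psi k i * W = 0" "\<And>c. m < c \<Longrightarrow> c < n \<Longrightarrow> ps c * W = 0"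
  shows "PhiProd (Suc m) * (Psi k m * W) = y m * (PhiProd m * (ps m * W))"
proof -
  let ?X = "ps m * W"
  have t: "T m j * (Psi k m * W) = (y m * T m j - zeta m * T m (Suc j)) * ?X" for j
  proof -
    have y: "ps m * y m = y m * ps m" using base_cm(3)[of m "(k,m)"] by (simp add: cm_def ps_def)
    have "T m j * (Psi k m * W) = T m j * (ps m * y m) * W - (\<Sum>a<k. T m j * dd (a,m) * (u a * W))"
      by (simp add: Psi_def left_diff_distrib right_diff_distrib sum_distrib_left sum_distrib_right mult.assoc)
    also have "(\<Sum>a<k. T m j * dd (a,m) * (u a * W)) = - (T m (Suc j) * (\<Sum>a<k. Phi m a * (u a * W)))"
      using T_annihilate[OF assms(1)] by (simp add: sum_distrib_left sum_negf mult.assoc)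
    also have "(\<Sum>a<k. Phi m a * (u a * W)) = - (zeta m * ?X)" by (rule sum_Phi_u) (use assms in auto)
    also have "T m j * (ps m * y m) * W - - (T m (Suc j) * - (zeta m * ?X)) = (T m j * y m - T m (Suc j) * zeta m) * ?X"
      unfolding y by (simp add: left_diff_distrib mult.assoc)
    finally show ?thesis unfolding T_commutator[OF assms(1)] .
  qed
  let ?a = "\<lambda>j. w m ^ j * (y m * (T m j * ?X))"
  \<comment> \<open>Writing zeta_m as w_m y_m raises the power of w_m by one, which makes the second
    summand the successor of the first.\<close>
  have z: "w m ^ j * ((y m * T m j - zeta m * T m (Suc j)) * ?X) = ?a j - ?a (Suc j)" for j
    unfolding zy[symmetric] by (simp add: left_diff_distrib right_diff_distrib mult.assoc power_Suc2 del: power_Suc)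
  have "PhiProd (Suc m) * (Psi k m * W) = (\<Sum>j\<le>k. w m ^ j * (T m j * (Psi k m * W)))"
    unfolding PhiProd_Suc[OF assms(1)] sum_distrib_right by (simp add: mult.assoc)
  also have "\<dots> = (\<Sum>j\<le>k. ?a j - ?a (Suc j))" unfolding t z ..
  also have "\<dots> = ?a 0 - ?a (Suc k)" by (rule sum_telescope)
  also have "\<dots> = y m * (PhiProd m * ?X)" by (simp add: mixed_gt mixed_0 PhiProd_def del: mixed.simps)
  finally show ?thesis .
qed

text \<open>Each step trades \<open>Psi k m\<close> for psi_m and extracts y_m. The annihilation
  conditions of \<open>main_step\<close> hold because the factor in question already occurs in the
  remaining product. The sign for bringing \<open>Psi k m\<close> to the front equals the one for
  returning psi_m to its place, so they cancel.\<close>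

lemma core_claim:
  "m \<le> n \<Longrightarrow> PhiProd m * (lprod (Psi k) m * prod_list (map ps [m..<n]))
     = prod_list (map y (rev [0..<m])) * (PhiProd 0 * lprod ps n)"
proof (induction m)
  case (Suc m)
  have m: "m < n" using Suc.prems by simp
  let ?P = "lprod (Psi k) m" and ?Q = "prod_list (map ps [Suc m..<n])"
  let ?s = "(-1::'r) ^ m"
  have s: "?s * x = x * ?s" "?s * (?s * x) = x" for x by (cases "even m"; simp)+
  have P: "?P * Psi k m = ?s * (Psi k m * ?P)"
  proof -
    have "acm x (Psi k m)" if "x \<in> set (map (Psi k) [0..<m])" for x using that m Psi_Psi[of k] by auto
    from prod_list_ac[of "map (Psi k) [0..<m]" "Psi k m", OF this] show ?thesis by simp
  qed
  have p: "?P * ps c = ?s * (ps c * ?P)" for c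
  proof -
    have "acm x (ps c)" if "x \<in> set (map (Psi k) [0..<m])" for x using that Psi_ps[of k] by auto
    from prod_list_ac[of "map (Psi k) [0..<m]" "ps c", OF this] show ?thesis by simp
  qed
  have "PhiProd (Suc m) * (lprod (Psi k) (Suc m) * ?Q) = PhiProd (Suc m) * (?P * Psi k m * ?Q)"
    by simp
  also have "\<dots> = ?s * (PhiProd (Suc m) * (Psi k m * (?P * ?Q)))" unfolding P
    by (cases "even m") (simp_all add: mult.assoc)
  also have "PhiProd (Suc m) * (Psi k m * (?P * ?Q)) = y m * (PhiProd m * (ps m * (?P * ?Q)))"
  proof (rule main_step[OF m])
    fix i assume i: "i < m"
    have "Psi k i * ?P = 0"
      by (rule prod_list_annihilate) (use i m Psi_Psi[of k] in \<open>auto intro!: sq0\<close>)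
    thus "Psi k i * (?P * ?Q) = 0" by (simp add: mult.assoc[symmetric])
  next
    fix c assume c: "m < c" "c < n"
    have "ps c * ?Q = 0"
      by (rule prod_list_annihilate) (use c xi_xi in \<open>auto intro!: sq0 simp: ps_def\<close>)
    have c: "ps c * ?P = ?s * (?P * ps c)" unfolding p using s(2) by simp
    have "ps c * (?P * ?Q) = (ps c * ?P) * ?Q" by (simp only: mult.assoc)
    also have "\<dots> = ?s * (?P * (ps c * ?Q))" unfolding c by (simp only: mult.assoc)
    finally show "ps c * (?P * ?Q) = 0" using \<open>ps c * ?Q = 0\<close> by simp
  qed
  also have "?s * (y m * (PhiProd m * (ps m * (?P * ?Q)))) = y m * (PhiProd m * ((?s * (ps m * ?P)) * ?Q))"
    by (cases "even m") (simp_all add: mult.assoc)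
  also have "(?s * (ps m * ?P)) * ?Q = ?P * (ps m * ?Q)" unfolding p[symmetric] by (simp only: mult.assoc)
  also have "ps m * ?Q = prod_list (map ps [m..<n])" using m by (simp add: upt_conv_Cons)
  finally show ?case using Suc m by (simp add: mult.assoc)
qed simp

section \<open>From products of forms back to determinants\<close>

definition "Cm a b = (if a = b then d a else 0) - (\<Sum>i<n. xi (b,i) * yi i * dd (a,i))"
definition "Am r c = (if r = c then y r else 0) + (\<Sum>a<k. xi (a,c) * dd (a,r) * di a)"

lemma Phi_forms: "a < k \<Longrightarrow> Phi n a = (\<Sum>b<k. Cm a b * th b)"
proof -
  assume a: "a < k"
  have "xi (b,i) * yi i * dd (a,i) * th b = - (xi (b,i) * th b * yi i * dd (a,i))" if "i < n" for b i
  proof -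
    have "acm (dd (a,i)) (th b)" "cm (yi i) (th b)" unfolding th_def by (rule dd_xi_ne yi_cms; use that in auto)+
    hence 1: "dd (a,i) * th b = - (th b * dd (a,i))" "yi i * th b = th b * yi i" by (simp_all add: acm_def cm_def)
    have "xi (b,i) * yi i * dd (a,i) * th b = xi (b,i) * yi i * (dd (a,i) * th b)" by (simp only: mult.assoc)
    also have "\<dots> = - (xi (b,i) * (yi i * th b) * dd (a,i))" unfolding 1(1) by (simp only: mult.assoc mult_minus_right)
    also have "\<dots> = - (xi (b,i) * th b * yi i * dd (a,i))" unfolding 1(2) by (simp only: mult.assoc)
    finally show ?thesis .
  qed
  hence "(\<Sum>b<k. Cm a b * th b) = (\<Sum>b<k. (if a = b then d a * th b else 0)) + (\<Sum>b<k. \<Sum>i<n. xi (b,i) * th b * yi i * dd (a,i))"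
    by (simp add: Cm_def left_diff_distrib sum_distrib_right sum_subtractf if_distrib[of "\<lambda>x. x * _"] sum_negf sum.distrib cong: if_cong)
  also have "(\<Sum>b<k. \<Sum>i<n. xi (b,i) * th b * yi i * dd (a,i)) = (\<Sum>i<n. w i * dd (a,i))"
    by (subst sum.swap) (simp add: w_def zeta_def sum_distrib_right)
  also have "(\<Sum>b<k. (if a = b then d a * th b else 0)) = th a * d a"
    using a base_cm(9)[of "(a,n)" a] by (simp add: th_def cm_def)
  finally show ?thesis by (simp add: Phi_def)
qed

text \<open>Normal ordering explains the shift: differentiating eta_a leaves psi_r, so every a
  contributes psi_r d_a^{-1}. Apart from this the expression is \<open>Psi k r\<close>.\<close>

lemma Psi'_forms: "r < n \<Longrightarrow> (\<Sum>c<n. Am r c * ps c) = ps r * (y r + (\<Sum>a<k. di a)) - (\<Sum>a<k. dd (a,r) * u a)"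
proof -
  assume r: "r < n"
  have e: "(\<Sum>c<n. xi (a,c) * dd (a,r) * di a * ps c) = ps r * di a - dd (a,r) * u a" if a: "a < k" for a
  proof -
    have "xi (a,c) * dd (a,r) * di a * ps c = - (xi (a,c) * ps c * dd (a,r) * di a)" for c
    proof -
      have "acm (dd (a,r)) (ps c)" "cm (di a) (ps c)" unfolding ps_def by (rule dd_xi_ne di_cms; use a in auto)+
      hence 1: "dd (a,r) * ps c = - (ps c * dd (a,r))" "di a * ps c = ps c * di a" by (simp_all add: acm_def cm_def)
      have "xi (a,c) * dd (a,r) * di a * ps c = xi (a,c) * dd (a,r) * (di a * ps c)" by (simp only: mult.assoc)
      also have "\<dots> = xi (a,c) * (dd (a,r) * ps c) * di a" unfolding 1(2) by (simp only: mult.assoc)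
      also have "\<dots> = - (xi (a,c) * ps c * dd (a,r) * di a)" unfolding 1(1) by (simp add: mult.assoc)
      finally show ?thesis .
    qed
    hence "(\<Sum>c<n. xi (a,c) * dd (a,r) * di a * ps c) = - (eta a * dd (a,r) * di a)"
      by (simp add: eta_def sum_distrib_right sum_negf)
    also have "eta a * dd (a,r) = dd (a,r) * eta a - ps r" using dd_eta_eq[OF a r] by simp
    finally show ?thesis by (simp add: u_def left_diff_distrib mult.assoc)
  qed
  have "(\<Sum>c<n. Am r c * ps c) = (\<Sum>c<n. (if r = c then y r * ps c else 0)) + (\<Sum>c<n. \<Sum>a<k. xi (a,c) * dd (a,r) * di a * ps c)"
    by (simp add: Am_def distrib_right sum_distrib_right sum.distrib if_distrib[of "\<lambda>x. x * _"] cong: if_cong)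
  also have "(\<Sum>c<n. \<Sum>a<k. xi (a,c) * dd (a,r) * di a * ps c) = (\<Sum>a<k. ps r * di a - dd (a,r) * u a)"
    by (subst sum.swap) (use e in simp)
  also have "(\<Sum>c<n. (if r = c then y r * ps c else 0)) = ps r * y r"
    using r base_cm(3)[of r "(k,r)"] by (simp add: ps_def cm_def)
  finally show ?thesis by (simp add: sum_subtractf sum_distrib_left distrib_left)
qed

definition "G = lprod d k"
definition "Gi = lprod di k"

lemma G_Gi: "G * Gi = 1" "Gi * G = 1"
proof -
  have r: "prod_list (map di (rev xs)) = prod_list (map di xs)" "prod_list (map d (rev xs)) = prod_list (map d xs)" for xs
    unfolding rev_map[symmetric] by (rule prod_list_rev_cm; auto simp: di_cms dcd)+
  show "G * Gi = 1" using prod_list_map_inverse[of d di "[0..<k]"] d_di by (simp add: G_def Gi_def r)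
  show "Gi * G = 1" using prod_list_map_inverse[of di d "[0..<k]"] di_d by (simp add: G_def Gi_def r)
qed

text \<open>The product rule: each d_a has commutator 1 with y_r, so moving y_r through the product
  costs that product with d_a removed, for each a. Conjugation by G therefore supplies exactly the
  shift found in \<open>Psi'_forms\<close>.\<close>

lemma G_y: "G * y r = (y r + (\<Sum>a<k. di a)) * G"
proof -
  have "lprod d m * y r = (y r + (\<Sum>a<m. di a)) * lprod d m" for m
  proof (induction m)
    case (Suc m)
    let ?G = "lprod d m"
    have c: "?G * di m = di m * ?G"
    proof -
      have "cm (di m) ?G" by (rule cm_prod_list) (auto simp: di_cms)
      thus ?thesis by (simp add: cm_def)
    qed
    have "d m * y r = (y r + di m) * d m" by (simp add: dy distrib_right di_d)
    hence "lprod d (Suc m) * y r = (?G * y r + ?G * di m) * d m" by (simp add: mult.assoc distrib_left distrib_right)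
    also have "\<dots> = ((y r + (\<Sum>a<m. di a)) + di m) * ?G * d m" unfolding Suc c by (simp add: distrib_right)
    finally show ?case by (simp add: mult.assoc add.assoc)
  qed simp
  thus ?thesis by (simp add: G_def)
qed

lemma G_Psi: "r < n \<Longrightarrow> G * Psi k r = (\<Sum>c<n. Am r c * ps c) * G"
proof -
  assume r: "r < n"
  have "cm G x" if "\<And>a. cm x (d a)" for x
    unfolding G_def by (rule cm_sym, rule cm_prod_list) (use that in auto)
  note G = this
  have 1: "G * (ps r * y r) = ps r * (y r + (\<Sum>a<k. di a)) * G"
  proof -
    have "G * ps r = ps r * G" using G[of "ps r"] base_cm by (simp add: cm_def ps_def)
    note c = this
    have "G * (ps r * y r) = (G * ps r) * y r" by (simp only: mult.assoc)
    also have "\<dots> = ps r * (G * y r)" unfolding c by (simp only: mult.assoc)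
    finally show ?thesis unfolding G_y by (simp only: mult.assoc)
  qed
  have "cm G (\<Sum>a<k. dd (a,r) * u a)"
    by (intro cm_sum cm_mult G base_cm cm_sym[OF u_cms(2)])
  thus ?thesis unfolding Psi'_forms[OF r] Psi_def using 1
    by (simp add: cm_def right_diff_distrib left_diff_distrib)
qed

lemma G_Psis: "G * lprod (Psi k) n = lprod (\<lambda>r. \<Sum>c<n. Am r c * ps c) n * G"
proof -
  have "m \<le> n \<Longrightarrow> G * lprod (Psi k) m = lprod (\<lambda>r. \<Sum>c<n. Am r c * ps c) m * G" for m
  proof (induction m)
    case (Suc m)
    have "G * lprod (Psi k) (Suc m) = (G * lprod (Psi k) m) * Psi k m" by (simp add: mult.assoc)
    also have "\<dots> = lprod (\<lambda>r. \<Sum>c<n. Am r c * ps c) m * (G * Psi k m)" using Suc by (simp add: mult.assoc)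
    also have "\<dots> = lprod (\<lambda>r. \<Sum>c<n. Am r c * ps c) (Suc m) * G" using Suc.prems by (simp add: G_Psi mult.assoc)
    finally show ?case .
  qed simp
  thus ?thesis by simp
qed

text \<open>Multiply the relation xi_c dd_c + dd_c xi_c = 1 by Z on the left. Once
  \<open>dd c\<close> has been moved across Z, both summands contain Z xi_c.\<close>

lemma cancel_xi:
  assumes "Z * xi c = 0" "Z * dd c = s * (dd c * Z)" "c \<in> {..k} \<times> {..n}" shows "Z = 0"
proof -
  have "Z = Z * xi c * dd c + Z * dd c * xi c"
    using dd_xi_eq[OF assms(3)] by (simp add: mult.assoc distrib_left[symmetric])
  also have "\<dots> = s * (dd c * (Z * xi c))" unfolding assms(2) by (simp add: assms(1) mult.assoc)
  finally show ?thesis using assms(1) by simp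
qed

lemma cancel_xis:
  assumes "distinct cs" "set cs \<subseteq> {..k} \<times> {..n}" "\<And>c. c \<in> set cs \<Longrightarrow> cm X (dd c)"
    "X * prod_list (map xi cs) = 0" shows "X = 0"
  using assms
proof (induction cs rule: rev_induct)
  case (snoc c cs)
  have "prod_list (map xi cs) * dd c = (-1) ^ length cs * (dd c * prod_list (map xi cs))"
    using prod_list_ac[of "map xi cs" "dd c"] snoc.prems(1) by (auto intro!: xi_dd_ne)
  hence "X * prod_list (map xi cs) * dd c = (-1) ^ length cs * (X * dd c * prod_list (map xi cs))"
    by (cases "even (length cs)") (simp_all add: mult.assoc)
  also have "X * dd c = dd c * X" using snoc.prems(3)[of c] by (simp add: cm_def)
  finally have e: "X * prod_list (map xi cs) * dd c = (-1) ^ length cs * (dd c * (X * prod_list (map xi cs)))"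
    by (simp only: mult.assoc)
  have "X * prod_list (map xi cs) = 0"
  proof (rule cancel_xi[OF _ e])
    show "X * prod_list (map xi cs) * xi c = 0" using snoc.prems(4) by (simp add: mult.assoc)
    show "c \<in> {..k} \<times> {..n}" using snoc.prems(2) by simp
  qed
  thus ?case using snoc.prems by (intro snoc.IH) auto
qed simp

lemma cm_rdetR: "(\<And>a b. a < N \<Longrightarrow> b < N \<Longrightarrow> cm (x::'r) (M a b)) \<Longrightarrow> cm x (rdetR N M)"
  unfolding rdetR_def
proof (intro cm_sum cm_mult cm_of_int cm_prod_list)
  fix \<sigma> z assume M: "\<And>a b. a < N \<Longrightarrow> b < N \<Longrightarrow> cm x (M a b)" and s: "\<sigma> \<in> {\<sigma>. \<sigma> permutes {..<N}}"
    and z: "z \<in> set (map (\<lambda>r. M r (\<sigma> r)) [0..<N])"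
  have "\<sigma> r < N" if "r < N" for r using permutes_in_image[of \<sigma> "{..<N}" r] s that by auto
  thus "cm x z" using z M by auto
qed

lemma cm_Cm: "(\<And>b i. b < k \<Longrightarrow> i < n \<Longrightarrow> acm x (xi (b,i)) \<and> acm x (dd (b,i)) \<and> cm x (yi i)) \<Longrightarrow> (\<And>a. cm x (d a)) \<Longrightarrow> a < k \<Longrightarrow> b < k \<Longrightarrow> cm x (Cm a b)"
  unfolding Cm_def by (intro cm_diff cm_sum cm_mult_ac acm_mult1) auto

lemma cm_Am: "(\<And>b i. b < k \<Longrightarrow> i < n \<Longrightarrow> acm x (xi (b,i)) \<and> acm x (dd (b,i)) \<and> cm x (di b)) \<Longrightarrow> (\<And>a. cm x (y a)) \<Longrightarrow> a < n \<Longrightarrow> b < n \<Longrightarrow> cm x (Am a b)"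
  unfolding Am_def by (intro cm_add cm_sum cm_mult cm_mult_ac) auto

text \<open>At m = n both sides of \<open>core_claim\<close> become multiples of the monomial of all
  auxiliary variables, followed by the invertible G. Cancelling G and then the monomial leaves the
  determinants, because the derivations dual to the auxiliary variables commute with everything
  else.\<close>

theorem rdet_duality: "rdetR k Cm * Gi * rdetR n Am = lprod y n"
proof -
  let ?Y = "lprod y n" and ?Th = "lprod th k" and ?Ps = "lprod ps n"
  let ?C = "rdetR k Cm" and ?A = "rdetR n Am"
  have "PhiProd n = lprod (\<lambda>a. \<Sum>b<k. Cm a b * th b) k"
    unfolding PhiProd_def by (intro arg_cong[of _ _ prod_list] map_cong) (auto simp: Phi_forms)
  also have "\<dots> = ?C * ?Th"
  proof (rule rdetR_forms)
    fix i r c assume *: "i < k" "r < k" "c < k"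
    show "cm (th i) (Cm r c)" unfolding th_def by (rule cm_Cm) (use * in \<open>auto simp: xi_xi base_cm yi_cms intro!: xi_dd_ne\<close>)
  qed (auto simp: th_def xi_xi intro!: sq0)
  finally have 1: "PhiProd n = ?C * ?Th" .
  have 2: "lprod (\<lambda>r. \<Sum>c<n. Am r c * ps c) n = ?A * ?Ps"
  proof (rule rdetR_forms)
    fix i r c assume *: "i < n" "r < n" "c < n"
    show "cm (ps i) (Am r c)" unfolding ps_def by (rule cm_Am) (use * in \<open>auto simp: xi_xi base_cm di_cms intro!: xi_dd_ne\<close>)
  qed (auto simp: ps_def xi_xi intro!: sq0)
  have 3: "lprod (Psi k) n = Gi * ?A * ?Ps * G"
  proof -
    have "lprod (Psi k) n = Gi * (G * lprod (Psi k) n)" by (simp add: mult.assoc[symmetric] G_Gi)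
    thus ?thesis unfolding G_Psis 2 by (simp add: mult.assoc)
  qed
  have 4: "PhiProd 0 = G * ?Th"
  proof -
    have "Phi 0 = (\<lambda>a. d a * th a)" using base_cm(9) by (auto simp: Phi_def th_def cm_def)
    moreover have "cm (th i) (d j)" for i j by (simp add: th_def base_cm)
    ultimately show ?thesis unfolding PhiProd_def G_def by (simp add: prod_list_cm_split)
  qed
  have 5: "prod_list (map y (rev [0..<n])) = ?Y"
    unfolding rev_map[symmetric] by (rule prod_list_rev_cm) (auto simp: yy)
  have Gth: "cm G ?Th" "cm G ?Ps"
    unfolding G_def by (intro cm_prod_list cm_sym[OF cm_prod_list]; auto simp: th_def ps_def base_cm)+
  have Gith: "cm Gi ?Th"
    unfolding Gi_def by (intro cm_prod_list cm_sym[OF cm_prod_list]; auto simp: th_def ps_def di_cms)+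
  have Ath: "cm ?Th ?A"
  proof (rule cm_sym, rule cm_prod_list)
    fix x assume "x \<in> set (map th [0..<k])"
    then obtain i where i: "i < k" "x = th i" by auto
    have "cm (th i) ?A" unfolding th_def by (intro cm_rdetR cm_Am) (auto simp: xi_xi base_cm di_cms intro!: xi_dd_ne)
    thus "cm ?A x" using i by (simp add: cm_sym)
  qed
  have "PhiProd n * lprod (Psi k) n = ?Y * (PhiProd 0 * ?Ps)" using core_claim[of n] 5 by simp
  hence "?C * ?Th * (Gi * ?A * ?Ps * G) = ?Y * (G * ?Th * ?Ps)" unfolding 1 3 4 .
  also have "?C * ?Th * (Gi * ?A * ?Ps * G) = ?C * Gi * ?A * (?Th * ?Ps) * G"
  proof -
    have c: "?Th * Gi = Gi * ?Th" "?Th * ?A = ?A * ?Th" using Gith Ath by (simp_all add: cm_def)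
    have "?C * ?Th * (Gi * ?A * ?Ps * G) = ?C * (?Th * Gi) * ?A * ?Ps * G" by (simp only: mult.assoc)
    also have "\<dots> = ?C * Gi * (?Th * ?A) * ?Ps * G" unfolding c(1) by (simp only: mult.assoc)
    finally show ?thesis unfolding c(2) by (simp only: mult.assoc)
  qed
  also have "?Y * (G * ?Th * ?Ps) = ?Y * (?Th * ?Ps) * G"
  proof -
    have "G * (?Th * ?Ps) = ?Th * ?Ps * G" using cm_mult[OF Gth] by (simp add: cm_def)
    thus ?thesis by (simp only: mult.assoc)
  qed
  finally have "(?C * Gi * ?A * (?Th * ?Ps) * G) * Gi = (?Y * (?Th * ?Ps) * G) * Gi" by simp
  hence 6: "(?C * Gi * ?A - ?Y) * (?Th * ?Ps) = 0"
    by (simp add: mult.assoc G_Gi left_diff_distrib)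
  let ?cs = "map (\<lambda>a. (a,n)) [0..<k] @ map (\<lambda>i. (k,i)) [0..<n]"
  have "?C * Gi * ?A - ?Y = 0"
  proof (rule cancel_xis[of ?cs])
    show "distinct ?cs" by (auto simp: distinct_map inj_on_def)
    show "set ?cs \<subseteq> {..k} \<times> {..n}" by auto
    show "(?C * Gi * ?A - ?Y) * prod_list (map xi ?cs) = 0"
      using 6 by (simp add: th_def[abs_def] ps_def[abs_def] o_def)
    fix c assume c: "c \<in> set ?cs"
    have x: "acm (dd c) (xi (b,i)) \<and> acm (dd c) (dd (b,i)) \<and> cm (dd c) (yi j) \<and> cm (dd c) (di j)" if "b < k" "i < n" for b i j
      using c that by (auto intro!: dd_xi_ne dd_dd yi_cms di_cms)
    have "cm (dd c) ?C" by (intro cm_rdetR cm_Cm) (use x in \<open>auto simp: base_cm\<close>)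
    moreover have "cm (dd c) ?A" by (intro cm_rdetR cm_Am) (use x in \<open>auto simp: base_cm\<close>)
    moreover have "cm (dd c) Gi" unfolding Gi_def by (rule cm_prod_list) (auto simp: di_cms)
    moreover have "cm (dd c) ?Y" by (rule cm_prod_list) (auto simp: base_cm)
    ultimately show "cm (?C * Gi * ?A - ?Y) (dd c)" by (intro cm_sym[OF cm_diff] cm_mult)
  qed
  thus ?thesis by simp
qed

end

section \<open>Comparison with the concrete pseudodifferential operators\<close>

definition psd_of :: "complex pdo \<Rightarrow> psd" where "psd_of F = (\<lambda>a b. cf F (a, b))"

lemma psd_of_inject: "psd_of F = psd_of G \<longleftrightarrow> F = G"
  unfolding psd_of_def by (metis pdo_eqI)

lemma psd_valid_psd_of: "psd_valid f \<longleftrightarrow> (\<exists>F. f = psd_of F)"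
proof
  assume "psd_valid f"
  then obtain K M where "\<forall>kk m. f kk m \<noteq> 0 \<longrightarrow> kk \<le> K \<and> m \<le> M" by (auto simp: psd_valid_def)
  hence "bdd (max K M) (\<lambda>(a,b). f a b)" by (auto simp: bdd_def le_max_iff_disj)
  hence "cf (Abs_pdo (\<lambda>(a,b). f a b)) = (\<lambda>(a,b). f a b)" by (intro Abs_pdo_inverse) auto
  hence "f = psd_of (Abs_pdo (\<lambda>(a,b). f a b))" by (simp add: psd_of_def)
  thus "\<exists>F. f = psd_of F" by blast
next
  assume "\<exists>F. f = psd_of F"
  then obtain F where "f = psd_of F" by blast
  thus "psd_valid f" using bdd_cf[of F] by (auto simp: psd_valid_def psd_of_def bdd_def)
qed

lemma ff_gbinomial: "ff m j = of_real (fact j * (of_int m gchoose j))"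
  unfolding ff_def gbinomial_prod_rev by (simp add: atLeast0LessThan)

lemma ff_cc: "ff m j * ff k j / fact j = complex_of_real (leibniz m k j)"
proof -
  have "(fact j * x) * (fact j * y) / fact j = fact j * x * (y::real)" for x y by simp
  note e = this
  have f: "(fact j :: complex) = complex_of_real (fact j)" by simp
  show ?thesis unfolding ff_gbinomial leibniz_def f of_real_mult[symmetric] of_real_divide[symmetric] e ..
qed

text \<open>The depth j is determined by the two exponent pairs, so the quintuples reduce to pairs
  in a box. P and Q are the supports of the factors; the general target monoid lets the lemma serve
  scalar products and operator products alike.\<close>

lemma sum_quint:
  fixes h :: "nat \<Rightarrow> int \<Rightarrow> int \<Rightarrow> int \<Rightarrow> int \<Rightarrow> 'b::comm_monoid_add"
  assumes "\<And>kk m. P kk m \<Longrightarrow> kk \<le> K \<and> m \<le> K" "\<And>kk m. Q kk m \<Longrightarrow> kk \<le> K \<and> m \<le> K"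
    and L: "L \<le> a - K" "L \<le> b - K"
    and h0: "\<And>j kk m k2 m2. \<not> (P kk m \<and> Q k2 m2) \<Longrightarrow> h j kk m k2 m2 = 0"
  shows "(\<Sum>(j,kk,m,k2,m2) \<in> {(j::nat,kk,m,k2,m2). P kk m \<and> Q k2 m2 \<and> kk + k2 - int j = a \<and> m + m2 - int j = b}. h j kk m k2 m2)
    = (\<Sum>p\<in>sqbox L K. \<Sum>q\<in>sqbox L K. if 0 \<le> fst p + fst q - a \<and> snd p + snd q - b = fst p + fst q - a
         then h (nat (fst p + fst q - a)) (fst p) (snd p) (fst q) (snd q) else 0)"
proof -
  let ?S = "{(p,q). P (fst p) (snd p) \<and> Q (fst q) (snd q) \<and> 0 \<le> fst p + fst q - a \<and> snd p + snd q - b = fst p + fst q - a}"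
  let ?g = "\<lambda>(p,q). h (nat (fst p + fst q - a)) (fst p) (snd p) (fst q) (snd q)"
  have "(\<Sum>(j,kk,m,k2,m2) \<in> {(j::nat,kk,m,k2,m2). P kk m \<and> Q k2 m2 \<and> kk + k2 - int j = a \<and> m + m2 - int j = b}. h j kk m k2 m2)
     = sum ?g ?S"
    by (rule sum.reindex_bij_witness[where i="\<lambda>(p,q). (nat (fst p + fst q - a), fst p, snd p, fst q, snd q)" and j="\<lambda>(j,kk,m,k2,m2). ((kk,m),(k2,m2))"]) auto
  also have "\<dots> = (\<Sum>x\<in>sqbox L K \<times> sqbox L K. if 0 \<le> fst (fst x) + fst (snd x) - a \<and> snd (fst x) + snd (snd x) - b = fst (fst x) + fst (snd x) - a then ?g x else 0)"
  proof (rule sum.mono_neutral_cong_left)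
    show "?S \<subseteq> sqbox L K \<times> sqbox L K"
    proof
      fix x assume x: "x \<in> ?S"
      obtain kk m k2 m2 where e: "x = ((kk,m),(k2,m2))" by (metis prod.collapse)
      have "kk \<le> K" "m \<le> K" "k2 \<le> K" "m2 \<le> K" using x assms(1)[of kk m] assms(2)[of k2 m2] by (auto simp: e)
      thus "x \<in> sqbox L K \<times> sqbox L K" using x L by (auto simp: e sqbox_def)
    qed
    show "\<forall>x\<in>sqbox L K \<times> sqbox L K - ?S. (if 0 \<le> fst (fst x) + fst (snd x) - a \<and> snd (fst x) + snd (snd x) - b = fst (fst x) + fst (snd x) - a then ?g x else 0) = 0"
      by (auto; use h0 in blast)
  qed auto
  finally show ?thesis by (simp only: sum.cartesian_product case_prod_unfold)
qed

lemma psd_mult_psd_of: "psd_mult (psd_of F) (psd_of G) = psd_of (F * G)"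
proof (intro ext)
  fix a b
  obtain K where K: "bdd K (cf F)" "bdd K (cf G)" using bdd_cf2 by blast
  define L where "L = min a b - K"
  have L: "L \<le> a - K" "L \<le> b - K" by (auto simp: L_def)
  have "psd_mult (psd_of F) (psd_of G) a b = (\<Sum>p\<in>sqbox L K. \<Sum>q\<in>sqbox L K. if 0 \<le> fst p + fst q - a \<and> snd p + snd q - b = fst p + fst q - a
         then psd_of F (fst p) (snd p) * psd_of G (fst q) (snd q) * ff (snd p) (nat (fst p + fst q - a)) * ff (fst q) (nat (fst p + fst q - a)) / fact (nat (fst p + fst q - a)) else 0)"
    unfolding psd_mult_def
    by (rule sum_quint) (use L bddD[OF K(1), of "(_,_)"] bddD[OF K(2), of "(_,_)"] in \<open>auto simp: psd_of_def\<close>)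
  also have "\<dots> = cf (F * G) (a,b)"
    unfolding times_pdo.rep_eq pmult_box[OF K, of L "(a,b)", unfolded fst_conv snd_conv, OF L]
    by (intro sum.cong refl) (auto simp: mcoeff_def Let_def psd_of_def scaleR_conv_of_real ff_cc[symmetric])
  finally show "psd_mult (psd_of F) (psd_of G) a b = psd_of (F * G) a b" by (simp add: psd_of_def)
qed

lemma psd_one_psd_of: "psd_one = psd_of 1"
  by (intro ext) (auto simp: psd_of_def psd_one_def cf_simps)

lemma psd_prod_psd_of: "psd_prod (map psd_of Fs) = psd_of (prod_list Fs)"
  unfolding psd_prod_def by (induction Fs) (simp_all add: psd_one_psd_of psd_mult_psd_of)

lemma psd_const_psd_of: "psd_const c = psd_of (pconst c)"
  by (intro ext) (auto simp: psd_of_def psd_const_def cf_pmon)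

lemma psd_dminus_psd_of: "psd_dminus c = psd_of (pD - pconst c)"
  by (intro ext) (auto simp: psd_of_def psd_dminus_def cf_pmon cf_simps)

lemma psd_poly_psd_of: "psd_poly [:c, 1:] = psd_of (pX + pconst c)"
proof (intro ext)
  fix a b :: int
  have "a = 0 \<or> a = 1 \<or> a < 0 \<or> 2 \<le> a" by linarith
  moreover have "coeff [:c, 1:] (nat a) = 0" if "2 \<le> a"
    by (rule coeff_eq_0) (use that in simp)
  ultimately show "psd_poly [:c, 1:] a b = psd_of (pX + pconst c) a b"
    by (auto simp: psd_poly_def psd_of_def cf_pmon cf_simps)
qed

lemma psd_pow_psd_of: "psd_pow (psd_of F) e = psd_of (F ^ e)"
  unfolding psd_pow_def by (induction e) (simp_all add: psd_one_psd_of psd_mult_psd_of)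

lemma psd_sharp_psd_of: "psd_sharp (psd_of F) = psd_of (sharp F)"
proof (intro ext)
  fix a b
  have "psd_sharp (psd_of F) a b = (\<Sum>(j,kk,m) \<in> {(j::nat,kk,m). psd_of F kk m \<noteq> 0 \<and> kk - int j = b \<and> m - int j = a}.
      (if even m then 1 else -1) * psd_of F kk m * ff m j * ff kk j / fact j)"
    by (simp add: psd_sharp_def psd_ddag_def psd_dag_def)
  also have "\<dots> = (\<Sum>j\<in>{j. cf F (b + int j, a + int j) \<noteq> 0}.
     (alt (a + int j) * leibniz (b + int j) (a + int j) j) *\<^sub>R cf F (b + int j, a + int j))"
    by (rule sum.reindex_bij_witness[where i="\<lambda>j. (j, b + int j, a + int j)" and j=fst])
      (auto simp: psd_of_def scaleR_conv_of_real ff_cc[symmetric])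
  finally show "psd_sharp (psd_of F) a b = psd_of (sharp F) a b"
    by (simp add: psd_of_def sharp.rep_eq sharp_fun_def sterm_def)
qed

text \<open>\<open>psd_inv\<close> asks for the unique valid right inverse; a two-sided inverse
  forces every right inverse to agree with it.\<close>

lemma psd_inv_psd_of:
  assumes "D * E = 1" "E * D = 1" shows "psd_inv (psd_of D) = psd_of E"
  unfolding psd_inv_def
proof (rule the_equality)
  show "psd_valid (psd_of E) \<and> psd_mult (psd_of D) (psd_of E) = psd_one"
    using assms by (auto simp: psd_valid_psd_of psd_mult_psd_of psd_one_psd_of)
  fix f assume f: "psd_valid f \<and> psd_mult (psd_of D) f = psd_one"
  then obtain E' where E': "f = psd_of E'" by (auto simp: psd_valid_psd_of)
  hence "D * E' = 1" using f by (simp add: psd_mult_psd_of psd_one_psd_of psd_of_inject)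
  hence "E * (D * E') = E" by simp
  hence "E' = E" using assms by (simp add: mult.assoc[symmetric])
  thus "f = psd_of E" using E' by simp
qed

section \<open>Laurent expansion at infinity\<close>

lemma fls_of_bounded:
  fixes c :: "int \<Rightarrow> complex"
  assumes "\<forall>kk>K. c kk = 0" obtains f where "\<And>kk. fls_nth f (- kk) = c kk"
proof -
  have "fls_nth (Abs_fls (\<lambda>n. c (- n))) n = c (- n)" for n
    by (rule nth_Abs_fls_lower_bound[of "-K"]) (use assms in auto)
  thus ?thesis using that[of "Abs_fls (\<lambda>n. c (- n))"] by simp
qed

text \<open>The equations defining \<open>lexp\<close> say that the series times q is p. In the
  field of Laurent series in 1/x they have exactly one solution, the quotient, so the description is
  proper and the value inherits the bound.\<close>

lemma lexp_bounded:
  assumes "q \<noteq> 0" shows "\<exists>K. \<forall>kk>K. lexp p q kk = 0"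
proof -
  \<comment> \<open>This is q written in the variable 1/x, so all exponents change sign.\<close>
  define qf :: "complex fls" where "qf = (\<Sum>i\<le>degree q. fls_const (coeff q i) * fls_X_intpow (- int i))"
  have qf: "fls_nth (qf * f) (- a) = (\<Sum>i\<le>degree q. coeff q i * fls_nth f (- (a - int i)))" for f a
    unfolding qf_def sum_distrib_right fls_nth_sum
  proof (rule sum.cong[OF refl])
    fix i
    have e: "- a + int i = - (a - int i)" by simp
    show "fls_nth (fls_const (coeff q i) * fls_X_intpow (- int i) * f) (- a) = coeff q i * fls_nth f (- (a - int i))"
      unfolding mult.assoc fls_X_intpow_times_conv_shift(1) unfolding fls_mult_const_nth fls_shift_nth minus_minus e ..
  qed
  have "fls_nth qf (- int (degree q)) = (\<Sum>i\<le>degree q. coeff q i * fls_nth (1::complex fls) (- (int (degree q) - int i)))"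
    using qf[of 1 "int (degree q)"] by simp
  also have "\<dots> = (\<Sum>i\<le>degree q. if i = degree q then coeff q i else 0)"
    by (intro sum.cong) auto
  also have "\<dots> \<noteq> 0" using assms by simp
  finally have qf0: "qf \<noteq> 0" by auto
  define P where "P = (\<lambda>c. (\<exists>K. \<forall>kk>K. c kk = 0) \<and>
      (\<forall>a. (\<Sum>i\<le>degree q. coeff q i * c (a - int i)) = (if a \<ge> 0 then coeff p (nat a) else 0)))"
  define pc where "pc a = (if a \<ge> 0 then coeff p (nat a) else 0)" for a :: int
  have "\<forall>kk>int (degree p). pc kk = 0" by (auto simp: pc_def intro!: coeff_eq_0)
  then obtain pf where pf: "\<And>kk. fls_nth pf (- kk) = pc kk" using fls_of_bounded by blast
  define f where "f = pf / qf"
  have fq: "qf * f = pf" using qf0 by (simp add: f_def)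
  have "P (\<lambda>kk. fls_nth f (- kk))"
  proof -
    have "fls_nth f (- kk) = 0" if "kk > - fls_subdegree f" for kk
      using that by (intro fls_eq0_below_subdegree) simp
    moreover have "(\<Sum>i\<le>degree q. coeff q i * fls_nth f (- (a - int i))) = pc a" for a
      unfolding qf[symmetric] fq pf ..
    ultimately show ?thesis unfolding P_def pc_def by blast
  qed
  moreover have "c = (\<lambda>kk. fls_nth f (- kk))" if Pc: "P c" for c
  proof -
    obtain K where "\<forall>kk>K. c kk = 0" using Pc unfolding P_def by blast
    then obtain g where g: "\<And>kk. fls_nth g (- kk) = c kk" using fls_of_bounded by blast
    have "fls_nth (qf * g) (- a) = fls_nth pf (- a)" for a
      unfolding qf g pf pc_def using Pc unfolding P_def by blast
    hence "qf * g = pf" by (intro fls_eqI) (metis minus_minus)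
    hence "g = f" using qf0 fq by (metis mult_left_cancel)
    thus ?thesis using g by auto
  qed
  ultimately have "P (THE c. P c)" by (rule theI)
  moreover have "lexp p q = (THE c. P c)" unfolding lexp_def P_def ..
  ultimately show ?thesis unfolding P_def by metis
qed

lemma DV_psd_psd_of:
  assumes "\<forall>j<M. q j \<noteq> 0" obtains D where "DV_psd M p q = psd_of D"
proof -
  have "\<exists>K. \<forall>j. \<forall>kk>K j. j < M \<longrightarrow> lexp (p j) (q j) kk = 0"
    using assms lexp_bounded by (intro choice) metis
  then obtain K where K: "\<And>j kk. j < M \<Longrightarrow> kk > K j \<Longrightarrow> lexp (p j) (q j) kk = 0" by blast
  have "psd_valid (DV_psd M p q)" unfolding psd_valid_def
  proof (intro exI allI impI)
    fix kk m assume *: "DV_psd M p q kk m \<noteq> 0"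
    show "kk \<le> Max (insert 0 (K ` {..<M})) \<and> m \<le> int M"
    proof (cases "m = int M")
      case True
      hence "kk = 0" using * by (auto simp: DV_psd_def split: if_splits)
      thus ?thesis using True by simp
    next
      case False
      hence m: "0 \<le> m" "m < int M" "lexp (p (nat m)) (q (nat m)) kk \<noteq> 0" using * by (auto simp: DV_psd_def split: if_splits)
      hence "kk \<le> K (nat m)" using K[of "nat m" kk] by force
      also have "\<dots> \<le> Max (insert 0 (K ` {..<M}))" using m by (intro Max_ge) auto
      finally show ?thesis using m by simp
    qed
  qed
  thus ?thesis using that by (auto simp: psd_valid_psd_of)
qed

section \<open>Comparison with the concrete Bethe operators\<close>

definition gU :: "nat \<Rightarrow> nat \<Rightarrow> gvec set" where
  "gU k n = {v. \<forall>S. v S \<noteq> 0 \<longrightarrow> S \<subseteq> {..<k} \<times> {..<n}}"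

text \<open>The concrete generators lose their signs on infinite sets, so agreement is asked on
  \<open>gU\<close> only; that \<open>gU\<close> is preserved makes it compatible with composition.
  The bound concerns the operators as functions and keeps the index sets of \<open>osmult\<close>
  finite.\<close>

definition reps :: "nat \<Rightarrow> nat \<Rightarrow> opser \<Rightarrow> lop pdo \<Rightarrow> bool" where
  "reps k n F F' \<longleftrightarrow> (\<exists>K. \<forall>kk m. F kk m \<noteq> 0 \<longrightarrow> kk \<le> K \<and> m \<le> K) \<and>
     (\<forall>kk m. \<forall>v\<in>gU k n. F kk m v = ap (cf F' (kk, m)) v \<and> F kk m v \<in> gU k n)"

lemma sum_apply: "(sum f X) v = (\<Sum>x\<in>X. f x v)"
  by (induction X rule: infinite_finite_induct) auto

lemma gU_closed: "0 \<in> gU k n" "v \<in> gU k n \<Longrightarrow> w \<in> gU k n \<Longrightarrow> v + w \<in> gU k n"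
  "v \<in> gU k n \<Longrightarrow> gscale c v \<in> gU k n"
proof -
  show "v \<in> gU k n \<Longrightarrow> w \<in> gU k n \<Longrightarrow> v + w \<in> gU k n"
    unfolding gU_def by auto (metis add.right_neutral in_mono mem_Sigma_iff lessThan_iff add_0)+
qed (auto simp: gU_def gscale_def)

lemma gU_sum: "(\<And>x. x \<in> X \<Longrightarrow> f x \<in> gU k n) \<Longrightarrow> sum f X \<in> gU k n"
  by (induction X rule: infinite_finite_induct) (auto intro: gU_closed)

lemma reps_bounded: assumes "reps k n F F'" "reps k n G G'"
  obtains K where "\<And>kk m. F kk m \<noteq> 0 \<Longrightarrow> kk \<le> K \<and> m \<le> K" "\<And>kk m. G kk m \<noteq> 0 \<Longrightarrow> kk \<le> K \<and> m \<le> K"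
    "bdd K (cf F')" "bdd K (cf G')"
proof -
  obtain K1 where K1: "\<forall>kk m. F kk m \<noteq> 0 \<longrightarrow> kk \<le> K1 \<and> m \<le> K1" using assms(1) by (auto simp: reps_def)
  obtain K2 where K2: "\<forall>kk m. G kk m \<noteq> 0 \<longrightarrow> kk \<le> K2 \<and> m \<le> K2" using assms(2) by (auto simp: reps_def)
  obtain K3 where K3: "bdd K3 (cf F')" "bdd K3 (cf G')" using bdd_cf2 by blast
  show ?thesis
  proof (rule that[of "max K1 (max K2 K3)"])
    show "bdd (max K1 (max K2 K3)) (cf F')" "bdd (max K1 (max K2 K3)) (cf G')" using K3 by (auto intro: bdd_mono)
    show "kk \<le> max K1 (max K2 K3) \<and> m \<le> max K1 (max K2 K3)" if "F kk m \<noteq> 0" for kk m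
      using K1[rule_format, OF that] by linarith
    show "kk \<le> max K1 (max K2 K3) \<and> m \<le> max K1 (max K2 K3)" if "G kk m \<noteq> 0" for kk m
      using K2[rule_format, OF that] by linarith
  qed
qed

text \<open>The two products sum over different supports, because an operator can vanish on
  \<open>gU\<close> without being 0. Over a common box the additional terms vanish at v, and the
  sums agree term by term.\<close>

lemma reps_mult:
  assumes F: "reps k n F F'" and G: "reps k n G G'"
  shows "reps k n (osmult F G) (F' * G')"
proof -
  obtain K where K: "\<And>kk m. F kk m \<noteq> 0 \<Longrightarrow> kk \<le> K \<and> m \<le> K" "\<And>kk m. G kk m \<noteq> 0 \<Longrightarrow> kk \<le> K \<and> m \<le> K"
    "bdd K (cf F')" "bdd K (cf G')" using reps_bounded[OF F G] by blast
  have 1: "a \<le> 2 * K \<and> b \<le> 2 * K" if "osmult F G a b \<noteq> 0" for a b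
  proof (rule ccontr)
    assume n: "\<not> ?thesis"
    have S: "{(j::nat,kk,m,k2,m2). F kk m \<noteq> 0 \<and> G k2 m2 \<noteq> 0 \<and> kk + k2 - int j = a \<and> m + m2 - int j = b} = {}"
    proof -
      have False if "F kk m \<noteq> 0" "G k2 m2 \<noteq> 0" "kk + k2 - int j = a" "m + m2 - int j = b" for j kk m k2 m2
        using K(1)[OF that(1)] K(2)[OF that(2)] that n by linarith
      thus ?thesis by blast
    qed
    show False using that unfolding osmult_def S by simp
  qed
  have 2: "osmult F G a b v = ap (cf (F' * G') (a,b)) v \<and> osmult F G a b v \<in> gU k n" if v: "v \<in> gU k n" for a b v
  proof
    define L where "L = min a b - K"
    have L: "L \<le> a - K" "L \<le> b - K" by (auto simp: L_def)
    have Gv: "G k2 m2 v \<in> gU k n" "G k2 m2 v = ap (cf G' (k2,m2)) v" for k2 m2 using G v unfolding reps_def by blast+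
    have Fv: "F k2 m2 w \<in> gU k n" "F k2 m2 w = ap (cf F' (k2,m2)) w" if "w \<in> gU k n" for k2 m2 w using F that unfolding reps_def by blast+
    let ?h = "\<lambda>p q. if F (fst p) (snd p) \<noteq> 0 \<and> G (fst q) (snd q) \<noteq> 0 then op_scale (ff (snd p) (nat (fst p + fst q - a)) * ff (fst q) (nat (fst p + fst q - a)) / fact (nat (fst p + fst q - a))) (F (fst p) (snd p) \<circ> G (fst q) (snd q)) v else 0"
    have F0: "F kk m (ap (cf G' (k2,m2)) v) = ap (cf F' (kk,m)) (ap (cf G' (k2,m2)) v)" for kk m k2 m2
      using Fv(2)[OF Gv(1), of kk m k2 m2] by (simp add: Gv(2))
    show "osmult F G a b v \<in> gU k n"
      unfolding osmult_def sum_apply[where v=v] by (rule gU_sum) (auto simp: op_scale_def intro!: gU_closed Fv Gv)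
    have "osmult F G a b v = (\<Sum>(j,kk,m,k2,m2) \<in> {(j::nat,kk,m,k2,m2). F kk m \<noteq> 0 \<and> G k2 m2 \<noteq> 0
        \<and> kk + k2 - int j = a \<and> m + m2 - int j = b}.
      if F kk m \<noteq> 0 \<and> G k2 m2 \<noteq> 0 then op_scale (ff m j * ff k2 j / fact j) (F kk m \<circ> G k2 m2) v else 0)"
      unfolding osmult_def sum_apply[where v=v] by (intro sum.cong) (auto split: prod.splits)
    also have "\<dots> = (\<Sum>p\<in>sqbox L K. \<Sum>q\<in>sqbox L K. if 0 \<le> fst p + fst q - a \<and> snd p + snd q - b = fst p + fst q - a
         then ?h p q else 0)"
      by (rule sum_quint) (use K L in auto)
    also have "\<dots> = (\<Sum>p\<in>sqbox L K. \<Sum>q\<in>sqbox L K. gscale (of_real (mcoeff p q (a,b))) (ap (cf F' p) (ap (cf G' q) v)))"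
    proof (rule sum.cong[OF refl], rule sum.cong[OF refl])
      fix p q :: "int \<times> int"
      obtain kk m k2 m2 where pq: "p = (kk,m)" "q = (k2,m2)" by (metis prod.collapse)
      have "ap (cf F' p) (ap (cf G' q) v) = 0" if "F kk m = 0"
        using F0[of kk m k2 m2] that by (simp add: pq)
      moreover have "ap (cf F' p) (ap (cf G' q) v) = 0" if "G k2 m2 = 0"
      proof -
        have "ap (cf G' q) v = 0" using Gv(2)[of k2 m2] that by (simp add: pq)
        hence "ap (cf F' p) (ap (cf G' q) v) = ap (cf F' p) (\<lambda>S. 0 * v S)" by (simp add: zero_fun_def)
        thus ?thesis unfolding ap_scale by (simp add: zero_fun_def)
      qed
      ultimately show "(if 0 \<le> fst p + fst q - a \<and> snd p + snd q - b = fst p + fst q - a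
         then ?h p q else 0)
         = gscale (of_real (mcoeff p q (a,b))) (ap (cf F' p) (ap (cf G' q) v))"
        unfolding ff_cc by (auto simp: pq mcoeff_def Let_def op_scale_def F0 Gv(2) gscale_def zero_fun_def)
    qed
    also have "\<dots> = ap (cf (F' * G') (a,b)) v"
      unfolding times_pdo.rep_eq pmult_box[OF K(3,4), of L "(a,b)", unfolded fst_conv snd_conv, OF L]
      by (rule ext) (simp add: sum_apply ap_sum ap_simps gscale_def)
    finally show "osmult F G a b v = ap (cf (F' * G') (a,b)) v" .
  qed
  show ?thesis unfolding reps_def using 1 2 by blast
qed

lemma reps_one: "reps k n os_one 1"
  unfolding reps_def
proof (intro conjI exI[of _ 0])
  show "\<forall>kk m. os_one kk m \<noteq> 0 \<longrightarrow> kk \<le> 0 \<and> m \<le> 0" by (auto simp: os_one_def)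
qed (auto simp: os_one_def cf_simps ap_simps gU_closed zero_fun_def[symmetric])

lemma reps_foldr:
  assumes "\<And>x. x \<in> set xs \<Longrightarrow> reps k n (f x) (g x)"
  shows "reps k n (foldr osmult (map f xs) os_one) (prod_list (map g xs))"
  using assms by (induction xs) (auto intro: reps_one reps_mult)

lemma reps_add: "reps k n F F' \<Longrightarrow> reps k n G G' \<Longrightarrow> reps k n (F + G) (F' + G')"
proof -
  assume F: "reps k n F F'" and G: "reps k n G G'"
  obtain K where K: "\<And>kk m. F kk m \<noteq> 0 \<Longrightarrow> kk \<le> K \<and> m \<le> K" "\<And>kk m. G kk m \<noteq> 0 \<Longrightarrow> kk \<le> K \<and> m \<le> K"
    "bdd K (cf F')" "bdd K (cf G')"
    using reps_bounded[OF F G] by blast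
  have "kk \<le> K \<and> m \<le> K" if "(F + G) kk m \<noteq> 0" for kk m
  proof (cases "F kk m = 0")
    case True
    thus ?thesis using that K(2)[of kk m] by simp
  qed (rule K(1))
  moreover have "(F + G) kk m v = ap (cf (F' + G') (kk, m)) v \<and> (F + G) kk m v \<in> gU k n" if v: "v \<in> gU k n" for kk m v
  proof -
    have "F kk m v = ap (cf F' (kk, m)) v" "F kk m v \<in> gU k n" using F v unfolding reps_def by blast+
    moreover have "G kk m v = ap (cf G' (kk, m)) v" "G kk m v \<in> gU k n" using G v unfolding reps_def by blast+
    moreover have "(F + G) kk m v = F kk m v + G kk m v" by simp
    moreover have "F kk m v + G kk m v \<in> gU k n" by (rule gU_closed) fact+
    ultimately show ?thesis by (simp add: cf_simps ap_simps plus_fun_def)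
  qed
  ultimately show ?thesis unfolding reps_def by blast
qed

lemma reps_0: "reps k n 0 0"
  unfolding reps_def by (auto simp: cf_simps ap_simps gU_closed zero_fun_def[symmetric])

lemma reps_sum: "(\<And>x. x \<in> X \<Longrightarrow> reps k n (f x) (g x)) \<Longrightarrow> reps k n (sum f X) (sum g X)"
  by (induction X rule: infinite_finite_induct) (auto intro: reps_add reps_0)

lemma of_int_pdo: "(of_int i :: 'a::real_algebra_1 pdo) = pconst (of_int i)"
proof -
  have n: "(of_nat j :: 'a pdo) = pconst (of_nat j)" for j
    by (induction j) (simp_all add: pconst_add pconst_0 pconst_1)
  show ?thesis by (cases i) (simp_all add: n pconst_uminus pconst_diff pconst_1 pconst_add)
qed

lemma ap_of_int: "ap (of_int i) v = (\<lambda>S. of_int i * v S)"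
proof -
  have n: "ap (of_nat j) v = (\<lambda>S. of_nat j * v S)" for j
    by (induction j) (simp_all add: ap_simps distrib_right)
  show ?thesis by (cases i rule: int_cases2) (simp_all add: n ap_simps)
qed

lemma reps_scale:
  assumes "reps k n F F'" shows "reps k n (os_scale (of_int i) F) (of_int i * F')"
proof -
  obtain K where K: "\<forall>kk m. F kk m \<noteq> 0 \<longrightarrow> kk \<le> K \<and> m \<le> K" using assms by (auto simp: reps_def)
  have "os_scale (of_int i) F kk m \<noteq> 0 \<Longrightarrow> F kk m \<noteq> 0" for kk m
    by (auto simp: os_scale_def op_scale_def gscale_def zero_fun_def)
  hence "\<forall>kk m. os_scale (of_int i) F kk m \<noteq> 0 \<longrightarrow> kk \<le> K \<and> m \<le> K" using K by blast
  moreover have "os_scale (of_int i) F kk m v = ap (cf (of_int i * F') (kk, m)) v \<and> os_scale (of_int i) F kk m v \<in> gU k n"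
    if v: "v \<in> gU k n" for kk m v
  proof
    have e: "os_scale (of_int i) F kk m v = gscale (of_int i) (F kk m v)" by (simp add: os_scale_def op_scale_def)
    have F: "F kk m v = ap (cf F' (kk, m)) v" "F kk m v \<in> gU k n" using assms v unfolding reps_def by blast+
    show "os_scale (of_int i) F kk m v \<in> gU k n" unfolding e by (rule gU_closed(3)[OF F(2)])
    show "os_scale (of_int i) F kk m v = ap (cf (of_int i * F') (kk, m)) v"
      unfolding e F(1) by (simp add: of_int_pdo cf_pconst_mult ap_simps ap_of_int gscale_def)
  qed
  ultimately show ?thesis unfolding reps_def by blast
qed

lemma reps_rdet:
  assumes "\<And>r c. r < N \<Longrightarrow> c < N \<Longrightarrow> reps k n (A r c) (A' r c)"
  shows "reps k n (rdet N A) (rdetR N A')"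
  unfolding rdet_def rdetR_def
proof (intro reps_sum reps_scale reps_foldr)
  fix \<sigma> r assume "\<sigma> \<in> {\<sigma>. \<sigma> permutes {..<N}}" "r \<in> set [0..<N]"
  thus "reps k n (A r (\<sigma> r)) (A' r (\<sigma> r))"
    using permutes_in_image[of \<sigma> "{..<N}" r] by (intro assms) auto
qed

lemma reps_bethe:
  assumes E: "\<And>s v. v \<in> gU k n \<Longrightarrow> E s c r v = ap (E' s) v \<and> E s c r v \<in> gU k n"
    and F: "\<And>kk m. cf F (kk,m) = (if r = c then (if kk = 0 \<and> m = 1 then 1 else if kk = 0 \<and> m = 0 then lsc (- beta r) else 0) else 0)
        - (if m = 0 \<and> kk \<le> -1 then E' (nat (- kk - 1)) else 0)"
  shows "reps k n (bethe_mat beta E r c) F"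
  unfolding reps_def
proof (intro conjI exI[of _ 1])
  show "\<forall>kk m. bethe_mat beta E r c kk m \<noteq> 0 \<longrightarrow> kk \<le> 1 \<and> m \<le> 1"
    by (auto simp: bethe_mat_def split: if_splits)
  have d: "v - w = v + gscale (-1) w" for v w :: gvec by (auto simp: gscale_def)
  show "\<forall>kk m. \<forall>v\<in>gU k n. bethe_mat beta E r c kk m v = ap (cf F (kk, m)) v \<and> bethe_mat beta E r c kk m v \<in> gU k n"
  proof (intro allI ballI conjI)
    fix kk m v assume v: "v \<in> gU k n"
    show "bethe_mat beta E r c kk m v = ap (cf F (kk, m)) v"
      unfolding bethe_mat_def F using E[OF v] by (auto simp: ap_simps op_scale_def gscale_def fun_eq_iff)
    have EU: "E s c r v \<in> gU k n" for s using E[OF v] by blast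
    show "bethe_mat beta E r c kk m v \<in> gU k n"
      unfolding bethe_mat_def minus_apply d using EU v by (auto simp: op_scale_def intro!: gU_closed)
  qed
qed

section \<open>The two Lie algebra actions\<close>

abbreviation "sites k n \<equiv> {..k} \<times> {..n::nat} :: (nat \<times> nat) set"

lemma gsgn_eq: "S \<subseteq> sites k n \<Longrightarrow> gsgn (sites k n) S c = (-1) ^ card {d \<in> S. lexless d c}"
  unfolding gsgn_def by (simp add: Int_absorb2)

text \<open>Wherever the coefficient of the vector is nonzero, the set S lies inside the finite
  grid, and there both sign conventions count the same elements. Elsewhere both sides are 0.\<close>

lemma xi_dd_gU:
  assumes v: "v \<in> gU k n" and c: "c \<in> {..<k} \<times> {..<n}" and e: "e \<in> {..<k} \<times> {..<n}"
  shows "xi c (dd e v) = ap (lxi (sites k n) c * ldd (sites k n) e) v" "xi c (dd e v) \<in> gU k n"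
proof -
  have 1: "dd e v = ap (ldd (sites k n) e) v" "dd e v \<in> gU k n"
  proof -
    show "dd e v \<in> gU k n" using v unfolding gU_def dd_def by (auto split: if_splits)
    show "dd e v = ap (ldd (sites k n) e) v"
    proof
      fix S
      have "S \<subseteq> sites k n" if "v (insert e S) \<noteq> 0" using v that by (force simp: gU_def)
      thus "dd e v S = ap (ldd (sites k n) e) v S"
        by (cases "v (insert e S) = 0") (auto simp: dd_def ap_ldd gsgn_eq)
    qed
  qed
  have 2: "xi c w = ap (lxi (sites k n) c) w" "xi c w \<in> gU k n" if w: "w \<in> gU k n" for w
  proof -
    show "xi c w \<in> gU k n" using w c unfolding gU_def xi_def by (auto split: if_splits)
    show "xi c w = ap (lxi (sites k n) c) w"
    proof
      fix S
      have "S \<subseteq> sites k n" if "w (S - {c}) \<noteq> 0" using w that c by (force simp: gU_def)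
      thus "xi c w S = ap (lxi (sites k n) c) w S"
        by (cases "w (S - {c}) = 0") (auto simp: xi_def ap_lxi gsgn_eq)
    qed
  qed
  show "xi c (dd e v) = ap (lxi (sites k n) c * ldd (sites k n) e) v" "xi c (dd e v) \<in> gU k n"
    using 2[OF 1(2)] 1(1) by (simp_all add: ap_simps)
qed

lemma pi_gU_aux:
  assumes "\<And>x. x \<in> X \<Longrightarrow> A x v = ap (A' x) v \<and> A x v \<in> gU k n"
  shows "(\<Sum>x\<in>X. op_scale (c x ^ s) (A x)) v = ap (\<Sum>x\<in>X. lsc (c x) ^ s * A' x) v \<and> (\<Sum>x\<in>X. op_scale (c x ^ s) (A x)) v \<in> gU k n"
proof
  have e: "(\<Sum>x\<in>X. op_scale (c x ^ s) (A x)) v = (\<Sum>x\<in>X. gscale (c x ^ s) (A x v))"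
    by (simp add: sum_apply op_scale_def)
  show "(\<Sum>x\<in>X. op_scale (c x ^ s) (A x)) v \<in> gU k n"
    unfolding e by (intro gU_sum gU_closed(3)) (use assms in blast)
  have "(\<Sum>x\<in>X. gscale (c x ^ s) (A x v)) = (\<Sum>x\<in>X. ap (lsc (c x) ^ s * A' x) v)"
    by (intro sum.cong refl) (use assms in \<open>simp add: ap_simps gscale_def flip: lsc_hom(7)\<close>)
  thus "(\<Sum>x\<in>X. op_scale (c x ^ s) (A x)) v = ap (\<Sum>x\<in>X. lsc (c x) ^ s * A' x) v"
    unfolding e by (simp add: ap_sum sum_apply fun_eq_iff)
qed

lemma pi_gU:
  assumes v: "v \<in> gU k n"
  shows "c < n \<Longrightarrow> r < n \<Longrightarrow> pi_n k z s c r v = ap (\<Sum>a<k. lsc (z a) ^ s * (lxi (sites k n) (a,c) * ldd (sites k n) (a,r))) v \<and> pi_n k z s c r v \<in> gU k n"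
    and "c < k \<Longrightarrow> r < k \<Longrightarrow> pi_k n alpha s c r v = ap (\<Sum>i<n. lsc (- alpha i) ^ s * (lxi (sites k n) (c,i) * ldd (sites k n) (r,i))) v \<and> pi_k n alpha s c r v \<in> gU k n"
  unfolding pi_n_def pi_k_def by (rule pi_gU_aux; use xi_dd_gU[OF v] in simp)+

section \<open>The concrete Weyl and Clifford generators\<close>

lemma pconst_lsc_central: "cm (pconst (lsc c)) F"
  unfolding cm_def by (rule pdo_eqI) (simp add: cf_pconst_mult cf_mult_pconst lsc_cm)

lemma cm_pX_pconst: "cm pX (pconst c)" and cm_pD_pconst: "cm pD (pconst c)"
  unfolding cm_def by (simp_all add: pconst_pX pconst_pD)

lemma weyl_aux:
  fixes X D a c :: "'r::ring_1"
  assumes "D * X = X * D + 1" "a * X = X * a" "c * D = D * c" "a * c = c * a"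
  shows "(X - c) * (a - D) = (a - D) * (X - c) + 1"
  by (simp add: left_diff_distrib right_diff_distrib assms)

locale setting =
  fixes k n :: nat and alpha z :: "nat \<Rightarrow> complex"
begin

text \<open>With d_a = x - z_a, the relation d_a y_i = y_i d_a + 1 forces the sign of d/dx in y_i.
  The Bethe matrix of gl_n is therefore the negative of \<open>wc.Am\<close>.\<close>

definition yP :: "nat \<Rightarrow> lop pdo" where "yP i = pconst (lsc (alpha i)) - pD"
definition yiP :: "nat \<Rightarrow> lop pdo" where "yiP i = - dinv (lsc (alpha i))"
definition dP :: "nat \<Rightarrow> lop pdo" where "dP a = pX - pconst (lsc (z a))"
definition diP :: "nat \<Rightarrow> lop pdo" where "diP a = xinv (lsc (z a))"
text \<open>The value 0 outside the grid makes the anticommutation relations of the locale hold for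
  all index pairs.\<close>

definition xiP :: "nat \<times> nat \<Rightarrow> lop pdo" where "xiP c = pconst (if c \<in> sites k n then lxi (sites k n) c else 0)"
definition ddP :: "nat \<times> nat \<Rightarrow> lop pdo" where "ddP c = pconst (if c \<in> sites k n then ldd (sites k n) c else 0)"

lemma acm_pconst: "a * b = - (b * a) \<Longrightarrow> acm (pconst a) (pconst (b::lop))"
  unfolding acm_def by (simp add: pconst_uminus flip: pconst_mult)

sublocale wc: weyl_clifford k n yP yiP dP diP xiP ddP
proof
  fix i j a b c e
  show "x = 0" if "x + x = 0" for x :: "lop pdo"
  proof (rule pdo_eqI, rule lop_eqI)
    fix a b v S
    have "ap (cf (x + x) (a,b)) v S = 0" unfolding that by (simp add: cf_simps ap_simps)
    thus "ap (cf x (a,b)) v S = ap (cf 0 (a,b)) v S" by (simp add: cf_simps ap_simps)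
  qed
  show "yP i * yiP i = 1" using dinv_right[of "lsc (alpha i)"] by (simp add: yP_def yiP_def algebra_simps)
  show "yiP i * yP i = 1" using dinv_left[of "lsc (alpha i)"] by (simp add: yP_def yiP_def algebra_simps)
  show "dP a * diP a = 1" by (simp add: dP_def diP_def xinv_right)
  show "diP a * dP a = 1" by (simp add: dP_def diP_def xinv_left)
  show "dP a * yP i = yP i * dP a + 1"
  proof -
    note c = pconst_lsc_central[unfolded cm_def]
    show ?thesis unfolding dP_def yP_def by (rule weyl_aux[OF pD_pX c c c])
  qed
  show "cm (yP i) (yP j)" "cm (dP a) (dP b)" unfolding yP_def dP_def
    by (intro cm_diff cm_sym[OF cm_diff] cm_self pconst_lsc_central cm_sym[OF pconst_lsc_central])+
  show "cm (yP i) (xiP c)" "cm (yP i) (ddP c)" "cm (dP a) (xiP c)" "cm (dP a) (ddP c)"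
    unfolding yP_def dP_def xiP_def ddP_def
    by (rule cm_sym, intro cm_diff cm_sym[OF cm_pX_pconst] cm_sym[OF cm_pD_pconst] cm_sym[OF pconst_lsc_central])+
  show "acm (xiP c) (xiP e)" "acm (ddP c) (ddP e)" unfolding xiP_def ddP_def
    by (rule acm_pconst; use lxi_lxi[of "sites k n" c e] ldd_ldd[of "sites k n" c e] in auto)+
  show "acm (ddP c) (xiP e)" if "c \<noteq> e" unfolding xiP_def ddP_def
    by (rule acm_pconst; use ldd_lxi[of "sites k n" c e] that in auto)
  show "ddP c * xiP c = 1 - xiP c * ddP c" if "c \<in> sites k n"
  proof -
    have "ldd (sites k n) c * lxi (sites k n) c = 1 - lxi (sites k n) c * ldd (sites k n) c"
      using ldd_lxi[of "sites k n" c c] that by simp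
    thus ?thesis using that by (simp add: xiP_def ddP_def pconst_diff pconst_1 flip: pconst_mult)
  qed
qed

end

section \<open>Monic differential operators\<close>

definition dop :: "int \<Rightarrow> 'a::real_algebra_1 pdo \<Rightarrow> bool" where
  "dop N F \<longleftrightarrow> (\<forall>p. cf F p \<noteq> 0 \<longrightarrow> 0 \<le> snd p \<and> snd p \<le> N)"

text \<open>The eigenvalue equations speak of the coefficients of (d/dx)^b with 0 <= b < n. Monicity
  of both operators supplies the equality of all other coefficients.\<close>

definition monic_dop :: "int \<Rightarrow> 'a::real_algebra_1 pdo \<Rightarrow> bool" where
  "monic_dop N F \<longleftrightarrow> dop N F \<and> (\<forall>a. cf F (a, N) = (if a = 0 then 1 else 0))"

lemma pmult_nonzero:
  assumes "cf (F * G) r \<noteq> 0"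
  obtains p q where "cf F p \<noteq> 0" "cf G q \<noteq> 0" "mcoeff p q r \<noteq> 0"
  using assms unfolding times_pdo.rep_eq pmult_def by (auto elim!: sum.not_neutral_contains_not_neutral)

lemma dop_mult:
  assumes "dop N F" "dop M G" shows "dop (N + M) (F * G)"
  unfolding dop_def
proof (intro allI impI)
  fix r assume "cf (F * G) r \<noteq> 0"
  then obtain p q where pq: "cf F p \<noteq> 0" "cf G q \<noteq> 0" "mcoeff p q r \<noteq> 0" by (rule pmult_nonzero)
  define j where "j = fst p + fst q - fst r"
  have j: "0 \<le> j" "snd p + snd q - snd r = j" "leibniz (snd p) (fst q) (nat j) \<noteq> 0"
    using pq(3) by (auto simp: mcoeff_def Let_def j_def split: if_splits)
  have p: "0 \<le> snd p" "snd p \<le> N" and q: "0 \<le> snd q" "snd q \<le> M" using assms pq unfolding dop_def by blast+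
  \<comment> \<open>An operator of order snd p >= 0 can differentiate at most snd p times: beyond
    that the binomial coefficient vanishes, so no negative power of d/dx appears.\<close>
  have "j \<le> snd p"
  proof (rule ccontr)
    assume "\<not> ?thesis"
    hence "nat (snd p) < nat j" using p j(1) by linarith
    hence "(of_nat (nat (snd p)) gchoose nat j :: real) = 0"
      unfolding binomial_gbinomial[symmetric] by simp
    moreover have "(of_nat (nat (snd p)) :: real) = of_int (snd p)" using p by simp
    ultimately show False using j(3) by (simp add: leibniz_def)
  qed
  thus "0 \<le> snd r \<and> snd r \<le> N + M" using j p q by linarith
qed

lemma monic_dop_mult:
  assumes "monic_dop N F" "monic_dop M G" shows "monic_dop (N + M) (F * G)"
proof -
  have d: "dop N F" "dop M G" using assms by (auto simp: monic_dop_def)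
  have "cf (F * G) (a, N + M) = (if a = 0 then 1 else 0)" for a
  proof -
    have "cf (F * G) (a, N + M) = (\<Sum>p\<in>{(0,N)}. \<Sum>q\<in>{(0,M)}. mcoeff p q (a, N + M) *\<^sub>R (cf F p * cf G q))"
      unfolding times_pdo.rep_eq
    proof (rule pmult_sum)
      fix p q assume *: "cf F p \<noteq> 0" "cf G q \<noteq> 0" "mcoeff p q (a, N + M) \<noteq> 0"
      have "snd p \<le> N" "snd q \<le> M" using d * unfolding dop_def by blast+
      moreover have "N + M \<le> snd p + snd q" using mcoeff_le[OF *(3)] by simp
      ultimately have s: "snd p = N" "snd q = M" by auto
      have "cf F (fst p, N) \<noteq> 0" "cf G (fst q, M) \<noteq> 0" using *(1,2) s by (metis prod.collapse)+
      hence "fst p = 0" "fst q = 0" using assms unfolding monic_dop_def by metis+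
      thus "p \<in> {(0,N)} \<and> q \<in> {(0,M)}" using s by (auto simp: prod_eq_iff)
    qed auto
    also have "\<dots> = (if a = 0 then 1 else 0)"
      using assms by (auto simp: monic_dop_def mcoeff_def)
    finally show ?thesis .
  qed
  thus ?thesis using dop_mult[OF d] by (simp add: monic_dop_def)
qed

lemma dop_1: "dop 0 1" and monic_dop_1: "monic_dop 0 1"
  by (auto simp: dop_def monic_dop_def cf_simps)

lemma dop_prod_list:
  "(\<And>i. i < N \<Longrightarrow> dop (e i) (F i)) \<Longrightarrow> dop (\<Sum>i<N. e i) (lprod F N)"
  by (induction N) (auto simp: dop_1 intro!: dop_mult)

lemma monic_dop_prod_list:
  "(\<And>x. x \<in> set xs \<Longrightarrow> monic_dop 1 (F x)) \<Longrightarrow> monic_dop (int (length xs)) (prod_list (map F xs))"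
proof (induction xs)
  case (Cons x xs)
  thus ?case using monic_dop_mult[of 1 "F x" "int (length xs)" "prod_list (map F xs)"] by (simp add: add.commute)
qed (simp add: monic_dop_1)

lemma dop_add: "dop N F \<Longrightarrow> dop N G \<Longrightarrow> dop N (F + G)"
  unfolding dop_def cf_simps by (metis add.right_neutral)

lemma dop_0: "dop N 0"
  by (simp add: dop_def cf_simps)

lemma dop_sum: "(\<And>x. x \<in> X \<Longrightarrow> dop N (f x)) \<Longrightarrow> dop N (sum f X)"
  by (induction X rule: infinite_finite_induct) (auto intro: dop_add dop_0)

lemma dop_mono: "dop N F \<Longrightarrow> N \<le> M \<Longrightarrow> dop M F"
  unfolding dop_def by fastforce

text \<open>A permutation other than the identity moves some row and so uses an off-diagonal entry
  of order 0. Its term has order below N, and the top coefficient comes from the diagonal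
  alone.\<close>

lemma monic_dop_rdetR:
  fixes A :: "nat \<Rightarrow> nat \<Rightarrow> 'a::real_algebra_1 pdo"
  assumes "\<And>r. r < N \<Longrightarrow> monic_dop 1 (A r r)" "\<And>r c. r < N \<Longrightarrow> c < N \<Longrightarrow> r \<noteq> c \<Longrightarrow> dop 0 (A r c)"
  shows "monic_dop (int N) (rdetR N A)"
proof -
  let ?t = "\<lambda>\<sigma>. of_int (sign \<sigma>) * lprod (\<lambda>r. A r (\<sigma> r)) N"
  let ?S = "{\<sigma>. \<sigma> permutes {..<N}}"
  have id: "monic_dop (int N) (?t id)"
    using monic_dop_prod_list[of "[0..<N]" "\<lambda>r. A r r"] assms(1) by simp
  have o: "dop (int N - 1) (?t \<sigma>)" if s: "\<sigma> \<in> ?S - {id}" for \<sigma>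
  proof -
    have sp: "\<sigma> permutes {..<N}" "\<sigma> \<noteq> id" using s by auto
    have sl: "\<sigma> r < N" if "r < N" for r using permutes_in_image[OF sp(1), of r] that by auto
    obtain i where i: "\<sigma> i \<noteq> i" using sp(2) by (metis eq_id_iff)
    hence iN: "i < N" using sp(1) by (metis lessThan_iff permutes_def)
    let ?e = "\<lambda>r. if \<sigma> r = r then 1 else 0 :: int"
    have "dop (\<Sum>r<N. ?e r) (lprod (\<lambda>r. A r (\<sigma> r)) N)"
      by (rule dop_prod_list) (use assms sl in \<open>auto simp: monic_dop_def\<close>)
    moreover have "(\<Sum>r<N. ?e r) \<le> int N - 1"
    proof -
      have "(\<Sum>r<N. ?e r) = ?e i + (\<Sum>r\<in>{..<N} - {i}. ?e r)" using iN by (simp add: sum.remove)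
      also have "\<dots> \<le> 0 + (\<Sum>r\<in>{..<N} - {i}. 1)" using i by (intro add_mono sum_mono) auto
      also have "\<dots> = int N - 1" using iN by simp
      finally show ?thesis .
    qed
    ultimately have "dop (int N - 1) (lprod (\<lambda>r. A r (\<sigma> r)) N)" by (rule dop_mono)
    moreover have "dop 0 (of_int (sign \<sigma>) :: 'a pdo)" by (simp add: of_int_pdo dop_def cf_pmon)
    ultimately show ?thesis using dop_mult[of 0 _ "int N - 1"] by simp
  qed
  have e: "rdetR N A = ?t id + (\<Sum>\<sigma>\<in>?S - {id}. ?t \<sigma>)"
    unfolding rdetR_def by (rule sum.remove) (auto simp: finite_permutations permutes_id)
  have d: "dop (int N - 1) (\<Sum>\<sigma>\<in>?S - {id}. ?t \<sigma>)" by (rule dop_sum) (rule o)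
  have z: "cf (\<Sum>\<sigma>\<in>?S - {id}. ?t \<sigma>) (a, int N) = 0" for a
    using d unfolding dop_def by force
  show ?thesis unfolding monic_dop_def
  proof
    show "dop (int N) (rdetR N A)" unfolding e
      by (rule dop_add) (use id d in \<open>auto simp: monic_dop_def intro: dop_mono\<close>)
    show "\<forall>a. cf (rdetR N A) (a, int N) = (if a = 0 then 1 else 0)"
      unfolding e plus_pdo.rep_eq z using id by (simp add: monic_dop_def)
  qed
qed

section \<open>Matching the determinants with the Bethe operators\<close>

lemma prod_list_uminus:
  "prod_list (map (\<lambda>x. - f x) xs) = (-1) ^ length xs * (prod_list (map f xs) :: 'r::ring_1)"
proof (induction xs)
  case (Cons x xs)
  show ?case by (cases "even (length xs)") (simp_all add: Cons)
qed simp

lemma rdetR_uminus: "rdetR N (\<lambda>r c. - A r c) = (-1) ^ N * rdetR N A"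
  unfolding rdetR_def prod_list_uminus sum_distrib_left
proof (rule sum.cong[OF refl])
  fix \<sigma> :: "nat \<Rightarrow> nat"
  show "of_int (sign \<sigma>) * ((- 1) ^ length [0..<N] * lprod (\<lambda>r. A r (\<sigma> r)) N) = (- 1) ^ N * (of_int (sign \<sigma>) * lprod (\<lambda>r. A r (\<sigma> r)) N)"
    by (cases "even N") simp_all
qed

lemma sharp_prod_list:
  assumes "\<And>x F. x \<in> set xs \<Longrightarrow> sharp (f x * F) = g x * sharp F"
  shows "sharp (prod_list (map f xs) * F) = prod_list (map g xs) * sharp F"
  using assms by (induction xs) (simp_all add: mult.assoc)

context setting
begin

text \<open>The Bethe matrix of gl_k: under # the entry x - z_a becomes d/dx - z_a, and (alpha_i -
  d/dx)^{-1} becomes (x + alpha_i)^{-1}.\<close>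

definition "Cn a b = (if a = b then pD - pconst (lsc (z a)) else 0)
  - (\<Sum>i<n. xiP (b,i) * xinv (lsc (- alpha i)) * ddP (a,i))"

text \<open>The trailing factor F allows a determinant product to be treated by peeling off one
  entry at a time from the left.\<close>

lemma sharp_Cm_mult: "sharp (wc.Cm a b * F) = Cn a b * sharp F"
proof -
  have "sharp (xiP c * yiP i * ddP e * F) = xiP c * xinv (lsc (- alpha i)) * ddP e * sharp F" for c e i
  proof -
    have "xiP c * yiP i * ddP e * F = xiP c * - (dinv (lsc (alpha i)) * (ddP e * F))"
      by (simp add: yiP_def mult.assoc)
    also have "sharp \<dots> = xiP c * (xinv (- lsc (alpha i)) * sharp (ddP e * F))"
      unfolding xiP_def sharp_pconst_mult sharp_uminus sharp_dinv_mult minus_minus ..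
    also have "sharp (ddP e * F) = ddP e * sharp F" unfolding ddP_def sharp_pconst_mult ..
    finally show ?thesis by (simp add: lsc_hom mult.assoc)
  qed
  thus ?thesis
    by (simp add: wc.Cm_def Cn_def left_diff_distrib sharp_diff sum_distrib_right sharp_sum sharp_0 dP_def sharp_pX_mult sharp_pconst_mult)
qed

lemma sharp_rdetR_Cm: "sharp (rdetR k wc.Cm) = rdetR k Cn"
proof -
  have "sharp (of_int (sign \<sigma>) * lprod (\<lambda>r. wc.Cm r (\<sigma> r)) k) = of_int (sign \<sigma>) * lprod (\<lambda>r. Cn r (\<sigma> r)) k" for \<sigma>
    using sharp_prod_list[of "[0..<k]" "\<lambda>r. wc.Cm r (\<sigma> r)" "\<lambda>r. Cn r (\<sigma> r)" 1]
    by (simp add: of_int_pdo sharp_pconst_mult sharp_Cm_mult sharp_1)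
  thus ?thesis by (simp add: rdetR_def sharp_sum)
qed

lemma reps_A:
  assumes "r < n" "c < n" shows "reps k n (bethe_mat alpha (pi_n k z) r c) (- wc.Am r c)"
proof (rule reps_bethe)
  fix s v assume "v \<in> gU k n"
  thus "pi_n k z s c r v = ap (\<Sum>a<k. lsc (z a) ^ s * (lxi (sites k n) (a,c) * ldd (sites k n) (a,r))) v \<and> pi_n k z s c r v \<in> gU k n"
    using pi_gU(1) assms by blast
next
  fix kk m
  have "xiP (a,c) * ddP (a,r) * diP a = pconst (lxi (sites k n) (a,c) * ldd (sites k n) (a,r)) * xinv (lsc (z a))" if "a < k" for a
    using that assms by (simp add: xiP_def ddP_def diP_def flip: pconst_mult)
  hence 1: "cf (\<Sum>a<k. xiP (a,c) * ddP (a,r) * diP a) (kk,m)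
     = (if m = 0 \<and> kk \<le> -1 then (\<Sum>a<k. lsc (z a) ^ nat (- kk - 1) * (lxi (sites k n) (a,c) * ldd (sites k n) (a,r))) else 0)"
    by (auto simp: cf_sum cf_pconst_mult cf_xinv lsc_cm intro!: sum.neutral simp flip: lsc_hom(7))
  show "cf (- wc.Am r c) (kk,m) = (if r = c then (if kk = 0 \<and> m = 1 then 1 else if kk = 0 \<and> m = 0 then lsc (- alpha r) else 0) else 0)
        - (if m = 0 \<and> kk \<le> -1 then (\<Sum>a<k. lsc (z a) ^ nat (- kk - 1) * (lxi (sites k n) (a,c) * ldd (sites k n) (a,r))) else 0)"
    unfolding wc.Am_def minus_add cf_simps 1 by (auto simp: cf_simps yP_def cf_pmon lsc_hom)
qed

lemma reps_C:
  assumes "r < k" "c < k" shows "reps k n (bethe_mat z (pi_k n alpha) r c) (Cn r c)"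
proof (rule reps_bethe)
  fix s v assume "v \<in> gU k n"
  thus "pi_k n alpha s c r v = ap (\<Sum>i<n. lsc (- alpha i) ^ s * (lxi (sites k n) (c,i) * ldd (sites k n) (r,i))) v \<and> pi_k n alpha s c r v \<in> gU k n"
    using pi_gU(2) assms by blast
next
  fix kk m
  have "cf (xiP (c,i) * xinv (lsc (- alpha i)) * ddP (r,i)) (kk,m) = (if m = 0 \<and> kk \<le> -1 then lsc (- alpha i) ^ nat (- kk - 1) * (lxi (sites k n) (c,i) * ldd (sites k n) (r,i)) else 0)" if "i < n" for i
  proof -
    have "lxi (sites k n) (c,i) * lsc x * ldd (sites k n) (r,i) = lsc x * (lxi (sites k n) (c,i) * ldd (sites k n) (r,i))" for x
      by (simp add: lsc_cm[of x "lxi (sites k n) (c,i)", symmetric] mult.assoc)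
    thus ?thesis using that assms
      by (simp add: xiP_def ddP_def cf_mult_pconst cf_pconst_mult cf_xinv flip: lsc_hom(7))
  qed
  hence 1: "cf (\<Sum>i<n. xiP (c,i) * xinv (lsc (- alpha i)) * ddP (r,i)) (kk,m)
     = (if m = 0 \<and> kk \<le> -1 then (\<Sum>i<n. lsc (- alpha i) ^ nat (- kk - 1) * (lxi (sites k n) (c,i) * ldd (sites k n) (r,i))) else 0)"
    by (auto simp: cf_sum intro!: sum.neutral)
  show "cf (Cn r c) (kk,m) = (if r = c then (if kk = 0 \<and> m = 1 then 1 else if kk = 0 \<and> m = 0 then lsc (- z r) else 0) else 0)
        - (if m = 0 \<and> kk \<le> -1 then (\<Sum>i<n. lsc (- alpha i) ^ nat (- kk - 1) * (lxi (sites k n) (c,i) * ldd (sites k n) (r,i))) else 0)"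
    unfolding Cn_def minus_pdo.rep_eq 1 by (auto simp: cf_simps cf_pmon lsc_hom)
qed

lemma monic_A: "monic_dop (int n) (rdetR n (\<lambda>r c. - wc.Am r c))"
proof (rule monic_dop_rdetR)
  have d: "dop 0 (\<Sum>a<k. xiP (a,c) * ddP (a,r) * diP a)" for r c
  proof (rule dop_sum)
    fix a
    have "dop 0 (diP a)" by (auto simp: dop_def diP_def cf_xinv split: prod.splits if_splits)
    moreover have "dop 0 (xiP (a,c))" "dop 0 (ddP (a,r))" by (auto simp: dop_def xiP_def ddP_def cf_pmon)
    ultimately show "dop 0 (xiP (a,c) * ddP (a,r) * diP a)"
      using dop_mult[OF dop_mult] by fastforce
  qed
  have d': "dop 0 (- (\<Sum>a<k. xiP (a,c) * ddP (a,r) * diP a))" for r c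
    using d unfolding dop_def cf_simps by simp
  show "dop 0 (- wc.Am r c)" if "r \<noteq> c" for r c using d' that by (simp add: wc.Am_def)
  show "monic_dop 1 (- wc.Am r r)" for r
  proof -
    let ?S = "\<Sum>a<k. xiP (a,r) * ddP (a,r) * diP a" and ?D = "pD - pconst (lsc (alpha r))"
    have e: "- wc.Am r r = ?D + - ?S" by (simp add: wc.Am_def yP_def)
    have 1: "dop 1 ?D" by (auto simp: dop_def cf_simps cf_pmon)
    have 2: "cf (- ?S) (a, 1) = 0" for a using d'[of r r] unfolding dop_def by force
    show ?thesis unfolding monic_dop_def e
    proof
      show "dop 1 (?D + - ?S)" by (rule dop_add[OF 1 dop_mono[OF d']]) simp
      show "\<forall>a. cf (?D + - ?S) (a, 1) = (if a = 0 then 1 else 0)"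
        unfolding plus_pdo.rep_eq 2 by (simp add: cf_simps cf_pmon)
    qed
  qed
qed

section \<open>The determinant identity on an eigenvector\<close>

definition "P0 = lprod (\<lambda>i. pD - pconst (alpha i)) n"
definition "Gc = lprod (\<lambda>a. pX - pconst (z a)) k"

lemma emb_prod_list: "emb (prod_list xs) = prod_list (map emb xs)"
  by (induction xs) (simp_all add: emb_1 emb_mult)

lemma emb_Gc: "emb Gc = wc.G"
  unfolding Gc_def wc.G_def emb_prod_list map_map
  by (rule arg_cong[of _ _ prod_list], rule map_cong) (simp_all add: dP_def emb_diff emb_pmon lsc_hom(3))

lemma emb_P0: "emb P0 = (-1) ^ n * lprod yP n"
proof -
  have "emb P0 = lprod (\<lambda>i. - yP i) n"
    unfolding P0_def emb_prod_list yP_def by (simp add: o_def emb_diff emb_pmon lsc_hom)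
  thus ?thesis by (simp add: prod_list_uminus)
qed

text \<open>On v the identity reads C G^{-1} Daug = P0, where C is the first determinant. One
  coordinate of it gives a scalar operator H' with H' Daug = P0, and inverting P0 yields the inverse
  L of Daug. Multiplying the identity by L G on the right then isolates C = P0 L G on v, and # is
  applied to both sides.\<close>

lemma eigenvalue_duality:
  assumes v: "v S0 \<noteq> 0" and eig: "veq v (rdetR n (\<lambda>r c. - wc.Am r c)) (emb Daug)"
  obtains L where "Daug * L = 1" "L * Daug = 1" "veq v (rdetR k Cn) (emb (sharp (P0 * L * Gc)))"
proof -
  let ?C = "rdetR k wc.Cm" and ?A = "rdetR n wc.Am"
  have cm: "(-1) ^ n * x = x * (-1) ^ n" for x :: "lop pdo" by (cases "even n") simp_all
  have "?C * wc.Gi * ((-1) ^ n * ?A) = emb P0"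
    unfolding cm emb_P0 wc.rdet_duality[symmetric] by (simp add: mult.assoc)
  hence "veq v (?C * wc.Gi * emb Daug) (emb P0)"
    using veq_mult[OF eig, of "?C * wc.Gi"] unfolding rdetR_uminus by (simp add: veq_def)
  note 1 = this
  obtain H' where H': "H' * Daug = P0" using lin_functional_left_inverse[OF v 1] by blast
  define P0i where "P0i = prod_list (map (\<lambda>i. dinv (alpha i)) (rev [0..<n]))"
  have "prod_list (map (\<lambda>i. dinv (alpha i)) (rev xs)) * prod_list (map (\<lambda>i. pD - pconst (alpha i)) (rev (rev xs))) = 1" for xs
    by (rule prod_list_map_inverse) (rule dinv_left)
  hence P0i: "P0i * P0 = 1" unfolding P0i_def P0_def by (metis rev_rev_ident)
  define L where "L = P0i * H'"
  have L: "L * Daug = 1" by (simp add: L_def mult.assoc H' P0i)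
  have L': "Daug * L = 1" by (rule pdo_left_inverse_right[OF L])
  have "veq v (?C * wc.Gi * emb Daug * emb (L * Gc)) (emb P0 * emb (L * Gc))"
    by (rule veq_mult_emb[OF 1])
  moreover have "?C * wc.Gi * emb Daug * emb (L * Gc) = ?C"
  proof -
    have "?C * wc.Gi * emb Daug * emb (L * Gc) = ?C * wc.Gi * emb (Daug * L * Gc)" by (simp add: emb_mult mult.assoc)
    also have "\<dots> = ?C * (wc.Gi * wc.G)" by (simp add: L' emb_Gc mult.assoc)
    finally show ?thesis by (simp add: wc.G_Gi)
  qed
  ultimately have "veq v ?C (emb (P0 * L * Gc))" by (simp add: emb_mult mult.assoc)
  hence "veq v (rdetR k Cn) (emb (sharp (P0 * L * Gc)))"
    using veq_sharp by (fastforce simp: sharp_rdetR_Cm sharp_emb)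
  thus ?thesis using that L L' by blast
qed

lemma sharp_P0_Gc:
  "sharp (P0 * L * Gc) = lprod (\<lambda>i. - (pX + pconst (alpha i))) n * sharp L * lprod (\<lambda>a. pD - pconst (z a)) k"
proof -
  have r: "sharp (F * prod_list (map (\<lambda>a. pX - pconst (z a)) xs)) = sharp F * prod_list (map (\<lambda>a. pD - pconst (z a)) xs)" for F xs
  proof (induction xs arbitrary: F)
    case (Cons x xs)
    thus ?case using Cons[of "F * (pX - pconst (z x))"] by (simp add: sharp_mult_X_minus mult.assoc)
  qed simp
  have "sharp (P0 * (L * Gc)) = lprod (\<lambda>i. - (pX + pconst (alpha i))) n * sharp (L * Gc)"
    unfolding P0_def by (rule sharp_prod_list) (simp only: sharp_D_minus_mult mult_minus_left)
  moreover have "sharp (L * Gc) = sharp L * lprod (\<lambda>a. pD - pconst (z a)) k"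
    unfolding Gc_def r ..
  ultimately show ?thesis by (simp only: mult.assoc)
qed

end

section \<open>The eigenvalue correspondence\<close>

lemma list_comp_filter: "concat (map (\<lambda>x. if P x then [f x] else []) xs) = map f (filter P xs)"
  by (induction xs) auto

lemma conj1_mu_of: "conj1 (mu_of m i) = (if m i = 0 then 0 else 1)"
proof -
  have "{j. 1 \<le> j \<and> mu_of m i j \<noteq> 0} = (if m i = 0 then {} else {1})" by (auto simp: mu_of_def)
  thus ?thesis by (simp add: conj1_def)
qed

text \<open>A nonzero one-row partition contributes exactly one basis function, so dim V is the
  number of nonzero m i.\<close>

lemma card_qe_index: "card (qe_index n (mu_of m)) = length (filter (\<lambda>i. m i \<noteq> 0) [0..<n])"
proof -
  have "qe_index n (mu_of m) = (\<lambda>i. (i, 1)) ` set (filter (\<lambda>i. m i \<noteq> 0) [0..<n])"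
    by (auto simp: qe_index_def conj1_mu_of split: if_splits)
  thus ?thesis by (simp add: card_image inj_on_def distinct_card[symmetric])
qed

text \<open>The factors with exponent 0 in the definition of the transformed operator are exactly
  those supplied by augmentation; commuting factors merge into the full product.\<close>

lemma prod_list_split_filter:
  fixes g :: "nat \<Rightarrow> 'r::ring_1"
  assumes "\<And>x y. cm (g x) (g y)"
  shows "prod_list (map (\<lambda>x. g x ^ (if P x then 1 else 0)) xs) * prod_list (map g (filter (\<lambda>x. \<not> P x) xs)) = prod_list (map g xs)"
proof (induction xs)
  case (Cons x xs)
  let ?A = "prod_list (map (\<lambda>x. g x ^ (if P x then 1 else 0)) xs)" and ?B = "prod_list (map g (filter (\<lambda>x. \<not> P x) xs))"
  have "cm (g x) ?A" by (rule cm_prod_list) (auto intro: assms)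
  hence "?A * (g x * ?B) = g x * (?A * ?B)" by (simp add: cm_def mult.assoc[symmetric])
  thus ?case using Cons by (simp add: mult.assoc)
qed simp

text \<open>Explains the sign (-1)^M': it gives one minus to each factor x + alpha_i that occurs
  with exponent 1. The minus signs of the other factors come from # itself.\<close>

lemma prod_list_pow_uminus:
  fixes h :: "nat \<Rightarrow> 'r::ring_1"
  shows "(-1) ^ length (filter P xs) * prod_list (map (\<lambda>x. h x ^ (if P x then 1 else 0)) xs) = prod_list (map (\<lambda>x. (- h x) ^ (if P x then 1 else 0)) xs)"
proof (induction xs)
  case (Cons x xs)
  show ?case
    unfolding list.map prod_list.Cons Cons[symmetric]
    by (cases "even (length (filter P xs))") simp_all
qed simp

lemma cm_X_plus: "cm (- (pX + pconst (a::complex))) (- (pX + pconst b))"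
proof -
  have c: "pconst a * F = F * pconst a" for a and F :: "complex pdo" by (rule pconst_cm)
  have "cm (pX + pconst a) (pX + pconst b)"
    unfolding cm_def by (simp add: distrib_left distrib_right c[of _ pX] c[of a "pconst b"])
  thus ?thesis by (simp only: cm_def mult_minus_left mult_minus_right)
qed

lemma cm_D_minus: "cm (pD - pconst (a::complex)) (pD - pconst b)"
proof -
  have c: "pconst a * F = F * pconst a" for a and F :: "complex pdo" by (rule pconst_cm)
  show ?thesis
    unfolding cm_def by (simp add: left_diff_distrib right_diff_distrib c[of _ pD] c[of a "pconst b"])
qed

lemma monic_D_minus: "monic_dop 1 (pD - pconst c)"
  by (auto simp: monic_dop_def dop_def cf_simps cf_pmon)

lemma monic_dop_outside:
  assumes "monic_dop N F" "b < 0 \<or> N \<le> b" "0 \<le> N"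
  shows "cf F (a, b) = (if a = 0 \<and> b = N then 1 else 0)"
proof (cases "b = N")
  case True
  thus ?thesis using assms by (simp add: monic_dop_def)
next
  case False
  have "cf F (a, b) = 0"
  proof (rule ccontr)
    assume "cf F (a, b) \<noteq> 0"
    hence "0 \<le> b \<and> b \<le> N" using assms(1) unfolding monic_dop_def dop_def by force
    thus False using assms False by linarith
  qed
  thus ?thesis using False by simp
qed

lemma DV_psd_monic: "DV_psd M p q = psd_of D \<Longrightarrow> monic_dop (int M) D"
proof -
  assume D: "DV_psd M p q = psd_of D"
  have "cf D (a, b) = DV_psd M p q a b" for a b unfolding D by (simp add: psd_of_def)
  thus ?thesis unfolding monic_dop_def dop_def by (auto simp: DV_psd_def split: if_splits)
qed

lemma pconst_minus_one_power: "pconst ((-1) ^ M) = ((-1) ^ M :: complex pdo)"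
  by (cases "even M") (simp_all add: pconst_1 pconst_uminus)

theorem theorem5p7:
  fixes k n :: nat and l m :: "nat \<Rightarrow> nat"
  assumes "1 \<le> k" and "1 \<le> n" and "(l, m) \<in> Zkn k n"
  shows "\<exists>P \<in> poly_fun n k. (\<exists>al zz. P al zz \<noteq> 0) \<and>
    (\<forall>(alpha :: nat \<Rightarrow> complex) (z :: nat \<Rightarrow> complex) V p q v.
       inj_on alpha {..<n} \<and> inj_on z {..<k} \<and> P alpha z \<noteq> 0 \<and>
       quasi_exp_space n k alpha z (mu_of m) (lam_of l) V \<and>
       is_DV V (card (qe_index n (mu_of m))) p q \<and>
       v \<in> Pkn_wt k n l m \<and> v \<noteq> 0 \<and>
       (\<forall>i \<in> {1..n}. \<forall>kk. bethe_coeff n alpha (pi_n k z) i kk v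
          = gscale (DV_aug n alpha (mu_of m) (DV_psd (card (qe_index n (mu_of m))) p q) kk (int n - int i)) v)
     \<longrightarrow>
       (\<forall>a \<in> {1..k}. \<forall>kk. bethe_coeff k z (pi_k n alpha) a kk v
          = gscale (tDV_aug k z l
                      (tDV n k alpha z (mu_of m) (lam_of l) (card (qe_index n (mu_of m)))
                         (DV_psd (card (qe_index n (mu_of m))) p q)) kk (int k - int a)) v))"
proof (rule bexI[where x="\<lambda>_ _. 1"], intro conjI allI impI; (elim conjE)?)
  show "(\<lambda>_ _. 1) \<in> poly_fun n k" by (rule pf_const)
  show "\<exists>(al :: nat \<Rightarrow> complex) (zz :: nat \<Rightarrow> complex). (1::complex) \<noteq> 0" by simp
next
  fix alpha z :: "nat \<Rightarrow> complex" and V p q v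
  define M where "M = card (qe_index n (mu_of m))"
  assume DV: "is_DV V (card (qe_index n (mu_of m))) p q" and vw: "v \<in> Pkn_wt k n l m" and v0: "v \<noteq> 0"
    and eig: "\<forall>i \<in> {1..n}. \<forall>kk. bethe_coeff n alpha (pi_n k z) i kk v
        = gscale (DV_aug n alpha (mu_of m) (DV_psd (card (qe_index n (mu_of m))) p q) kk (int n - int i)) v"
  interpret setting k n alpha z .
  have M: "M = length (filter (\<lambda>i. m i \<noteq> 0) [0..<n])" unfolding M_def by (rule card_qe_index)
  obtain S0 where S0: "v S0 \<noteq> 0" using v0 by (auto simp: fun_eq_iff)
  have vU: "v \<in> gU k n" using vw unfolding Pkn_wt_def gU_def by blast
  obtain D where D: "DV_psd M p q = psd_of D" using DV_psd_psd_of[of M q p] DV by (auto simp: is_DV_def M_def)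
  let ?Z = "filter (\<lambda>i. m i = 0) [0..<n]"
  \<comment> \<open>Q collects the factors by which the augmented operator differs from D_V.\<close>
  define Q where "Q = prod_list (map (\<lambda>i. pD - pconst (alpha i)) ?Z)"
  have mu0: "(\<forall>j. mu_of m i j = 0) \<longleftrightarrow> m i = 0" for i by (auto simp: mu_of_def)
  have aug: "DV_aug n alpha (mu_of m) (DV_psd M p q) = psd_of (D * Q)"
  proof -
    have "psd_of D # [psd_dminus (alpha i). i \<leftarrow> [0..<n], \<forall>j. mu_of m i j = 0] = map psd_of (D # map (\<lambda>i. pD - pconst (alpha i)) ?Z)"
      unfolding mu0 list_comp_filter psd_dminus_psd_of by simp
    thus ?thesis unfolding DV_aug_def D Q_def by (simp only: psd_prod_psd_of prod_list.Cons)
  qed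
  have len: "int M + int (length ?Z) = int n"
    unfolding M using sum_length_filter_compl[of "\<lambda>i. m i \<noteq> 0" "[0..<n]"] by simp
  have monic: "monic_dop (int n) (D * Q)"
    using monic_dop_mult[OF DV_psd_monic[OF D] monic_dop_prod_list[of ?Z "\<lambda>i. pD - pconst (alpha i)"]]
    by (simp add: monic_D_minus len Q_def)
  have relA: "reps k n (rdet n (bethe_mat alpha (pi_n k z))) (rdetR n (\<lambda>r c. - wc.Am r c))"
    by (rule reps_rdet) (rule reps_A)
  have relC: "reps k n (rdet k (bethe_mat z (pi_k n alpha))) (rdetR k Cn)"
    by (rule reps_rdet) (rule reps_C)
  \<comment> \<open>The eigenvalue hypothesis gives the powers of d/dx from 0 to n - 1; at all other
    powers both operators have the coefficients of a monic operator of order n.\<close>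
  have "veq v (rdetR n (\<lambda>r c. - wc.Am r c)) (emb (D * Q))"
    unfolding veq_def
  proof
    fix r :: "int \<times> int"
    obtain kk b where r: "r = (kk, b)" by force
    show "ap (cf (rdetR n (\<lambda>r c. - wc.Am r c)) r) v = ap (cf (emb (D * Q)) r) v"
    proof (cases "0 \<le> b \<and> b < int n")
      case True
      define i where "i = n - nat b"
      have i: "i \<in> {1..n}" "int n - int i = b" using True by (auto simp: i_def)
      have "ap (cf (rdetR n (\<lambda>r c. - wc.Am r c)) r) v = rdet n (bethe_mat alpha (pi_n k z)) kk b v"
        using relA vU unfolding reps_def r by metis
      also have "\<dots> = gscale (DV_aug n alpha (mu_of m) (DV_psd M p q) kk b) v"
        using eig[rule_format, OF i(1), of kk] unfolding bethe_coeff_def i(2) M_def .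
      also have "\<dots> = ap (cf (emb (D * Q)) r) v"
        unfolding aug by (simp add: r cf_emb psd_of_def ap_simps gscale_def)
      finally show ?thesis .
    next
      case False
      hence "b < 0 \<or> int n \<le> b" by auto
      thus ?thesis by (simp add: r cf_emb lsc_hom monic_dop_outside[OF monic] monic_dop_outside[OF monic_A])
    qed
  qed
  then obtain L where L: "(D * Q) * L = 1" "L * (D * Q) = 1" and
    C: "veq v (rdetR k Cn) (emb (sharp (P0 * L * Gc)))"
    using eigenvalue_duality[of v S0 "D * Q"] S0 by blast
  \<comment> \<open>The inverse of the augmented operator D * Q is L, so D itself has inverse Q * L.
    Under # the factor Q turns into the factors -(x + alpha_i) with m i = 0, which the prefactor of
    the transformed operator lacks.\<close>
  have inv: "psd_inv (psd_of D) = psd_of (Q * L)"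
  proof (rule psd_inv_psd_of)
    show "D * (Q * L) = 1" using L by (simp add: mult.assoc)
    thus "Q * L * D = 1" by (rule pdo_left_inverse_right)
  qed
  have sQL: "sharp (Q * L) = prod_list (map (\<lambda>i. - (pX + pconst (alpha i))) ?Z) * sharp L"
    unfolding Q_def by (rule sharp_prod_list) (simp only: sharp_D_minus_mult mult_minus_left)
  let ?X = "\<lambda>i. pX + pconst (alpha i) :: complex pdo" and ?E = "\<lambda>a. pD - pconst (z a) :: complex pdo"
  let ?Xs = "map (\<lambda>i. ?X i ^ (if m i \<noteq> 0 then 1 else 0)) [0..<n]"
  let ?Es = "map (\<lambda>a. ?E a ^ (if l a \<noteq> 0 then 1 else 0)) [0..<k]"
  have "tDV n k alpha z (mu_of m) (lam_of l) M (DV_psd M p q)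
     = psd_prod (map psd_of ([pconst ((-1) ^ M)] @ ?Xs @ [sharp (Q * L)] @ ?Es))"
    unfolding tDV_def D inv psd_sharp_psd_of psd_const_psd_of psd_poly_psd_of psd_dminus_psd_of psd_pow_psd_of
    by (intro arg_cong[of _ _ psd_prod]) (auto simp: conj1_mu_of lam_of_def)
  hence t: "tDV n k alpha z (mu_of m) (lam_of l) M (DV_psd M p q) = psd_of (prod_list ([pconst ((-1) ^ M)] @ ?Xs @ [sharp (Q * L)] @ ?Es))"
    by (simp only: psd_prod_psd_of)
  have "tDV_aug k z l (tDV n k alpha z (mu_of m) (lam_of l) M (DV_psd M p q))
     = psd_of (prod_list ([pconst ((-1) ^ M)] @ ?Xs @ [sharp (Q * L)] @ ?Es) * prod_list (map ?E (filter (\<lambda>a. l a = 0) [0..<k])))"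
    (is "_ = psd_of ?R")
  proof -
    have "psd_of F # [psd_dminus (z a). a \<leftarrow> [0..<k], l a = 0] = map psd_of (F # map ?E (filter (\<lambda>a. l a = 0) [0..<k]))" for F
      unfolding list_comp_filter psd_dminus_psd_of by simp
    thus ?thesis unfolding t tDV_aug_def by (simp only: psd_prod_psd_of prod_list.Cons)
  qed
  moreover have "?R = sharp (P0 * L * Gc)"
  proof -
    \<comment> \<open>Of the n minus signs, M come from the prefactor (-1)^M and the rest from #
      applied to Q.\<close>
    have 1: "(-1) ^ M * prod_list ?Xs * prod_list (map (\<lambda>i. - ?X i) ?Z) = lprod (\<lambda>i. - ?X i) n"
      unfolding M prod_list_pow_uminus
      using prod_list_split_filter[of "\<lambda>i. - ?X i" "\<lambda>i. m i \<noteq> 0" "[0..<n]"] cm_X_plus by simp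
    have 2: "prod_list ?Es * prod_list (map ?E (filter (\<lambda>a. l a = 0) [0..<k])) = lprod ?E k"
      using prod_list_split_filter[of ?E "\<lambda>a. l a \<noteq> 0" "[0..<k]"] cm_D_minus by simp
    have "?R = ((-1) ^ M * prod_list ?Xs * prod_list (map (\<lambda>i. - ?X i) ?Z)) * sharp L * (prod_list ?Es * prod_list (map ?E (filter (\<lambda>a. l a = 0) [0..<k])))"
      unfolding sQL pconst_minus_one_power prod_list.append prod_list.Cons prod_list.Nil mult_1_right by (simp only: mult.assoc)
    thus ?thesis unfolding 1 2 sharp_P0_Gc .
  qed
  ultimately have T: "tDV_aug k z l (tDV n k alpha z (mu_of m) (lam_of l) M (DV_psd M p q)) = psd_of (sharp (P0 * L * Gc))"
    by (simp only:)
  show "\<forall>a \<in> {1..k}. \<forall>kk. bethe_coeff k z (pi_k n alpha) a kk v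
        = gscale (tDV_aug k z l
                    (tDV n k alpha z (mu_of m) (lam_of l) (card (qe_index n (mu_of m)))
                       (DV_psd (card (qe_index n (mu_of m))) p q)) kk (int k - int a)) v"
    unfolding M_def[symmetric] T
  proof (intro ballI allI)
    fix a kk
    have "bethe_coeff k z (pi_k n alpha) a kk v = ap (cf (rdetR k Cn) (kk, int k - int a)) v"
      unfolding bethe_coeff_def using relC vU unfolding reps_def by blast
    also have "\<dots> = ap (cf (emb (sharp (P0 * L * Gc))) (kk, int k - int a)) v"
      using C unfolding veq_def by blast
    finally show "bethe_coeff k z (pi_k n alpha) a kk v = gscale (psd_of (sharp (P0 * L * Gc)) kk (int k - int a)) v"
      by (simp add: cf_emb ap_simps gscale_def psd_of_def)
  qed
qed

end
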